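(* Let $k\ge 1$, let $Z$ be a finite set of pairwise different points in $\check{\mathbb{P}}^2$, let $P$ be a general point of $\check{\mathbb{P}}^2$, let $f$ be the product of the linear forms defining the lines dual to the points of $Z$, and let $L\subset\mathbb{P}^2$ be the (generic) line dual to $P$. Let $(a_1,a_2,\dots,a_{k+1})$ be the splitting type on $L$ of the (rank $k+1$) bundle of syzygies of $(J/f)^k(|Z|-1)$. Write $$(a_1,a_2,\dots,a_{k+1})=(a,\dots,a,a+\epsilon_1,\dots,a+\epsilon_1,a+\epsilon_2,\dots,a+\epsilon_2,a+\epsilon_3,\dots,a+\epsilon_s),$$ where $\epsilon_0=0$, $1\le\epsilon_1$ and $\epsilon_i<\epsilon_{i+1}$, and where $a+\epsilon_i$, for $i=0,1,\dots,s$, appears in the sequence $t_i$ times, $t_0+\dots+t_s=k+1$. Take syzygies of $(J/f)^k(|Z|-1)$ of degree $a+\epsilon_j$, for a given $j\in\{0,1,\dots,s\}$. Then the associated curve $C_L$ of type $(a+\epsilon_j+k,\,a+\epsilon_j)$ is unexpected if: 1. $Z$ imposes independent conditions on curves of degree $a+\epsilon_j+k$, and 2. $0<\sum_{i=j+1}^{s}t_i(\epsilon_i-\epsilon_j-1)$.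
   Context: $S=\mathbb{C}[x,y,z]$; $\check{\mathbb{P}}^2$ is the projective plane dual to $\mathbb{P}^2$; $J=(f_x,f_y,f_z)$ is the Jacobian ideal of $f$. For a homogeneous ideal $I$, $[I]_t$ is the vector space of forms of degree $t$ in $I$. Unexpectedness. $I_Z$ is the saturated homogeneous ideal of $Z$, and $I_{Z+dP}$ is the ideal of forms vanishing on $Z$ and to order at least $d$ at $P$. A curve $C$ given as the zero set of a form in $[I_Z]_{d+k}$ having a point of multiplicity $d$ at the generic point $P$ is called unexpected of type $(d+k,d)$ if $\dim[I_{Z+dP}]_{d+k}>\max\left(0,\dim[I_Z]_{d+k}-\binom{d+1}{2}\right)$; moreover it is assumed that vanishing on $Z$ imposes independent conditions on forms of degree $d+k$. Bundle of syzygies. Let $\mathrm{Der}^k(S)\cong S^{\binom{k+2}{2}}$ be the free $S$-module on the formal products $\partial_x^{i_1}\partial_y^{i_2}\partial_z^{i_3}$, $i_1+i_2+i_3=k$ (products of first-order derivations, not higher-order derivatives), graded by the degree of the coefficients. Let $D^k(\mathcal{A})$ be the kernel of the map $\phi:S^{\binom{k+2}{2}}\to(J/f)^k(|Z|-1)$, $\phi\big((g_{i_1,i_2,i_3})\big)=\sum_{i_1+i_2+i_3=k}g_{i_1,i_2,i_3}f_x^{i_1}f_y^{i_2}f_z^{i_3}\pmod f$ (the twist is such that $\phi$ is a degree-preserving surjection; $(J/f)^k$ is the $k$-th power of the ideal $J/fS$ of $S/fS$). For each of the $\binom{k+1}{2}$ triples with $i_1+i_2+i_3=k-1$ there is an Euler-type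 element $E=(x\partial_x+y\partial_y+z\partial_z)\cdot\partial_x^{i_1}\partial_y^{i_2}\partial_z^{i_3}\in D^k(\mathcal{A})$; list them as $E_1,\dots,E_{\binom{k+1}{2}}$. Put $D^k_0(\mathcal{A})=D^k(\mathcal{A})/(SE_1\oplus\dots\oplus SE_{\binom{k+1}{2}})$. The rank $k+1$ bundle $\mathcal{S}$ of syzygies of $(J/f)^k(|Z|-1)$ is the sheafification on $\mathbb{P}^2$ of $D_0^k(\mathcal{A})$; its splitting type on $L$ is $(a_1,\dots,a_{k+1})$, $0\le a_1\le\dots\le a_{k+1}$, where $\mathcal{S}|_L\cong\bigoplus_i\mathcal{O}_L(-a_i)$. Curve $C_L$. Let $P=(\alpha,\beta,\gamma)$, so $L$ is $\alpha a+\beta b+\gamma c=0$. A syzygy of degree $d$ on $L$ (a section of $\mathcal{S}|_L(d)$; here $d=a+\epsilon_j$ is the degree of a generator of the splitting) is represented by a tuple $(g_{i_1,i_2,i_3})_{i_1+i_2+i_3=k}$ of forms of degree $d$ on $L$. The curve $C_L\subset\check{\mathbb{P}}^2$ is the locus swept out, as $Q=(a,b,c)$ moves along $L$, by the points $(x,y,z)$ with $ax+by+cz=0$ and $\sum g_{i_1,i_2,i_3}(Q)x^{i_1}y^{i_2}z^{i_3}=0$; its equation is $\sum g_{i_1,i_2,i_3}(\gamma y-\beta z,\alpha z-\gamma x,\beta x-\alpha y)\,x^{i_1}y^{i_2}z^{i_3}=0$. It has degree $d+k$, passes through $Z$, and has multiplicity $d$ at $P$ (type $(d+k,d)$). *)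

theory Defs
  imports Complex_Main "HOL-Library.Poly_Mapping" "HOL-Library.Product_Plus"
begin

section \<open>Polynomials in three variables\<close>

type_synonym mon = "nat \<times> nat \<times> nat"

type_synonym 'c poly3 = "mon \<Rightarrow>\<^sub>0 'c"

type_synonym S = "complex poly3"

text \<open>Homogeneous coordinates, in the projective plane or in its dual.\<close>

type_synonym point = "complex \<times> complex \<times> complex"

fun mdeg :: "mon \<Rightarrow> nat" where
  "mdeg (i, j, l) = i + j + l"

definition is_form :: "nat \<Rightarrow> 'c::zero poly3 \<Rightarrow> bool" where
  "is_form n p \<longleftrightarrow> (\<forall>m\<in>Poly_Mapping.keys p. mdeg m = n)"

definition tdeg :: "'c::zero poly3 \<Rightarrow> nat" where
  "tdeg p = Max (insert 0 (mdeg ` Poly_Mapping.keys p))"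

definition nonzero_form :: "S \<Rightarrow> bool" where
  "nonzero_form h \<longleftrightarrow> h \<noteq> 0 \<and> is_form (tdeg h) h"

definition pos_form :: "S \<Rightarrow> bool" where
  "pos_form h \<longleftrightarrow> nonzero_form h \<and> 0 < tdeg h"

definition smul :: "'c::mult_zero \<Rightarrow> ('i \<Rightarrow>\<^sub>0 'c) \<Rightarrow> ('i \<Rightarrow>\<^sub>0 'c)" where
  "smul c p = Poly_Mapping.map ((*) c) p"

lemma lookup_smul: "Poly_Mapping.lookup (smul c p) i = c * Poly_Mapping.lookup p i"
  by (simp add: smul_def Poly_Mapping.map.rep_eq when_def)

global_interpretation free_mod: module "smul :: S \<Rightarrow> ('i \<Rightarrow>\<^sub>0 S) \<Rightarrow> ('i \<Rightarrow>\<^sub>0 S)"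
  by unfold_locales
    (auto intro!: poly_mapping_eqI simp: lookup_smul lookup_add algebra_simps)

global_interpretation form_space: vector_space "smul :: complex \<Rightarrow> S \<Rightarrow> S"
  by unfold_locales
    (auto intro!: poly_mapping_eqI simp: lookup_smul lookup_add algebra_simps)

definition const :: "'c::zero \<Rightarrow> 'c poly3" where
  "const c = Poly_Mapping.single (0, 0, 0) c"

definition var_x :: "'c::zero_neq_one poly3" where "var_x = Poly_Mapping.single (1, 0, 0) 1"
definition var_y :: "'c::zero_neq_one poly3" where "var_y = Poly_Mapping.single (0, 1, 0) 1"
definition var_z :: "'c::zero_neq_one poly3" where "var_z = Poly_Mapping.single (0, 0, 1) 1"

definition subst :: "('c::zero \<Rightarrow> 'r) \<Rightarrow> 'r \<Rightarrow> 'r \<Rightarrow> 'r \<Rightarrow> 'c poly3 \<Rightarrow> 'r::comm_semiring_1" where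
  "subst \<sigma> u v w p =
     (\<Sum>(i, j, l)\<in>Poly_Mapping.keys p. \<sigma> (Poly_Mapping.lookup p (i, j, l)) * u ^ i * v ^ j * w ^ l)"

fun peval :: "S \<Rightarrow> point \<Rightarrow> complex" where
  "peval p (a, b, c) = subst id a b c p"

definition pd_x :: "S \<Rightarrow> S" where
  "pd_x p = (\<Sum>(i, j, l)\<in>Poly_Mapping.keys p.
     Poly_Mapping.single (i - 1, j, l) (of_nat i * Poly_Mapping.lookup p (i, j, l)))"

definition pd_y :: "S \<Rightarrow> S" where
  "pd_y p = (\<Sum>(i, j, l)\<in>Poly_Mapping.keys p.
     Poly_Mapping.single (i, j - 1, l) (of_nat j * Poly_Mapping.lookup p (i, j, l)))"

definition pd_z :: "S \<Rightarrow> S" where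
  "pd_z p = (\<Sum>(i, j, l)\<in>Poly_Mapping.keys p.
     Poly_Mapping.single (i, j, l - 1) (of_nat l * Poly_Mapping.lookup p (i, j, l)))"


section \<open>Points, genericity and unexpected curves\<close>

fun pscale :: "complex \<Rightarrow> point \<Rightarrow> point" where
  "pscale t (a, b, c) = (t * a, t * b, t * c)"

definition same_point :: "point \<Rightarrow> point \<Rightarrow> bool" where
  "same_point p q \<longleftrightarrow> (\<exists>t. t \<noteq> 0 \<and> q = pscale t p)"

text \<open>A finite set of points of the projective plane, given by one nonzero coordinate vector
  for each point.\<close>

definition point_set :: "point set \<Rightarrow> bool" where
  "point_set Z \<longleftrightarrow> finite Z \<and> 0 \<notin> Z \<and> (\<forall>p\<in>Z. \<forall>q\<in>Z. p \<noteq> q \<longrightarrow> \<not> same_point p q)"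

text \<open>The property holds on a nonempty Zariski open set; every such set contains the
  complement of a plane curve.\<close>

definition for_general_point :: "(point \<Rightarrow> bool) \<Rightarrow> bool" where
  "for_general_point Q \<longleftrightarrow>
     (\<exists>h. nonzero_form h \<and> (\<forall>P. P \<noteq> 0 \<and> peval h P \<noteq> 0 \<longrightarrow> Q P))"

text \<open>A polynomial lies in the homogeneous ideal of a set of projective points iff it
  vanishes on the affine cone over that set; likewise for the order of vanishing.\<close>

definition ideal_pts :: "point set \<Rightarrow> S set" where
  "ideal_pts Z = {F. \<forall>p\<in>Z. \<forall>t. peval F (pscale t p) = 0}"

definition ideal_pts_fat :: "point set \<Rightarrow> nat \<Rightarrow> point \<Rightarrow> S set" where
  "ideal_pts_fat Z d P = {F \<in> ideal_pts Z. \<forall>i j l t. i + j + l < d \<longrightarrow>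
     peval ((pd_x ^^ i) ((pd_y ^^ j) ((pd_z ^^ l) F))) (pscale t P) = 0}"

definition graded_part :: "S set \<Rightarrow> nat \<Rightarrow> S set" where
  "graded_part I n = {F \<in> I. is_form n F}"

text \<open>The linear conditions \<open>F(p) = 0\<close>, for \<open>p\<close> in \<open>Z\<close>, on forms of degree \<open>n\<close> are linearly
  independent.\<close>

definition independent_conditions :: "point set \<Rightarrow> nat \<Rightarrow> bool" where
  "independent_conditions Z n \<longleftrightarrow>
     (\<forall>c. (\<forall>F. is_form n F \<longrightarrow> (\<Sum>p\<in>Z. c p * peval F p) = 0) \<longrightarrow> (\<forall>p\<in>Z. c p = 0))"

text \<open>The curve is given by its equation \<open>F\<close>; its type is \<open>(n, d)\<close>. As in the definition of
  \<^const>\<open>ideal_pts_fat\<close>, multiplicity \<open>d\<close> at \<open>P\<close> means vanishing to order at least \<open>d\<close>.\<close>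

definition unexpected_curve :: "point set \<Rightarrow> point \<Rightarrow> nat \<Rightarrow> nat \<Rightarrow> S \<Rightarrow> bool" where
  "unexpected_curve Z P n d F \<longleftrightarrow>
     F \<noteq> 0 \<and> F \<in> graded_part (ideal_pts_fat Z d P) n \<and>
     independent_conditions Z n \<and>
     int (form_space.dim (graded_part (ideal_pts_fat Z d P) n)) >
       max 0 (int (form_space.dim (graded_part (ideal_pts Z) n)) - int ((d + 1) choose 2))"


section \<open>Coherent sheaves on the projective plane\<close>

text \<open>A graded subquotient \<open>num / den\<close> of the graded free module \<open>\<Oplus>\<^sub>i S(- shift i)\<close>.\<close>

record 'i gmod =
  shift :: "'i \<Rightarrow> nat"
  num :: "('i \<Rightarrow>\<^sub>0 S) set"
  den :: "('i \<Rightarrow>\<^sub>0 S) set"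

definition hom_elem :: "'i gmod \<Rightarrow> nat \<Rightarrow> ('i \<Rightarrow>\<^sub>0 S) \<Rightarrow> bool" where
  "hom_elem M n v \<longleftrightarrow>
     (\<forall>i. \<forall>m\<in>Poly_Mapping.keys (Poly_Mapping.lookup v i). mdeg m + shift M i = n)"

text \<open>For the sheaf \<open>F\<close> associated with \<open>M\<close>, the sections of \<open>F(d)\<close> over the open set where
  \<open>h \<noteq> 0\<close> are the elements of degree \<open>d\<close> of the localization \<open>M\<^sub>h\<close>. The pair \<open>(v, n)\<close> stands
  for the fraction \<open>v / h ^ n\<close>.\<close>

definition fracs :: "'i gmod \<Rightarrow> nat \<Rightarrow> S \<Rightarrow> (('i \<Rightarrow>\<^sub>0 S) \<times> nat) set" where
  "fracs M d h = {(v, n). v \<in> num M \<and> hom_elem M (d + n * tdeg h) v}"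

definition frac_rel :: "'i gmod \<Rightarrow> nat \<Rightarrow> S \<Rightarrow> ((('i \<Rightarrow>\<^sub>0 S) \<times> nat) \<times> (('i \<Rightarrow>\<^sub>0 S) \<times> nat)) set" where
  "frac_rel M d h = {((v, n), (v', n')). (v, n) \<in> fracs M d h \<and> (v', n') \<in> fracs M d h \<and>
     (\<exists>N. smul (h ^ N) (smul (h ^ n') v - smul (h ^ n) v') \<in> den M)}"

definition sections :: "'i gmod \<Rightarrow> nat \<Rightarrow> S \<Rightarrow> (('i \<Rightarrow>\<^sub>0 S) \<times> nat) set set" where
  "sections M d h = fracs M d h // frac_rel M d h"

definition sec_zero :: "'i gmod \<Rightarrow> nat \<Rightarrow> S \<Rightarrow> (('i \<Rightarrow>\<^sub>0 S) \<times> nat) set" where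
  "sec_zero M d h = frac_rel M d h `` {(0, 0)}"

definition sec_add ::
  "'i gmod \<Rightarrow> nat \<Rightarrow> S \<Rightarrow> (('i \<Rightarrow>\<^sub>0 S) \<times> nat) set \<Rightarrow> (('i \<Rightarrow>\<^sub>0 S) \<times> nat) set \<Rightarrow> (('i \<Rightarrow>\<^sub>0 S) \<times> nat) set" where
  "sec_add M d h X Y = frac_rel M d h ``
     {(smul (h ^ n') v + smul (h ^ n) v', n + n') | v n v' n'. (v, n) \<in> X \<and> (v', n') \<in> Y}"

text \<open>Multiplication by the regular function \<open>r / h ^ q\<close>.\<close>

definition sec_scale ::
  "'i gmod \<Rightarrow> nat \<Rightarrow> S \<Rightarrow> S \<Rightarrow> nat \<Rightarrow> (('i \<Rightarrow>\<^sub>0 S) \<times> nat) set \<Rightarrow> (('i \<Rightarrow>\<^sub>0 S) \<times> nat) set" where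
  "sec_scale M d h r q X = frac_rel M d h `` {(smul r v, q + n) | v n. (v, n) \<in> X}"

text \<open>Restriction to the open set where \<open>h * g \<noteq> 0\<close>.\<close>

definition sec_res ::
  "'i gmod \<Rightarrow> nat \<Rightarrow> S \<Rightarrow> S \<Rightarrow> (('i \<Rightarrow>\<^sub>0 S) \<times> nat) set \<Rightarrow> (('i \<Rightarrow>\<^sub>0 S) \<times> nat) set" where
  "sec_res M d h g X = frac_rel M d (h * g) `` {(smul (g ^ n) v, n) | v n. (v, n) \<in> X}"

text \<open>Isomorphism, as sheaves of modules, of the sheaves associated with two graded modules;
  the distinguished open sets form a basis of the topology.\<close>

definition sheaf_iso :: "'i gmod \<Rightarrow> 'j gmod \<Rightarrow> bool" where
  "sheaf_iso M N \<longleftrightarrow> (\<exists>\<phi>.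
     (\<forall>h. pos_form h \<longrightarrow>
        bij_betw (\<phi> h) (sections M 0 h) (sections N 0 h) \<and>
        (\<forall>X\<in>sections M 0 h. \<forall>Y\<in>sections M 0 h.
           \<phi> h (sec_add M 0 h X Y) = sec_add N 0 h (\<phi> h X) (\<phi> h Y)) \<and>
        (\<forall>X\<in>sections M 0 h. \<forall>r q. is_form (q * tdeg h) r \<longrightarrow>
           \<phi> h (sec_scale M 0 h r q X) = sec_scale N 0 h r q (\<phi> h X))) \<and>
     (\<forall>h g. pos_form h \<and> nonzero_form g \<longrightarrow>
        (\<forall>X\<in>sections M 0 h. \<phi> (h * g) (sec_res M 0 h g X) = sec_res N 0 h g (\<phi> h X))))"

definition global_section :: "'i gmod \<Rightarrow> nat \<Rightarrow> (S \<Rightarrow> (('i \<Rightarrow>\<^sub>0 S) \<times> nat) set) \<Rightarrow> bool" where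
  "global_section M d \<sigma> \<longleftrightarrow>
     (\<forall>h. pos_form h \<longrightarrow> \<sigma> h \<in> sections M d h) \<and>
     (\<forall>h g. pos_form h \<and> nonzero_form g \<longrightarrow> \<sigma> (h * g) = sec_res M d h g (\<sigma> h))"

text \<open>The linear form with coefficient vector \<open>(a, b, c)\<close>; its zero locus is the line dual to
  the point \<open>(a, b, c)\<close>.\<close>

fun dual_line :: "point \<Rightarrow> S" where
  "dual_line (a, b, c) = const a * var_x + const b * var_y + const c * var_z"

text \<open>The quotient \<open>M / lf M\<close>, whose sheaf is the restriction to the line \<open>lf = 0\<close> of the sheaf
  associated with \<open>M\<close>.\<close>

definition restrict_line :: "S \<Rightarrow> 'i gmod \<Rightarrow> 'i gmod" where
  "restrict_line lf M = M\<lparr>den := {u + smul lf v | u v. u \<in> den M \<and> v \<in> num M}\<rparr>"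

text \<open>The graded module \<open>\<Oplus>\<^sub>i S(- a\<^sub>i)\<close>.\<close>

definition twisted_sum :: "nat list \<Rightarrow> nat gmod" where
  "twisted_sum as = \<lparr>shift = (\<lambda>i. if i < length as then as ! i else 0),
     num = {v. Poly_Mapping.keys v \<subseteq> {..<length as}}, den = {0}\<rparr>"


section \<open>The bundle of syzygies\<close>

definition arr_poly :: "point set \<Rightarrow> S" where
  "arr_poly Z = (\<Prod>p\<in>Z. dual_line p)"

text \<open>Polynomials with coefficients in \<open>S\<close> in the variables \<open>\<partial>\<^sub>x, \<partial>\<^sub>y, \<partial>\<^sub>z\<close>, which are
  \<^const>\<open>var_x\<close>, \<^const>\<open>var_y\<close>, \<^const>\<open>var_z\<close> at type \<^typ>\<open>S poly3\<close>.\<close>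

definition Der :: "nat \<Rightarrow> S poly3 set" where
  "Der k = {g. is_form k g}"

definition syz :: "nat \<Rightarrow> point set \<Rightarrow> S poly3 set" where
  "syz k Z = (let f = arr_poly Z in
     {g \<in> Der k. f dvd subst id (pd_x f) (pd_y f) (pd_z f) g})"

definition euler :: "S poly3" where
  "euler = const var_x * var_x + const var_y * var_y + const var_z * var_z"

definition euler_span :: "nat \<Rightarrow> S poly3 set" where
  "euler_span k = free_mod.span {euler * Poly_Mapping.single m 1 | m. mdeg m + 1 = k}"

definition Der0_mod :: "nat \<Rightarrow> mon gmod" where
  "Der0_mod k = \<lparr>shift = (\<lambda>_. 0), num = Der k, den = euler_span k\<rparr>"

definition syz0_mod :: "nat \<Rightarrow> point set \<Rightarrow> mon gmod" where
  "syz0_mod k Z = \<lparr>shift = (\<lambda>_. 0), num = syz k Z, den = euler_span k\<rparr>"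

definition splitting_type :: "nat \<Rightarrow> point set \<Rightarrow> point \<Rightarrow> nat list \<Rightarrow> bool" where
  "splitting_type k Z P as \<longleftrightarrow> length as = k + 1 \<and> sorted as \<and>
     sheaf_iso (restrict_line (dual_line P) (syz0_mod k Z))
               (restrict_line (dual_line P) (twisted_sum as))"

text \<open>The tuple \<open>g\<close> of forms of degree \<open>d\<close> represents the section \<open>\<sigma>\<close> on the line: locally
  \<open>\<sigma>\<close> and \<open>g\<close> agree modulo the Euler-type elements and the equation of the line.\<close>

definition represents ::
  "nat \<Rightarrow> point \<Rightarrow> nat \<Rightarrow> (S \<Rightarrow> (S poly3 \<times> nat) set) \<Rightarrow> S poly3 \<Rightarrow> bool" where
  "represents k P d \<sigma> g \<longleftrightarrow>
     g \<in> Der k \<and> (\<forall>m. is_form d (Poly_Mapping.lookup g m)) \<and>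
     (\<forall>h. pos_form h \<longrightarrow> (\<forall>s\<in>\<sigma> h.
        (s, (g, 0)) \<in> frac_rel (restrict_line (dual_line P) (Der0_mod k)) d h))"

definition nonzero_syzygy_on_line :: "nat \<Rightarrow> point set \<Rightarrow> point \<Rightarrow> nat \<Rightarrow> S poly3 \<Rightarrow> bool" where
  "nonzero_syzygy_on_line k Z P d g \<longleftrightarrow>
     (let M = restrict_line (dual_line P) (syz0_mod k Z) in
      \<exists>\<sigma>. global_section M d \<sigma> \<and> (\<exists>h. pos_form h \<and> \<sigma> h \<noteq> sec_zero M d h) \<and>
          represents k P d \<sigma> g)"

fun curve_CL :: "point \<Rightarrow> S poly3 \<Rightarrow> S" where
  "curve_CL (\<alpha>, \<beta>, \<gamma>) g =
     subst
       (subst const (const \<gamma> * var_y - const \<beta> * var_z)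
                    (const \<alpha> * var_z - const \<gamma> * var_x)
                    (const \<beta> * var_x - const \<alpha> * var_y))
       var_x var_y var_z g"

end

theory Submission
  imports Defs "HOL-Library.Product_Lexorder"
begin

text \<open>The curves of degree \<open>d + k\<close> through \<open>Z\<close> with multiplicity \<open>d\<close> at \<open>P\<close> considered here are the sections
of the syzygy bundle on \<open>L\<close> twisted by \<open>d\<close>. So the dimension of their space is determined by the
splitting type, and it exceeds the expected one because of the summands that have no sections yet:
a summand of degree \<open>b > d + 1\<close> contributes the negative number \<open>d + 1 - b\<close> to the expected dimension,
but \<open>0\<close> to the actual one.

\<^bold>\<open>Curves and syzygies.\<close> Let \<open>P = (\<alpha>, \<beta>, \<gamma>)\<close> with \<open>\<gamma> \<noteq> 0\<close>. In the coordinates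
\<open>s = \<gamma> y - \<beta> z\<close>, \<open>t = \<alpha> z - \<gamma> x\<close> and \<open>z\<close> of the dual plane, \<open>P\<close> is the point with \<open>s = t = 0\<close>, so a form of
degree \<open>d + k\<close> whose degree in \<open>z\<close> is at most \<open>k\<close> has multiplicity at least \<open>d\<close> at \<open>P\<close>. Written in
these coordinates, the equation of the curve of a tuple is a linear function \<open>flat\<close> of the tuple over
the coordinate ring of \<open>L\<close>, which is a polynomial ring in the two variables \<open>s\<close> and \<open>t\<close>. Up to powers of
these variables, the kernel of \<open>flat\<close> consists of the multiples of the Euler element and of the equation of
\<open>L\<close> (\<open>flat_kernel_var\<close>). At the foot of \<open>p \<in> Z\<close>, the point where \<open>L\<close> meets the line dual to \<open>p\<close>, the
gradient of \<open>f\<close> is a nonzero multiple of \<open>p\<close>; this is why a syzygy gives a curve through \<open>p\<close>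
(\<open>syz_vanish\<close>). Conversely every curve comes from a syzygy after multiplication with powers of
\<open>s\<close> or \<open>t\<close> (\<open>lift_curve\<close>), because \<open>f\<close> and its derivatives have no common zero on \<open>L\<close> (\<open>var_power_jac\<close>).

\<^bold>\<open>Dimensions.\<close> Both the syzygies on \<open>L\<close> and a direct sum of twists thus embed into a polynomial ring.
There fractions can be compared by cross multiplication, and sections over the two charts of \<open>L\<close> glue
because the two variables are coprime. An isomorphism of the two sheaves therefore
matches the curves with the global sections of the direct sum, and the space of curves has dimension
\<open>\<Sum>\<^sub>i max 0 (d + 1 - a\<^sub>i)\<close> in every degree \<open>d\<close> (\<open>dim_curves\<close>).

\<^bold>\<open>Comparison.\<close> For large \<open>d\<close> this dimension is at least the number of monomials minus the number of
points, which yields \<open>\<Sum>\<^sub>i a\<^sub>i + k (k + 1) / 2 \<le> |Z|\<close> (\<open>sum_splitting_type\<close>). Since \<open>Z\<close> imposes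
independent conditions in degree \<open>d + k\<close>, the expected dimension is then at most \<open>\<Sum>\<^sub>i (d + 1 - a\<^sub>i)\<close>. The
actual one is larger by the sum of \<open>a\<^sub>i - d - 1\<close> over all \<open>a\<^sub>i > d + 1\<close>, which is the sum assumed to be
positive (\<open>unexpected_of_dim\<close>).\<close>

section \<open>Polynomials in three variables and substitution\<close>

abbreviation coef :: "('a \<Rightarrow>\<^sub>0 'b::zero) \<Rightarrow> 'a \<Rightarrow> 'b" where "coef \<equiv> Poly_Mapping.lookup"
abbreviation mons :: "('a \<Rightarrow>\<^sub>0 'b::zero) \<Rightarrow> 'a set" where "mons \<equiv> Poly_Mapping.keys"
abbreviation monomial :: "'a \<Rightarrow> 'b \<Rightarrow> 'a \<Rightarrow>\<^sub>0 'b::zero" where "monomial \<equiv> Poly_Mapping.single"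

text \<open>With the lexicographic order on monomials, the library instance for polynomials over an ordered
monoid applies, so that \<^typ>\<open>S\<close> is an integral domain.\<close>

instance prod :: ("{linorder, ordered_cancel_comm_monoid_add}", "{linorder, ordered_cancel_comm_monoid_add}")
    ordered_cancel_comm_monoid_add
proof
  fix a b c :: "'a \<times> 'b"
  assume "a \<le> b"
  then show "c + a \<le> c + b"
    by (cases a; cases b; cases c)
      (auto simp: less_le intro: add_left_mono dest: add_left_imp_eq)
qed

locale rhom =
  fixes f :: "'a::comm_ring_1 \<Rightarrow> 'b::comm_ring_1"
  assumes one: "f 1 = 1" and add: "f (a + b) = f a + f b" and mult: "f (a * b) = f a * f b"
begin

lemma zero: "f 0 = 0"
  using add[of 0 0] by simp

lemma minus: "f (- a) = - f a"
  using add[of a "- a"] zero by (simp add: eq_neg_iff_add_eq_0 add.commute)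

lemma diff: "f (a - b) = f a - f b"
  using add[of a "- b"] minus by simp

lemma sum: "f (\<Sum>i\<in>A. g i) = (\<Sum>i\<in>A. f (g i))"
  by (induction A rule: infinite_finite_induct) (simp_all add: zero add)

lemma prod: "f (\<Prod>i\<in>A. g i) = (\<Prod>i\<in>A. f (g i))"
  by (induction A rule: infinite_finite_induct) (simp_all add: one mult)

lemma power: "f (a ^ n) = f a ^ n"
  by (induction n) (simp_all add: one mult)

lemmas simps = zero one add mult minus diff sum prod power

end

lemma rhom_id: "rhom id" by unfold_locales auto

lemma rhom_const: "rhom (const :: 'c::comm_ring_1 \<Rightarrow> 'c poly3)"
  by unfold_locales (simp_all add: const_def single_add mult_single flip: zero_prod_def single_one)

lemma poly_mapping_sum_monomials: "p = (\<Sum>m\<in>mons p. monomial m (coef p m))"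
  by (rule poly_mapping_eqI) (auto simp: lookup_sum lookup_single when_def in_keys_iff sum.delta')

fun monom3 :: "'r \<Rightarrow> 'r \<Rightarrow> 'r \<Rightarrow> mon \<Rightarrow> 'r::comm_semiring_1" where
  "monom3 u v w (i, j, l) = u ^ i * v ^ j * w ^ l"

lemma monom3_add: "monom3 u v w (m + n) = monom3 u v w m * monom3 u v w n"
  by (cases m; cases n) (simp add: power_add algebra_simps)

lemma rhom_monom3: "rhom f \<Longrightarrow> f (monom3 u v w m) = monom3 (f u) (f v) (f w) m"
  by (cases m) (simp add: rhom.simps)

lemma subst_superset:
  assumes "finite A" "mons p \<subseteq> A" "\<sigma> 0 = 0"
  shows "subst \<sigma> u v w p = (\<Sum>m\<in>A. \<sigma> (coef p m) * monom3 u v w m)"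
proof -
  have "subst \<sigma> u v w p = (\<Sum>m\<in>mons p. \<sigma> (coef p m) * monom3 u v w m)"
    unfolding subst_def by (rule sum.cong) (auto simp: mult.assoc)
  also have "\<dots> = (\<Sum>m\<in>A. \<sigma> (coef p m) * monom3 u v w m)"
    using assms by (intro sum.mono_neutral_left) (auto simp: in_keys_iff)
  finally show ?thesis .
qed

lemma subst_sum_mons:
  "\<sigma> 0 = 0 \<Longrightarrow> subst \<sigma> u v w p = (\<Sum>m\<in>mons p. \<sigma> (coef p m) * monom3 u v w m)"
  by (rule subst_superset) auto

lemma subst_monomial: "\<sigma> 0 = 0 \<Longrightarrow> subst \<sigma> u v w (monomial m c) = \<sigma> c * monom3 u v w m"
  by (subst subst_superset[where A = "{m}"]) auto

lemma subst_const: "\<sigma> 0 = 0 \<Longrightarrow> subst \<sigma> u v w (const c) = \<sigma> c"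
  by (simp add: const_def subst_monomial)

lemma subst_vars:
  assumes "rhom \<sigma>"
  shows "subst \<sigma> u v w var_x = u" "subst \<sigma> u v w var_y = v" "subst \<sigma> u v w var_z = w"
  by (simp_all add: var_x_def var_y_def var_z_def subst_monomial rhom.simps[OF assms])

lemma subst_add:
  assumes "rhom \<sigma>"
  shows "subst \<sigma> u v w (p + q) = subst \<sigma> u v w p + subst \<sigma> u v w q"
proof -
  interpret rhom \<sigma> by fact
  let ?A = "mons p \<union> mons q"
  show ?thesis
    using Poly_Mapping.keys_add[of p q]
    by (simp add: subst_superset[where A = ?A] zero lookup_add add distrib_right sum.distrib)
qed

lemma subst_sum:
  assumes "rhom \<sigma>"
  shows "subst \<sigma> u v w (\<Sum>i\<in>A. p i) = (\<Sum>i\<in>A. subst \<sigma> u v w (p i))"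
  by (induction A rule: infinite_finite_induct)
    (simp_all add: subst_add[OF assms] subst_sum_mons rhom.zero[OF assms])

lemma subst_mult:
  assumes "rhom \<sigma>"
  shows "subst \<sigma> u v w (p * q) = subst \<sigma> u v w p * subst \<sigma> u v w q"
proof -
  interpret rhom \<sigma> by fact
  let ?s = "subst \<sigma> u v w"
  have "p * q = (\<Sum>m\<in>mons p. \<Sum>n\<in>mons q. monomial (m + n) (coef p m * coef q n))"
    by (subst poly_mapping_sum_monomials[of p], subst poly_mapping_sum_monomials[of q])
      (simp add: sum_product mult_single)
  then have "?s (p * q) = (\<Sum>m\<in>mons p. \<Sum>n\<in>mons q. ?s (monomial m (coef p m)) * ?s (monomial n (coef q n)))"
    by (simp add: subst_sum[OF assms] subst_monomial zero mult monom3_add algebra_simps)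
  also have "\<dots> = ?s p * ?s q"
    by (subst (3) poly_mapping_sum_monomials[of p], subst (3) poly_mapping_sum_monomials[of q])
      (simp add: sum_product subst_sum[OF assms])
  finally show ?thesis .
qed

lemma rhom_subst:
  assumes "rhom \<sigma>"
  shows "rhom (subst \<sigma> u v w)"
proof
  show "subst \<sigma> u v w 1 = 1"
    using rhom.simps[OF assms] subst_const[of \<sigma> u v w 1]
    by (simp add: rhom.one[OF rhom_const])
qed (fact subst_add[OF assms] subst_mult[OF assms])+

lemma rhom_comp_subst:
  assumes "rhom \<eta>" "rhom \<sigma>"
  shows "\<eta> (subst \<sigma> u v w p) = subst (\<eta> \<circ> \<sigma>) (\<eta> u) (\<eta> v) (\<eta> w) p"
  by (simp add: subst_sum_mons rhom_monom3[OF assms(1)] rhom.simps[OF assms(1)] rhom.zero[OF assms(2)])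

lemma monomial_eq_monom3: "monomial m c = const c * monom3 var_x var_y var_z m"
proof -
  have p: "monomial (i, 0, 0) 1 = var_x ^ i" "monomial (0, i, 0) 1 = var_y ^ i" "monomial (0, 0, i) 1 = var_z ^ i"
    for i :: nat
    by (induction i; simp add: mult_single var_x_def var_y_def var_z_def flip: zero_prod_def;
        metis add.commute add_Pair add_0 mult_1 mult_single plus_1_eq_Suc)+
  show ?thesis
    by (cases m) (simp add: const_def mult_single flip: p)
qed

lemma subst_vars_id: "subst const var_x var_y var_z p = (p :: 'c::comm_ring_1 poly3)"
  using poly_mapping_sum_monomials[of p]
  by (simp add: subst_sum_mons rhom.zero[OF rhom_const] monomial_eq_monom3)

text \<open>Substitution respects congruences. This is how polynomials are reduced modulo a linear form:
eliminating one variable changes a polynomial by a multiple of that form.\<close>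

lemma subst_dvd_diff:
  assumes "rhom \<sigma>" "d dvd u - u'" "d dvd v - v'" "d dvd w - w'"
  shows "d dvd subst \<sigma> u v w p - subst \<sigma> u' v' w' p"
proof -
  have pw: "d dvd a ^ i - b ^ i" if "d dvd a - b" for a b :: 'b and i
    using that by (metis dvd_mult2 power_diff_sumr2)
  have ml: "d dvd a * a' - b * b'" if "d dvd a - b" "d dvd a' - b'" for a b a' b' :: 'b
  proof -
    have "a * a' - b * b' = (a - b) * a' + b * (a' - b')" by (simp add: algebra_simps)
    then show ?thesis using that by auto
  qed
  have "d dvd \<sigma> c * monom3 u v w m - \<sigma> c * monom3 u' v' w' m" for c m
    by (cases m) (auto intro!: ml pw assms)
  then show ?thesis
    by (simp add: subst_sum_mons rhom.zero[OF assms(1)] dvd_sum flip: sum_subtractf)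
qed

section \<open>Forms and homogeneous parts\<close>

lemma mdeg_add: "mdeg (m + n) = mdeg m + mdeg n"
  by (cases m; cases n) simp

lemma is_formD: "is_form n p \<Longrightarrow> coef p m \<noteq> 0 \<Longrightarrow> mdeg m = n"
  by (auto simp: is_form_def in_keys_iff)

lemma is_form_zero [simp]: "is_form n 0"
  by (simp add: is_form_def)

lemma is_form_monomial: "mdeg m = n \<Longrightarrow> is_form n (monomial m c)"
  by (simp add: is_form_def)

lemma is_form_const [simp]: "is_form 0 (const c)"
  by (simp add: const_def is_form_monomial)

lemma is_form_vars [simp]: "is_form (Suc 0) var_x" "is_form (Suc 0) var_y" "is_form (Suc 0) var_z"
  by (simp_all add: var_x_def var_y_def var_z_def is_form_monomial)

lemma is_form_add: "is_form n p \<Longrightarrow> is_form n q \<Longrightarrow> is_form n (p + q :: 'c::comm_monoid_add poly3)"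
  using Poly_Mapping.keys_add[of p q] by (auto simp: is_form_def)

lemma is_form_minus: "is_form n (- p :: 'c::ab_group_add poly3) \<longleftrightarrow> is_form n p"
  by (simp add: is_form_def in_keys_iff)

lemma is_form_diff: "is_form n p \<Longrightarrow> is_form n q \<Longrightarrow> is_form n (p - q :: 'c::ab_group_add poly3)"
  using is_form_add[of n p "- q"] by (simp add: is_form_minus)

lemma is_form_sum: "(\<And>i. i \<in> A \<Longrightarrow> is_form n (p i)) \<Longrightarrow> is_form n (\<Sum>i\<in>A. p i :: 'c::comm_monoid_add poly3)"
  by (induction A rule: infinite_finite_induct) (auto intro: is_form_add)

lemma is_form_mult: "is_form n p \<Longrightarrow> is_form m q \<Longrightarrow> is_form (n + m) (p * q :: 'c::comm_ring_1 poly3)"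
  using Poly_Mapping.keys_mult[of p q] by (fastforce simp: is_form_def mdeg_add)

lemma is_form_one [simp]: "is_form 0 (1 :: 'c::comm_ring_1 poly3)"
  unfolding rhom.one[OF rhom_const, symmetric] by (rule is_form_const)

lemma is_form_power: "is_form n p \<Longrightarrow> is_form (n * i) (p ^ i :: 'c::comm_ring_1 poly3)"
  by (induction i) (auto intro: is_form_mult)

lemma is_form_prod:
  "(\<And>i. i \<in> A \<Longrightarrow> is_form (n i) (p i)) \<Longrightarrow> is_form (\<Sum>i\<in>A. n i) (\<Prod>i\<in>A. p i :: 'c::comm_ring_1 poly3)"
  by (induction A rule: infinite_finite_induct) (auto intro: is_form_mult)

lemma is_form_monom3:
  assumes "is_form e u" "is_form e v" "is_form e w"
  shows "is_form (e * mdeg m) (monom3 u v w m :: 'c::comm_ring_1 poly3)"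
proof (cases m)
  case (fields i j l)
  have "is_form (e * i + e * j + e * l) (u ^ i * v ^ j * w ^ l)"
    by (intro is_form_mult is_form_power assms)
  then show ?thesis by (simp add: fields algebra_simps)
qed

lemma is_form_const_mult: "is_form n p \<Longrightarrow> is_form n (const c * p :: 'c::comm_ring_1 poly3)"
  using is_form_mult[OF is_form_const, of n p c] by simp

lemma is_form_subst:
  assumes "is_form e u" "is_form e v" "is_form e w" "is_form n p" "\<sigma> 0 = 0"
    "\<And>m. is_form b (\<sigma> (coef p m))"
  shows "is_form (b + e * n) (subst \<sigma> u v w p :: 'c::comm_ring_1 poly3)"
proof -
  have "is_form (b + e * n) (\<sigma> (coef p m) * monom3 u v w m)" if "m \<in> mons p" for m
    using is_form_mult[OF assms(6) is_form_monom3[OF assms(1-3)], of m m] that assms(4)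
    by (simp add: is_form_def)
  then show ?thesis
    by (simp add: subst_sum_mons assms(5) is_form_sum)
qed

lemma keys_eq_empty_iff: "mons p = {} \<longleftrightarrow> p = 0"
  by (metis keys_zero lookup_zero not_in_keys_iff_lookup_eq_zero empty_iff poly_mapping_eqI)

lemma vars_nonzero [simp]: "var_x \<noteq> (0::S)" "var_y \<noteq> (0::S)" "var_z \<noteq> (0::S)"
proof -
  have "monomial m 1 \<noteq> (0::S)" for m
    using keys_eq_empty_iff[of "monomial m (1::complex)"] by simp
  then show "var_x \<noteq> (0::S)" "var_y \<noteq> (0::S)" "var_z \<noteq> (0::S)"
    unfolding var_x_def var_y_def var_z_def by blast+
qed

lemma tdeg_form: "is_form n p \<Longrightarrow> p \<noteq> 0 \<Longrightarrow> tdeg p = n"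
proof -
  assume p: "is_form n p" "p \<noteq> 0"
  then obtain m where m: "m \<in> mons p" by (metis all_not_in_conv keys_eq_empty_iff)
  have "mdeg ` mons p = (\<lambda>_. n) ` mons p"
    using p(1) by (intro image_cong) (auto simp: is_form_def)
  also have "\<dots> = {n}" by (rule image_constant[OF m])
  finally have "mdeg ` mons p = {n}" .
  then show ?thesis by (simp add: tdeg_def)
qed

lemma nonzero_form_iff: "nonzero_form p \<longleftrightarrow> p \<noteq> 0 \<and> (\<exists>n. is_form n p)"
  by (auto simp: nonzero_form_def tdeg_form)

lemma nonzero_form_prod:
  "(\<And>i. i \<in> A \<Longrightarrow> nonzero_form (p i)) \<Longrightarrow> nonzero_form (\<Prod>i\<in>A. p i)"
  by (induction A rule: infinite_finite_induct)
    (auto simp: nonzero_form_iff intro: is_form_mult is_form_one)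

lemma nonzero_form_mult: "nonzero_form p \<Longrightarrow> nonzero_form q \<Longrightarrow> nonzero_form (p * q)"
  by (auto simp: nonzero_form_iff intro: is_form_mult)

definition hpart :: "nat \<Rightarrow> 'c::comm_monoid_add poly3 \<Rightarrow> 'c poly3" where
  "hpart n p = (\<Sum>m\<in>{m \<in> mons p. mdeg m = n}. monomial m (coef p m))"

lemma coef_hpart: "coef (hpart n p) m = (if mdeg m = n then coef p m else 0)"
  by (auto simp: hpart_def lookup_sum lookup_single when_def in_keys_iff sum.delta')

lemma hpart_add: "hpart n (p + q) = hpart n p + hpart n q"
  by (rule poly_mapping_eqI) (simp add: coef_hpart lookup_add)

lemma hpart_zero [simp]: "hpart n 0 = 0"
  by (rule poly_mapping_eqI) (simp add: coef_hpart)

lemma hpart_sum: "hpart n (\<Sum>i\<in>A. p i) = (\<Sum>i\<in>A. hpart n (p i))"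
  by (induction A rule: infinite_finite_induct) (simp_all add: hpart_add)

lemma is_form_hpart: "is_form n (hpart n p)"
  by (auto simp: is_form_def in_keys_iff coef_hpart split: if_splits)

lemma hpart_form: "is_form m p \<Longrightarrow> hpart n p = (if n = m then p else 0)"
  by (rule poly_mapping_eqI) (auto simp: coef_hpart dest: is_formD)

lemma hpart_mult_form:
  fixes h :: "'c::comm_ring_1 poly3"
  assumes h: "is_form a h"
  shows "hpart (a + n) (h * p) = h * hpart n p"
proof -
  have "hpart (a + n) (h * monomial m c) = h * hpart n (monomial m c)" for m c
  proof (cases "mdeg m = n")
    case True
    then show ?thesis
      using is_form_mult[OF h is_form_monomial[OF True, of c]] is_form_monomial[OF True, of c]
      by (simp add: hpart_form)
  next
    case False
    then show ?thesis
      using is_form_mult[OF h is_form_monomial[OF refl, of m c]] is_form_monomial[OF refl, of m c]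
      by (simp add: hpart_form)
  qed
  then show ?thesis
    by (subst (1 2) poly_mapping_sum_monomials[of p]) (simp add: sum_distrib_left hpart_sum)
qed

lemma hpart_mult_form_less:
  fixes h :: "'c::comm_ring_1 poly3"
  assumes h: "is_form a h" and "n < a"
  shows "hpart n (h * p) = 0"
proof (rule poly_mapping_eqI)
  fix m
  show "coef (hpart n (h * p)) m = coef 0 m"
    using Poly_Mapping.keys_mult[of h p] assms
    by (fastforce simp: coef_hpart is_form_def mdeg_add not_in_keys_iff_lookup_eq_zero)
qed

text \<open>Passing to homogeneous parts is what allows divisibility arguments below to ignore degrees:
representatives are made homogeneous only at the end.\<close>

lemma dvd_hpart:
  fixes h :: "'c::comm_ring_1 poly3"
  assumes "is_form a h" "h dvd p"
  shows "h dvd hpart n p"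
proof -
  obtain q where q: "p = h * q" using assms(2) by blast
  show ?thesis
    using hpart_mult_form[OF assms(1), of "n - a" q] hpart_mult_form_less[OF assms(1), of n q] q
    by (cases "n < a") auto
qed

lemma form_quotient:
  assumes "is_form a p" "p \<noteq> 0" "is_form n (p * q :: S)"
  shows "is_form (n - a) q"
proof (cases "n < a")
  case True
  then have "p * q = 0"
    using hpart_mult_form_less[OF assms(1), of n q] hpart_form[OF assms(3), of n] by simp
  then show ?thesis using assms(2) by simp
next
  case False
  then have "p * q = p * hpart (n - a) q"
    using hpart_mult_form[OF assms(1), of "n - a" q] hpart_form[OF assms(3), of n] by simp
  then have "q = hpart (n - a) q" using assms(2) by simp
  then show ?thesis using is_form_hpart[of "n - a" q] by simp
qed

lemma hpart_subst_const:
  fixes u v w :: "'c::comm_ring_1 poly3"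
  assumes "is_form (Suc 0) u" "is_form (Suc 0) v" "is_form (Suc 0) w"
  shows "subst const u v w (hpart n p) = hpart n (subst const u v w p)"
proof -
  have c0: "const 0 = (0 :: 'c poly3)" by (rule rhom.zero[OF rhom_const])
  have f: "is_form (mdeg m) (const c * monom3 u v w m)" for c m
    using is_form_monom3[OF assms, of m] by (intro is_form_const_mult) simp
  have "subst const u v w (hpart n p) = (\<Sum>m\<in>mons p. const (coef (hpart n p) m) * monom3 u v w m)"
    by (rule subst_superset) (auto simp: c0 in_keys_iff coef_hpart split: if_splits)
  also have "\<dots> = (\<Sum>m\<in>mons p. hpart n (const (coef p m) * monom3 u v w m))"
    by (rule sum.cong) (auto simp: coef_hpart hpart_form[OF f] c0)
  finally show ?thesis by (simp add: subst_sum_mons c0 hpart_sum)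
qed

text \<open>A tuple of polynomials is graded by the degree of its coefficients only, not by the degree in the
variables \<open>\<partial>\<close>.\<close>

definition coef_hpart_map :: "nat \<Rightarrow> S poly3 \<Rightarrow> S poly3" where
  "coef_hpart_map n g = (\<Sum>m\<in>mons g. monomial m (hpart n (coef g m)))"

lemma coef_coef_hpart_map: "coef (coef_hpart_map n g) m = hpart n (coef g m)"
  by (auto simp: coef_hpart_map_def lookup_sum lookup_single when_def in_keys_iff sum.delta')

lemma hpart_subst_form:
  assumes "is_form e u" "is_form e v" "is_form e w" "rhom \<sigma>" "is_form k g"
    "\<And>q. \<sigma> (hpart n q) = hpart n (\<sigma> q)"
  shows "subst \<sigma> u v w (coef_hpart_map n g) = hpart (n + e * k) (subst \<sigma> u v w g :: S)"
proof -
  have "hpart (n + e * k) (\<sigma> (coef g m) * monom3 u v w m) = hpart n (\<sigma> (coef g m)) * monom3 u v w m"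
    if "m \<in> mons g" for m
    using that assms(5) hpart_mult_form[OF is_form_monom3[OF assms(1-3)], of m n "\<sigma> (coef g m)"]
    by (simp add: is_form_def mult.commute add.commute)
  moreover have "subst \<sigma> u v w (coef_hpart_map n g)
      = (\<Sum>m\<in>mons g. \<sigma> (coef (coef_hpart_map n g) m) * monom3 u v w m)"
    by (rule subst_superset) (auto simp: rhom.zero[OF assms(4)] in_keys_iff coef_coef_hpart_map)
  ultimately show ?thesis
    by (simp add: subst_sum_mons rhom.zero[OF assms(4)] hpart_sum coef_coef_hpart_map assms(6))
qed

section \<open>Evaluation\<close>

lemma rhom_peval: "rhom (\<lambda>p. peval p Q)"
  by (cases Q) (simp add: rhom_subst[OF rhom_id])

lemma peval_const [simp]: "peval (const c) Q = c"
  by (cases Q) (simp add: subst_const)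

lemma peval_vars [simp]:
  "peval var_x (a, b, c) = a" "peval var_y (a, b, c) = b" "peval var_z (a, b, c) = c"
  by (simp_all add: subst_vars rhom_id)

lemmas peval_simps = rhom.simps[OF rhom_peval]

lemma peval_subst: "rhom \<sigma> \<Longrightarrow> peval (subst \<sigma> u v w p) Q =
    subst (\<lambda>c. peval (\<sigma> c) Q) (peval u Q) (peval v Q) (peval w Q) p"
  using rhom_comp_subst[OF rhom_peval, where \<sigma> = \<sigma>] by (simp add: o_def)

lemma peval_subst_const: "peval (subst const u v w p) Q = peval p (peval u Q, peval v Q, peval w Q)"
  by (simp add: peval_subst rhom_const id_def)

lemma peval_dual_line: "peval (dual_line (a, b, c)) (x, y, z) = a * x + b * y + c * z"
  by (simp add: peval_simps del: peval.simps)

lemma monom3_scale: "monom3 (t * a) (t * b) (t * c) m = t ^ mdeg m * monom3 a b c m"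
  by (cases m) (simp add: power_add power_mult_distrib algebra_simps)

text \<open>For constant \<open>u\<close> this is the scaling behaviour of a form; for \<open>u\<close> a variable it recovers a form on a
line through the origin from its value at one point.\<close>

lemma form_subst_multiples:
  assumes "is_form n p"
  shows "subst const (u * const a) (u * const b) (u * const c) p = u ^ n * const (peval p (a, b, c))"
proof -
  note c = rhom.simps[OF rhom_const[where 'c = complex]]
  have e: "const (monom3 a b c m) = monom3 (const a) (const b) (const c :: S) m" for m
    by (rule rhom_monom3[OF rhom_const])
  have "subst const (u * const a) (u * const b) (u * const c) p
      = (\<Sum>m\<in>mons p. u ^ n * const (coef p m * monom3 a b c m))"
    unfolding subst_sum_mons[of const, OF c(1)] monom3_scale using assms
    by (intro sum.cong) (auto simp: is_form_def c(4) e algebra_simps)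
  also have "\<dots> = u ^ n * const (\<Sum>m\<in>mons p. coef p m * monom3 a b c m)"
    by (simp only: c(7) sum_distrib_left)
  also have "(\<Sum>m\<in>mons p. coef p m * monom3 a b c m) = peval p (a, b, c)"
    by (simp add: subst_sum_mons)
  finally show ?thesis .
qed

lemma peval_pscale:
  assumes "is_form n p"
  shows "peval p (pscale t Q) = t ^ n * peval p Q"
proof (cases Q)
  case (fields a b c)
  show ?thesis
    using arg_cong[OF form_subst_multiples[OF assms, of "const t" a b c], of "\<lambda>p. peval p 0"]
    by (simp add: fields peval_subst_const peval_simps del: peval.simps)
qed

section \<open>Partial derivatives\<close>

locale derivation =
  fixes D :: "S \<Rightarrow> S"
  assumes add: "D (p + q) = D p + D q"
    and mult: "D (p * q) = D p * q + p * D q"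
    and const: "D (const c) = 0"

text \<open>All three partial derivatives have this shape, with \<open>e\<close> the exponent of the variable. The exponent is
lowered by truncated subtraction, which does no harm at exponent \<open>0\<close> because the coefficient vanishes
there.\<close>

lemma derivationI:
  assumes D: "\<And>p. D p = (\<Sum>m\<in>mons p. monomial (dec m) (of_nat (e m) * coef p m))"
    and e: "\<And>m n. e (m + n) = e m + e n" and dec: "\<And>m n. e m \<noteq> 0 \<Longrightarrow> dec (m + n) = dec m + n"
  shows "derivation D"
proof
  have sup: "D p = (\<Sum>m\<in>A. monomial (dec m) (of_nat (e m) * coef p m))"
    if "finite A" "mons p \<subseteq> A" for A p
    unfolding D using that by (intro sum.mono_neutral_left) (auto simp: in_keys_iff)
  show a: "D (p + q) = D p + D q" for p q
    using sup[of "mons p \<union> mons q" "p + q"] sup[of "mons p \<union> mons q" p] sup[of "mons p \<union> mons q" q]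
      Poly_Mapping.keys_add[of p q]
    by (simp add: lookup_add single_add distrib_left sum.distrib)
  have m: "D (monomial m c) = monomial (dec m) (of_nat (e m) * c)" for m c
    by (subst sup[of "{m}"]) auto
  have e0: "e 0 = 0" using e[of 0 0] by simp
  then show "D (const c) = 0" for c
    by (simp add: const_def m flip: zero_prod_def)
  have z: "D 0 = 0" by (simp add: D)
  have s: "D (\<Sum>i\<in>A. f i) = (\<Sum>i\<in>A. D (f i))" for f :: "mon \<Rightarrow> S" and A
    by (induction A rule: infinite_finite_induct) (simp_all add: a z)
  have mm: "D (monomial m c * monomial n c') = D (monomial m c) * monomial n c' + monomial m c * D (monomial n c')"
    for m n c c'
  proof -
    have 1: "monomial (dec (m + n)) (of_nat (e m) * c * c') = monomial (dec m + n) (of_nat (e m) * c * c')"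
      by (cases "e m = 0") (simp_all add: dec)
    have 2: "monomial (dec (m + n)) (of_nat (e n) * c * c') = monomial (m + dec n) (of_nat (e n) * c * c')"
      using dec[of n m] by (cases "e n = 0") (simp_all add: add.commute)
    show ?thesis
      using 1 2 by (simp add: mult_single m e distrib_right single_add algebra_simps)
  qed
  show "D (p * q) = D p * q + p * D q" for p q
  proof -
    let ?s = "\<lambda>p::S. \<Sum>m\<in>mons p. monomial m (coef p m)"
    have "D (?s p * ?s q) = D (?s p) * ?s q + ?s p * D (?s q)"
      by (simp only: sum_product s mm sum.distrib)
    then show ?thesis by (simp only: poly_mapping_sum_monomials[symmetric])
  qed
qed

lemma derivation_pd: "derivation pd_x" "derivation pd_y" "derivation pd_z"
proof -
  show "derivation pd_x"
    by (rule derivationI[where dec = "\<lambda>(i, j, l). (i - 1, j, l)" and e = "\<lambda>(i, j, l). i"])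
      (auto simp: pd_x_def intro!: sum.cong)
  show "derivation pd_y"
    by (rule derivationI[where dec = "\<lambda>(i, j, l). (i, j - 1, l)" and e = "\<lambda>(i, j, l). j"])
      (auto simp: pd_y_def intro!: sum.cong)
  show "derivation pd_z"
    by (rule derivationI[where dec = "\<lambda>(i, j, l). (i, j, l - 1)" and e = "\<lambda>(i, j, l). l"])
      (auto simp: pd_z_def intro!: sum.cong)
qed

lemma pd_vars [simp]:
  "pd_x var_x = 1" "pd_x var_y = 0" "pd_x var_z = 0"
  "pd_y var_x = 0" "pd_y var_y = 1" "pd_y var_z = 0"
  "pd_z var_x = 0" "pd_z var_y = 0" "pd_z var_z = 1"
proof -
  have "monomial (0, 0, 0) (1::complex) = 1" by (simp flip: zero_prod_def)
  then show "pd_x var_x = 1" "pd_x var_y = 0" "pd_x var_z = 0"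
    "pd_y var_x = 0" "pd_y var_y = 1" "pd_y var_z = 0"
    "pd_z var_x = 0" "pd_z var_y = 0" "pd_z var_z = 1"
    by (simp_all add: pd_x_def pd_y_def pd_z_def var_x_def var_y_def var_z_def)
qed

lemma pd_dual_line:
  "pd_x (dual_line (a, b, c)) = const a" "pd_y (dual_line (a, b, c)) = const b"
  "pd_z (dual_line (a, b, c)) = const c"
  by (simp_all add: derivation.add[OF derivation_pd(1)] derivation.mult[OF derivation_pd(1)] derivation.const[OF derivation_pd(1)]
     derivation.add[OF derivation_pd(2)] derivation.mult[OF derivation_pd(2)] derivation.const[OF derivation_pd(2)]
     derivation.add[OF derivation_pd(3)] derivation.mult[OF derivation_pd(3)] derivation.const[OF derivation_pd(3)])

lemma is_form_pd:
  assumes "is_form n p"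
  shows "is_form (n - 1) (pd_x p)" "is_form (n - 1) (pd_y p)" "is_form (n - 1) (pd_z p)"
proof -
  have e: "is_form (n - 1) (monomial m (of_nat a * c))" if "a \<noteq> 0 \<Longrightarrow> mdeg m = n - 1" for m a and c :: complex
    using that by (cases "a = 0") (auto intro: is_form_monomial)
  show "is_form (n - 1) (pd_x p)" "is_form (n - 1) (pd_y p)" "is_form (n - 1) (pd_z p)"
    unfolding pd_x_def pd_y_def pd_z_def using assms
    by (intro is_form_sum; force simp: is_form_def[of n] intro!: e)+
qed

section \<open>Dimension counts in spaces of polynomials\<close>

abbreviation scale :: "complex \<Rightarrow> S \<Rightarrow> S" (infixr "*s" 75) where "c *s F \<equiv> smul c F"

lemma card_le_dim:
  assumes "B \<subseteq> V" "form_space.independent B" "V \<subseteq> form_space.span W" "finite W"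
  shows "card B \<le> form_space.dim V"
proof -
  obtain B' where B': "B \<subseteq> B'" "B' \<subseteq> V" "form_space.independent B'" "V \<subseteq> form_space.span B'"
    using form_space.maximal_independent_subset_extend[OF assms(1,2)] by blast
  then have "finite B'"
    using form_space.independent_span_bound[OF assms(4) B'(3)] assms(3) by blast
  then show ?thesis
    using B' form_space.basis_card_eq_dim[of B' V] card_mono by metis
qed

lemma dim_mono_finite:
  assumes "U \<subseteq> V" "V \<subseteq> form_space.span W" "finite W"
  shows "form_space.dim U \<le> form_space.dim V"
proof -
  obtain B where "B \<subseteq> U" "form_space.independent B" "card B = form_space.dim U"
    by (rule form_space.basis_exists)
  then show ?thesis using card_le_dim[of B V W] assms by auto
qed

text \<open>A linear correspondence that is total and has no nonzero element over \<open>0\<close> serves as an injective linear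
map. It avoids a choice of representatives: images of a basis are chosen, and a relation between them
would pull back to a relation in the basis.\<close>

lemma dim_le_correspondence:
  assumes U: "U \<subseteq> form_space.span W'" "finite W'" and V: "V \<subseteq> form_space.span W" "finite W"
    and total: "\<And>F. F \<in> U \<Longrightarrow> \<exists>G\<in>V. K F G"
    and zero: "K 0 0" and add: "\<And>F F' G G'. K F G \<Longrightarrow> K F' G' \<Longrightarrow> K (F + F') (G + G')"
    and scale: "\<And>c F G. K F G \<Longrightarrow> K (c *s F) (c *s G)"
    and inj: "\<And>F. K F 0 \<Longrightarrow> F = 0"
  shows "form_space.dim U \<le> form_space.dim V"
proof -
  obtain B where B: "B \<subseteq> U" "form_space.independent B" "card B = form_space.dim U"
    by (rule form_space.basis_exists)
  have fB: "finite B" using form_space.independent_span_bound[OF U(2) B(2)] B(1) U(1) by blast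
  obtain g where g: "\<And>b. b \<in> B \<Longrightarrow> g b \<in> V" "\<And>b. b \<in> B \<Longrightarrow> K b (g b)"
  proof -
    have "\<forall>b\<in>B. \<exists>G. G \<in> V \<and> K b G" using total B(1) by blast
    then show ?thesis using that by (auto dest!: bchoice)
  qed
  have K: "K (\<Sum>b\<in>T. c b *s b) (\<Sum>b\<in>T. c b *s g b)" if "finite T" "T \<subseteq> B" for c T
    using that
  proof (induction T)
    case empty
    show ?case using zero by simp
  next
    case (insert b T)
    then have "K (c b *s b) (c b *s g b)" "K (\<Sum>b\<in>T. c b *s b) (\<Sum>b\<in>T. c b *s g b)"
      using scale[OF g(2)] by simp_all
    then show ?case using add insert.hyps by simp
  qed
  have z: "c b = 0" if "(\<Sum>b\<in>B. c b *s g b) = 0" "b \<in> B" for c b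
  proof -
    have "K (\<Sum>b\<in>B. c b *s b) 0" using K[OF fB order_refl, of c] that(1) by simp
    then have "(\<Sum>b\<in>B. c b *s b) = 0" by (rule inj)
    then show ?thesis using form_space.independentD[OF B(2) fB order_refl] that(2) by blast
  qed
  have inj_g: "inj_on g B"
  proof (rule inj_onI, rule ccontr)
    fix b b' assume b: "b \<in> B" "b' \<in> B" "g b = g b'" "b \<noteq> b'"
    define c where "c = (\<lambda>x. if x = b then 1 else if x = b' then - 1 else (0::complex))"
    have "(\<Sum>x\<in>B. c x *s g x) = (\<Sum>x\<in>{b, b'}. c x *s g x)"
      using b fB by (intro sum.mono_neutral_right) (auto simp: c_def)
    also have "\<dots> = 0" using b by (simp add: c_def)
    finally show False using z[of c b] b by (simp add: c_def)
  qed
  have "form_space.independent (g ` B)"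
  proof (rule form_space.independent_if_scalars_zero)
    fix f x assume f: "(\<Sum>x\<in>g ` B. f x *s x) = 0" "x \<in> g ` B"
    then have "(\<Sum>b\<in>B. (f \<circ> g) b *s g b) = 0"
      by (simp add: sum.reindex[OF inj_g])
    then show "f x = 0" using z[of "f \<circ> g"] f(2) by auto
  qed (use fB in simp)
  then have "card (g ` B) \<le> form_space.dim V"
    using card_le_dim[OF _ _ V] g by blast
  then show ?thesis using card_image[OF inj_g] B by simp
qed

definition functional :: "(S \<Rightarrow> complex) \<Rightarrow> bool" where
  "functional l \<longleftrightarrow> (\<forall>F G. l (F + G) = l F + l G) \<and> (\<forall>c F. l (c *s F) = c * l F)"

lemma functional_zero: "functional l \<Longrightarrow> l 0 = 0"
proof -
  assume "functional l"
  then have "l (0 + 0) = l 0 + l 0" unfolding functional_def by blast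
  then show ?thesis by simp
qed

lemma functional_add: "functional l \<Longrightarrow> l (F + G) = l F + l G"
  and functional_scale: "functional l \<Longrightarrow> l (c *s F) = c * l F"
  unfolding functional_def by blast+

lemma functional_diff: "functional l \<Longrightarrow> l (F - G) = l F - l G"
proof -
  assume "functional l"
  then have "l (F - G + G) = l (F - G) + l G" unfolding functional_def by blast
  then show ?thesis by simp
qed

lemma subspace_kernel: "form_space.subspace U \<Longrightarrow> functional l \<Longrightarrow> form_space.subspace {F \<in> U. l F = 0}"
  by (auto simp: form_space.subspace_def functional_zero functional_add functional_scale)

lemma subspace_kernels: "form_space.subspace U \<Longrightarrow> (\<And>p. functional (l p)) \<Longrightarrow> form_space.subspace {F \<in> U. \<forall>p\<in>Z. l p F = 0}"
  by (auto simp: form_space.subspace_def functional_zero functional_add functional_scale)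

lemma dim_kernel:
  assumes U: "form_space.subspace U" "U \<subseteq> form_space.span W" "finite W" and l: "functional l"
  shows "form_space.dim U \<le> form_space.dim {F \<in> U. l F = 0} + 1"
proof (cases "\<exists>F\<in>U. l F \<noteq> 0")
  case True
  then obtain F0 where F0: "F0 \<in> U" "l F0 \<noteq> 0" by blast
  obtain B where B: "B \<subseteq> {F \<in> U. l F = 0}" "form_space.independent B" "{F \<in> U. l F = 0} \<subseteq> form_space.span B"
      "card B = form_space.dim {F \<in> U. l F = 0}"
    by (rule form_space.basis_exists)
  have fB: "finite B" using form_space.independent_span_bound[OF U(3) B(2)] B(1) U(2) by blast
  have "U \<subseteq> form_space.span (insert F0 B)"
  proof
    fix F assume F: "F \<in> U"
    let ?c = "l F / l F0"
    have "l (F - ?c *s F0) = 0"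
      using F0(2) by (simp add: functional_diff[OF l] functional_scale[OF l])
    then have "F - ?c *s F0 \<in> {F \<in> U. l F = 0}"
      using F F0 U(1) by (simp add: form_space.subspace_diff form_space.subspace_scale)
    then have "F - ?c *s F0 \<in> form_space.span B" using B(3) by blast
    then show "F \<in> form_space.span (insert F0 B)"
      unfolding form_space.span_insert by blast
  qed
  then have "form_space.dim U \<le> card (insert F0 B)"
    using fB by (intro form_space.dim_le_card) auto
  also have "\<dots> \<le> card B + 1" by (simp add: card_insert_if fB)
  finally show ?thesis using B by simp
next
  case False
  then have "{F \<in> U. l F = 0} = U" by auto
  then show ?thesis by simp
qed

lemma dim_kernels:
  assumes "finite Z" "form_space.subspace U" "U \<subseteq> form_space.span W" "finite W" "\<And>p. functional (l p)"
  shows "form_space.dim U \<le> form_space.dim {F \<in> U. \<forall>p\<in>Z. l p F = 0} + card Z"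
  using assms(1)
proof (induction Z)
  case (insert q Z)
  let ?U = "{F \<in> U. \<forall>p\<in>Z. l p F = 0}"
  have "form_space.dim ?U \<le> form_space.dim {F \<in> ?U. l q F = 0} + 1"
    by (rule dim_kernel[OF subspace_kernels[OF assms(2,5)] _ assms(4,5)]) (use assms(3) in blast)
  moreover have "{F \<in> ?U. l q F = 0} = {F \<in> U. \<forall>p\<in>insert q Z. l p F = 0}" by auto
  ultimately show ?case using insert by simp
qed simp

text \<open>Restricted to the kernel of one functional \<open>l q\<close>, the functional \<open>m\<close> is a combination of the remaining
ones; the coefficient of \<open>l q\<close> is then read off at a vector on which \<open>l q\<close> does not vanish.\<close>

lemma functional_combination:
  assumes "finite Z" "form_space.subspace U" "\<And>p. functional (l p)" "functional m"
    and "\<And>F. F \<in> U \<Longrightarrow> (\<forall>p\<in>Z. l p F = 0) \<Longrightarrow> m F = 0"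
  shows "\<exists>c. \<forall>F\<in>U. m F = (\<Sum>p\<in>Z. c p * l p F)"
  using assms(1,2,4,5)
proof (induction Z arbitrary: U m)
  case (insert q Z)
  let ?U = "{F \<in> U. l q F = 0}"
  obtain c where c: "\<And>F. F \<in> ?U \<Longrightarrow> m F = (\<Sum>p\<in>Z. c p * l p F)"
    using insert.IH[of ?U m] insert.prems subspace_kernel[OF _ assms(3)] by auto
  show ?case
  proof (cases "\<exists>F\<in>U. l q F \<noteq> 0")
    case True
    then obtain F0 where F0: "F0 \<in> U" "l q F0 \<noteq> 0" by blast
    let ?r = "\<lambda>F. m F - (\<Sum>p\<in>Z. c p * l p F)"
    have r: "?r (F - d *s G) = ?r F - d * ?r G" for F G d
      by (simp add: functional_diff[OF insert.prems(2)] functional_scale[OF insert.prems(2)]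
          functional_diff[OF assms(3)] functional_scale[OF assms(3)]
          right_diff_distrib sum_subtractf sum_distrib_left mult.left_commute)
    have "m F = (\<Sum>p\<in>insert q Z. (c(q := ?r F0 / l q F0)) p * l p F)" if F: "F \<in> U" for F
    proof -
      have "F - (l q F / l q F0) *s F0 \<in> ?U"
        using F F0 insert.prems(1)
        by (simp add: form_space.subspace_diff form_space.subspace_scale
            functional_diff[OF assms(3)] functional_scale[OF assms(3)])
      then have "?r (F - (l q F / l q F0) *s F0) = 0" using c by simp
      then have "?r F = (l q F / l q F0) * ?r F0" unfolding r by simp
      then have "m F = (\<Sum>p\<in>Z. c p * l p F) + ?r F0 / l q F0 * l q F"
        by (simp only: diff_eq_eq times_divide_eq_left times_divide_eq_right mult.commute add.commute)
      moreover have "(\<Sum>p\<in>Z. (c(q := ?r F0 / l q F0)) p * l p F) = (\<Sum>p\<in>Z. c p * l p F)"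
        using insert.hyps by (intro sum.cong) auto
      ultimately show ?thesis using insert.hyps by (simp add: add.commute)
    qed
    then show ?thesis by blast
  next
    case False
    then have "m F = (\<Sum>p\<in>insert q Z. c p * l p F)" if "F \<in> U" for F
      using c[of F] that insert.hyps by simp
    then show ?thesis by blast
  qed
qed simp

text \<open>Each functional lowers the dimension, since otherwise it would vanish on the common kernel of the
previous ones and be a combination of them.\<close>

lemma dim_independent_kernels:
  assumes "finite Z" "form_space.subspace U" "U \<subseteq> form_space.span W" "finite W" "\<And>p. functional (l p)"
    and ind: "\<And>c. (\<And>F. F \<in> U \<Longrightarrow> (\<Sum>p\<in>Z. c p * l p F) = 0) \<Longrightarrow> \<forall>p\<in>Z. c p = 0"
  shows "form_space.dim {F \<in> U. \<forall>p\<in>Z. l p F = 0} + card Z \<le> form_space.dim U"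
  using assms(1) ind
proof (induction Z)
  case empty
  then show ?case by simp
next
  case (insert q Z)
  let ?U = "{F \<in> U. \<forall>p\<in>Z. l p F = 0}" and ?V = "{F \<in> U. \<forall>p\<in>insert q Z. l p F = 0}"
  have "\<forall>p\<in>Z. c p = 0" if c: "\<And>F. F \<in> U \<Longrightarrow> (\<Sum>p\<in>Z. c p * l p F) = 0" for c
  proof -
    have "(\<Sum>p\<in>insert q Z. (c(q := 0)) p * l p F) = 0" if "F \<in> U" for F
    proof -
      have "(\<Sum>p\<in>Z. (c(q := 0)) p * l p F) = (\<Sum>p\<in>Z. c p * l p F)"
        using insert.hyps by (intro sum.cong) auto
      then show ?thesis using insert.hyps c[OF that] by simp
    qed
    then have "\<forall>p\<in>insert q Z. (c(q := 0)) p = 0" by (rule insert.prems)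
    then show ?thesis using insert.hyps by (auto split: if_splits)
  qed
  then have IH: "form_space.dim ?U + card Z \<le> form_space.dim U" by (rule insert.IH)
  have "\<exists>F\<in>?U. l q F \<noteq> 0"
  proof (rule ccontr)
    assume "\<not> ?thesis"
    then have "\<exists>c. \<forall>F\<in>U. l q F = (\<Sum>p\<in>Z. c p * l p F)"
      using assms(2,5) insert.hyps by (intro functional_combination) auto
    then obtain c where c: "\<And>F. F \<in> U \<Longrightarrow> l q F = (\<Sum>p\<in>Z. c p * l p F)" by blast
    have "(\<Sum>p\<in>insert q Z. (c(q := - 1)) p * l p F) = 0" if "F \<in> U" for F
    proof -
      have "(\<Sum>p\<in>Z. (c(q := - 1)) p * l p F) = (\<Sum>p\<in>Z. c p * l p F)"
        using insert.hyps by (intro sum.cong) auto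
      then show ?thesis using insert.hyps c[OF that] by simp
    qed
    then have "\<forall>p\<in>insert q Z. (c(q := - 1)) p = 0" by (rule insert.prems)
    then show False by auto
  qed
  then obtain F0 where F0: "F0 \<in> ?U" "l q F0 \<noteq> 0" by blast
  obtain B where B: "B \<subseteq> ?V" "form_space.independent B" "?V \<subseteq> form_space.span B" "card B = form_space.dim ?V"
    by (rule form_space.basis_exists)
  have fB: "finite B" using form_space.independent_span_bound[OF assms(4) B(2)] B(1) assms(3) by blast
  have "form_space.span B \<subseteq> ?V"
    by (rule form_space.span_minimal[OF B(1) subspace_kernels[OF assms(2,5)]])
  then have F0B: "F0 \<notin> form_space.span B" using F0 by auto
  then have "form_space.independent (insert F0 B)" using B(2) by (rule form_space.independent_insertI)
  then have "card (insert F0 B) \<le> form_space.dim ?U"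
    using B(1) F0 assms(3,4) by (intro card_le_dim[of _ _ W]) auto
  moreover have "F0 \<notin> B" using F0B form_space.span_base by blast
  ultimately show ?case using IH fB insert.hyps B(4) by simp
qed

lemma smul_eq_const_mult: "smul c p = const c * (p :: 'c::comm_ring_1 poly3)"
proof -
  have "const c * p = (\<Sum>m\<in>mons p. monomial m (c * coef p m))"
    by (subst poly_mapping_sum_monomials[of p])
      (simp add: sum_distrib_left const_def mult_single flip: zero_prod_def)
  also have "\<dots> = smul c p"
    by (rule poly_mapping_eqI)
      (auto simp: lookup_smul lookup_sum lookup_single when_def in_keys_iff sum.delta')
  finally show ?thesis by simp
qed

lemma mons_smul: "mons (smul c p) \<subseteq> mons p"
  by (auto simp: in_keys_iff lookup_smul)

lemma subspace_mons: "form_space.subspace {F. mons F \<subseteq> A}"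
proof -
  have "mons (F + G) \<subseteq> A" if "mons F \<subseteq> A" "mons G \<subseteq> A" for F G :: S
    using Poly_Mapping.keys_add[of F G] that by blast
  moreover have "mons (smul c F) \<subseteq> A" if "mons F \<subseteq> A" for c and F :: S
    using mons_smul[of c F] that by blast
  ultimately show ?thesis by (simp add: form_space.subspace_def)
qed

lemma mons_subset_span: "mons F \<subseteq> A \<Longrightarrow> F \<in> form_space.span ((\<lambda>m. monomial m 1) ` A)"
proof -
  assume F: "mons F \<subseteq> A"
  have "smul c (monomial m 1) = monomial m c" for c :: complex and m :: mon
    by (rule poly_mapping_eqI) (simp add: lookup_smul lookup_single when_def)
  then have "F = (\<Sum>m\<in>mons F. smul (coef F m) (monomial m 1))"
    using poly_mapping_sum_monomials[of F] by simp
  also have "\<dots> \<in> form_space.span ((\<lambda>m. monomial m 1) ` A)"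
    using F by (intro form_space.span_sum form_space.span_scale form_space.span_base) auto
  finally show ?thesis .
qed

lemma dim_mons:
  assumes "finite A"
  shows "form_space.dim {F. mons F \<subseteq> A} = card A"
proof (rule form_space.dim_unique)
  let ?B = "(\<lambda>m. monomial m (1::complex)) ` A"
  have inj: "inj_on (\<lambda>m. monomial m (1::complex)) A"
    by (auto intro!: inj_onI simp: poly_mapping_eq_iff fun_eq_iff lookup_single when_def split: if_splits)
  show "card ?B = card A" by (rule card_image[OF inj])
  show "?B \<subseteq> {F. mons F \<subseteq> A}" by auto
  show "{F. mons F \<subseteq> A} \<subseteq> form_space.span ?B" by (auto intro: mons_subset_span)
  show "form_space.independent ?B"
  proof (rule form_space.independent_if_scalars_zero)
    fix f x assume f: "(\<Sum>x\<in>?B. smul (f x) x) = 0" "x \<in> ?B"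
    then obtain m where m: "m \<in> A" "x = monomial m 1" by blast
    have "(\<Sum>n\<in>A. smul (f (monomial n 1)) (monomial n 1)) = 0"
      using f(1) by (simp add: sum.reindex[OF inj])
    then have "coef (\<Sum>n\<in>A. smul (f (monomial n 1)) (monomial n 1)) m = 0" by simp
    then show "f x = 0"
      using m assms by (simp add: lookup_sum lookup_smul lookup_single when_def sum.delta if_distrib cong: if_cong)
  qed (use assms in simp)
qed

lemma functional_peval: "functional (\<lambda>F. peval F Q)"
  by (simp add: functional_def peval_simps smul_eq_const_mult del: peval.simps)

lemma smul_const: "smul c p = const c * (p :: S poly3)"
  by (rule smul_eq_const_mult)

section \<open>Degree in the third variable, and homogenization\<close>

text \<open>In the coordinates used below the point \<open>P\<close> is \<open>(0, 0, 1)\<close>, up to scaling. A bound on the degree in \<open>z\<close> of a form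
then bounds its multiplicity at \<open>P\<close> from below.\<close>

definition zdeg_le :: "nat \<Rightarrow> S \<Rightarrow> bool" where
  "zdeg_le k F \<longleftrightarrow> (\<forall>(i, j, l)\<in>mons F. l \<le> k)"

lemma zdeg_le_zero [simp]: "zdeg_le k 0"
  by (simp add: zdeg_le_def)

lemma zdeg_le_add: "zdeg_le k F \<Longrightarrow> zdeg_le k G \<Longrightarrow> zdeg_le k (F + G)"
  using Poly_Mapping.keys_add[of F G] unfolding zdeg_le_def by blast

lemma zdeg_le_sum: "(\<And>i. i \<in> A \<Longrightarrow> zdeg_le k (F i)) \<Longrightarrow> zdeg_le k (\<Sum>i\<in>A. F i)"
  by (induction A rule: infinite_finite_induct) (auto intro: zdeg_le_add)

lemma zdeg_le_monomial: "l \<le> k \<Longrightarrow> zdeg_le k (monomial (i, j, l) c)"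
  by (simp add: zdeg_le_def)

lemma zdeg_le_mult: "zdeg_le k F \<Longrightarrow> zdeg_le k' G \<Longrightarrow> zdeg_le (k + k') (F * G)"
  using Poly_Mapping.keys_mult[of F G] by (fastforce simp: zdeg_le_def intro: add_mono)

lemma zdeg_le_power: "zdeg_le k F \<Longrightarrow> zdeg_le (k * n) (F ^ n)"
proof (induction n)
  case 0
  show ?case by (simp add: zdeg_le_def zero_prod_def)
qed (auto intro: zdeg_le_mult)

lemma zdeg_le_minus: "zdeg_le k (- F) \<longleftrightarrow> zdeg_le k F"
  by (simp add: zdeg_le_def in_keys_iff)

lemma zdeg_le_diff: "zdeg_le k F \<Longrightarrow> zdeg_le k G \<Longrightarrow> zdeg_le k (F - G)"
  using zdeg_le_add[of k F "- G"] by (simp add: zdeg_le_minus)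

lemma zdeg_le_vars [simp]: "zdeg_le k var_x" "zdeg_le k var_y" "zdeg_le (Suc 0) var_z" "zdeg_le k (const c)"
  by (simp_all add: zdeg_le_def var_x_def var_y_def var_z_def const_def)

lemma zdeg_le_const_mult: "zdeg_le k F \<Longrightarrow> zdeg_le k (const c * F)"
  using zdeg_le_mult[of 0 "const c" k F] by simp

lemmas const_simps = rhom.simps[OF rhom_const]

text \<open>The polynomial \<open>lift u V k F\<close> is the homogenization of degree \<open>k\<close> of \<open>F\<close>, regarded as a
polynomial in \<open>z\<close> with coefficients in \<open>\<complex>[x, y]\<close>: the variable \<open>z\<close> becomes \<open>u \<partial>\<^sub>z\<close> and \<open>V\<close> is the
homogenizing variable. Below, \<open>V\<close> is a linear form in the \<open>\<partial>\<close>'s that becomes \<open>u\<close> under the map from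
tuples to curves, and \<open>lift\<close> inverts that map up to the factor \<open>u ^ k\<close>.\<close>

definition lift_term :: "S \<Rightarrow> S poly3 \<Rightarrow> nat \<Rightarrow> mon \<Rightarrow> complex \<Rightarrow> S poly3" where
  "lift_term u V k m c = (case m of (i, j, l) \<Rightarrow>
     const (const c * var_x ^ i * var_y ^ j) * (const u * var_z) ^ l * V ^ (k - l))"

definition lift :: "S \<Rightarrow> S poly3 \<Rightarrow> nat \<Rightarrow> S \<Rightarrow> S poly3" where
  "lift u V k F = (\<Sum>m\<in>mons F. lift_term u V k m (coef F m))"

lemma lift_term_zero [simp]: "lift_term u V k m 0 = 0"
  by (simp add: lift_term_def const_simps split: prod.splits)

lemma lift_superset:
  "finite A \<Longrightarrow> mons F \<subseteq> A \<Longrightarrow> lift u V k F = (\<Sum>m\<in>A. lift_term u V k m (coef F m))"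
  unfolding lift_def by (intro sum.mono_neutral_left) (auto simp: in_keys_iff)

lemma lift_monomial: "lift u V k (monomial m c) = lift_term u V k m c"
  by (subst lift_superset[of "{m}"]) auto

lemma lift_add: "lift u V k (F + G) = lift u V k F + lift u V k G"
proof -
  have "lift_term u V k m (a + b) = lift_term u V k m a + lift_term u V k m b" for m a b
    by (simp add: lift_term_def const_simps algebra_simps split: prod.splits)
  then show ?thesis
    using Poly_Mapping.keys_add[of F G]
    by (simp add: lift_superset[of "mons F \<union> mons G"] lookup_add sum.distrib)
qed

lemma lift_zero [simp]: "lift u V k 0 = 0"
  by (simp add: lift_def)

lemma lift_sum: "lift u V k (\<Sum>i\<in>A. F i) = (\<Sum>i\<in>A. lift u V k (F i))"
  by (induction A rule: infinite_finite_induct) (simp_all add: lift_add)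

text \<open>Homogenization is multiplicative. So it suffices to know the lifts of linear forms.\<close>

lemma lift_mult:
  assumes F: "zdeg_le k F" and G: "zdeg_le k' G"
  shows "lift u V (k + k') (F * G) = lift u V k F * lift u V k' G"
proof -
  have t: "lift_term u V (k + k') (m + n) (a * b) = lift_term u V k m a * lift_term u V k' n b"
    if "m \<in> mons F" "n \<in> mons G" for m n a b
  proof -
    obtain i j l i' j' l' where mn: "m = (i, j, l)" "n = (i', j', l')" by (metis prod_cases3)
    have "l \<le> k" "l' \<le> k'" using F G that mn by (auto simp: zdeg_le_def)
    then have "k + k' - (l + l') = (k - l) + (k' - l')" by simp
    then show ?thesis
      by (simp add: mn lift_term_def const_simps power_add mult_ac)
  qed
  have "F * G = (\<Sum>m\<in>mons F. \<Sum>n\<in>mons G. monomial (m + n) (coef F m * coef G n))"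
    by (subst poly_mapping_sum_monomials[of F], subst poly_mapping_sum_monomials[of G])
      (simp add: sum_product mult_single)
  then have "lift u V (k + k') (F * G) =
      (\<Sum>m\<in>mons F. \<Sum>n\<in>mons G. lift_term u V k m (coef F m) * lift_term u V k' n (coef G n))"
    by (simp add: lift_sum lift_monomial t)
  then show ?thesis by (simp add: lift_def sum_product)
qed

lemma lift_power: "zdeg_le k F \<Longrightarrow> lift u V (k * n) (F ^ n) = lift u V k F ^ n"
proof (induction n)
  case 0
  have "lift u V 0 (monomial 0 1) = 1"
    unfolding lift_monomial by (simp add: lift_term_def zero_prod_def const_simps)
  then show ?case by simp
next
  case (Suc n)
  then show ?case by (simp add: lift_mult zdeg_le_power)
qed

lemma monomial_const: "monomial (i, j, l) c = const c * var_x ^ i * var_y ^ j * (var_z :: 'c::comm_ring_1 poly3) ^ l"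
  by (simp add: monomial_eq_monom3 mult.assoc)

lemma lift_binary:
  assumes "zdeg_le 0 F"
  shows "lift u V 0 F = const F"
proof -
  have "lift_term u V 0 m c = const (monomial m c)" if "m \<in> mons F" for m c
    using that assms by (auto simp: zdeg_le_def lift_term_def monomial_const)
  then have "lift u V 0 F = const (\<Sum>m\<in>mons F. monomial m (coef F m))"
    by (simp add: lift_def const_simps)
  then show ?thesis by (simp add: poly_mapping_sum_monomials[symmetric])
qed

lemma lift_const_mult: "zdeg_le k F \<Longrightarrow> lift u V k (const c * F) = const (const c) * lift u V k F"
  using lift_mult[of 0 "const c" k F u V] by (simp add: lift_binary)

lemma lift_vars:
  "lift u V (Suc 0) var_x = const var_x * V" "lift u V (Suc 0) var_y = const var_y * V"
  "lift u V (Suc 0) var_z = const u * var_z"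
proof -
  have "lift u V 1 (monomial (1,0,0) 1) = const var_x * V" "lift u V 1 (monomial (0,1,0) 1) = const var_y * V"
    "lift u V 1 (monomial (0,0,1) 1) = const u * var_z"
    unfolding lift_monomial by (simp_all add: lift_term_def const_simps)
  then show "lift u V (Suc 0) var_x = const var_x * V" "lift u V (Suc 0) var_y = const var_y * V"
  "lift u V (Suc 0) var_z = const u * var_z"
    by (simp_all add: var_x_def[where 'c=complex] var_y_def[where 'c=complex] var_z_def[where 'c=complex])
qed

lemma is_form_lift:
  assumes "zdeg_le k F" "is_form (Suc 0) V"
  shows "is_form k (lift u V k F)"
  unfolding lift_def
proof (rule is_form_sum)
  fix m assume "m \<in> mons F"
  moreover obtain i j l where m: "m = (i, j, l)" by (metis prod_cases3)
  ultimately have l: "l \<le> k" using assms(1) by (auto simp: zdeg_le_def)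
  have "is_form (0 + Suc 0 * l + Suc 0 * (k - l)) (const (const c * var_x ^ i * var_y ^ j) * (const u * var_z) ^ l * V ^ (k - l))" for c
    by (intro is_form_mult is_form_power assms is_form_const is_form_const_mult is_form_vars)
  then show "is_form k (lift_term u V k m (coef F m))"
    using l by (simp add: lift_term_def m)
qed

definition cong2 :: "'a::comm_ring_1 \<Rightarrow> 'a \<Rightarrow> 'a \<Rightarrow> 'a \<Rightarrow> bool" where
  "cong2 e l a b \<longleftrightarrow> (\<exists>u v. a - b = e * u + l * v)"

lemma cong2_refl: "cong2 e l a a"
  unfolding cong2_def by (rule exI[of _ 0], rule exI[of _ 0]) simp

lemma cong2_add: "cong2 e l a b \<Longrightarrow> cong2 e l a' b' \<Longrightarrow> cong2 e l (a + a') (b + b')"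
proof -
  assume "cong2 e l a b" "cong2 e l a' b'"
  then obtain u v u' v' where "a - b = e * u + l * v" "a' - b' = e * u' + l * v'"
    unfolding cong2_def by blast
  then have "(a + a') - (b + b') = e * (u + u') + l * (v + v')" by (simp add: algebra_simps)
  then show ?thesis unfolding cong2_def by blast
qed

lemma cong2_mult: "cong2 e l a b \<Longrightarrow> cong2 e l a' b' \<Longrightarrow> cong2 e l (a * a') (b * b')"
proof -
  assume "cong2 e l a b" "cong2 e l a' b'"
  then obtain u v u' v' where uv: "a - b = e * u + l * v" "a' - b' = e * u' + l * v'"
    unfolding cong2_def by blast
  have "a * a' - b * b' = (a - b) * a' + b * (a' - b')" by (simp add: algebra_simps)
  also have "\<dots> = e * (u * a' + b * u') + l * (v * a' + b * v')"
    unfolding uv by (simp add: algebra_simps)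
  finally show ?thesis unfolding cong2_def by blast
qed

lemma cong2_power: "cong2 e l a b \<Longrightarrow> cong2 e l (a ^ n) (b ^ n)"
  by (induction n) (auto intro: cong2_refl cong2_mult)

lemma cong2_sum: "(\<And>i. i \<in> A \<Longrightarrow> cong2 e l (a i) (b i)) \<Longrightarrow> cong2 e l (\<Sum>i\<in>A. a i) (\<Sum>i\<in>A. b i)"
  by (induction A rule: infinite_finite_induct) (auto intro: cong2_refl cong2_add)

lemma euler_mult_in_span:
  assumes "is_form j u" "j + 1 = k"
  shows "euler * u \<in> euler_span k"
proof -
  have m: "monomial m c = const c * monomial m 1" for m :: mon and c :: S
    by (simp add: const_def mult_single flip: zero_prod_def)
  have "euler * u = euler * (\<Sum>m\<in>mons u. monomial m (coef u m))"
    by (simp only: poly_mapping_sum_monomials[symmetric])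
  also have "\<dots> = (\<Sum>m\<in>mons u. smul (coef u m) (euler * monomial m 1))"
    unfolding sum_distrib_left smul_const by (subst m) (simp only: mult.left_commute)
  finally have "euler * u = (\<Sum>m\<in>mons u. smul (coef u m) (euler * monomial m 1))" .
  also have "\<dots> \<in> euler_span k"
  proof -
    have "euler * monomial m 1 \<in> euler_span k" if "m \<in> mons u" for m
    proof -
      have "mdeg m + 1 = k" using that assms unfolding is_form_def by metis
      then show ?thesis unfolding euler_span_def by (intro free_mod.span_base) blast
    qed
    then show ?thesis
      unfolding euler_span_def by (intro free_mod.span_sum free_mod.span_scale)
  qed
  finally show ?thesis .
qed

lemma is_form_euler: "is_form (Suc 0) euler"
  unfolding euler_def by (intro is_form_add is_form_const_mult is_form_vars)

lemma euler_span_multiple: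
  assumes "w \<in> euler_span k"
  shows "euler dvd w \<and> w \<in> Der k"
  using assms unfolding euler_span_def
proof (induction rule: free_mod.span_induct_alt)
  case base
  show ?case by (simp add: Der_def)
next
  case (step c x y)
  then obtain m where m: "x = euler * monomial m 1" "mdeg m + 1 = k" by blast
  have "is_form (Suc 0 + mdeg m) x"
    unfolding m(1) by (intro is_form_mult is_form_euler is_form_monomial refl)
  then have "is_form k x" using m(2) by simp
  then show ?case
    using step.IH m(1) by (auto simp: smul_const Der_def intro!: is_form_add is_form_const_mult)
qed

section \<open>Flattening along a line\<close>

text \<open>The condition \<open>\<gamma> \<noteq> 0\<close> lets \<open>z\<close> be eliminated on the line dual to \<open>(\<alpha>, \<beta>, \<gamma>)\<close>, whose
coordinate ring is then \<open>\<complex>[x, y]\<close>.\<close>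

locale line =
  fixes \<alpha> \<beta> \<gamma> :: complex
  assumes gamma: "\<gamma> \<noteq> 0"
begin

abbreviation (input) lf :: S where "lf \<equiv> dual_line (\<alpha>, \<beta>, \<gamma>)"

definition red_z :: S where "red_z = const (- \<alpha> / \<gamma>) * var_x + const (- \<beta> / \<gamma>) * var_y"
text \<open>Reduction modulo the equation of the line, with values in \<open>\<complex>[x, y]\<close>.\<close>

definition red :: "S \<Rightarrow> S" where "red = subst const var_x var_y red_z"

text \<open>The map \<open>flat\<close> is \<^const>\<open>curve_CL\<close> followed by a linear change of coordinates, whose inverse
is \<open>unflat\<close>. The change is chosen so that the coefficients of a tuple, restricted to the line,
become polynomials in the two variables \<open>x\<close> and \<open>y\<close> again.\<close>

definition flat_x :: S where "flat_x = const (1 / \<gamma>) * (const \<alpha> * var_z - var_y)"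
definition flat_y :: S where "flat_y = const (1 / \<gamma>) * (var_x + const \<beta> * var_z)"
definition flat :: "S poly3 \<Rightarrow> S" where "flat = subst red flat_x flat_y var_z"

definition unflat :: "S \<Rightarrow> S" where
  "unflat = subst const (const \<gamma> * var_y - const \<beta> * var_z) (const \<alpha> * var_z - const \<gamma> * var_x) var_z"

lemma rhom_red: "rhom red"
  unfolding red_def by (rule rhom_subst[OF rhom_const])

lemma rhom_flat: "rhom flat"
  unfolding flat_def by (rule rhom_subst[OF rhom_red])

lemma rhom_unflat: "rhom unflat"
  unfolding unflat_def by (rule rhom_subst[OF rhom_const])

lemmas red_simps = rhom.simps[OF rhom_red]
lemmas flat_simps = rhom.simps[OF rhom_flat]
lemmas unflat_simps = rhom.simps[OF rhom_unflat]

lemma red_const [simp]: "red (const c) = const c"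
  by (simp add: red_def subst_const const_simps)

lemma red_vars [simp]: "red var_x = var_x" "red var_y = var_y" "red var_z = red_z"
  by (simp_all add: red_def subst_vars rhom_const)

lemma flat_const [simp]: "flat (const c) = red c"
  by (simp add: flat_def subst_const red_simps)

lemma flat_vars [simp]: "flat var_x = flat_x" "flat var_y = flat_y" "flat var_z = var_z"
  by (simp_all add: flat_def subst_vars rhom_red)

lemma flat_smul: "flat (smul r v) = red r * flat v"
  by (simp add: smul_const flat_simps)

lemma unflat_const [simp]: "unflat (const c) = const c"
  by (simp add: unflat_def subst_const const_simps)

lemma unflat_vars [simp]:
  "unflat var_x = const \<gamma> * var_y - const \<beta> * var_z" "unflat var_y = const \<alpha> * var_z - const \<gamma> * var_x"
  "unflat var_z = var_z"
  by (simp_all add: unflat_def subst_vars rhom_const)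

lemma gamma_red_z: "const \<gamma> * red_z = - (const \<alpha> * var_x + const \<beta> * var_y)"
proof -
  have "const \<gamma> * red_z = const (\<gamma> * (- \<alpha> / \<gamma>)) * var_x + const (\<gamma> * (- \<beta> / \<gamma>)) * var_y"
    unfolding red_z_def const_simps(4) by (simp add: algebra_simps)
  then show ?thesis using gamma by (simp add: const_simps)
qed

lemma const_inverse_gamma: "const (1 / \<gamma>) * (const \<gamma> * A) = (A :: S)"
  using gamma by (simp add: mult.assoc[symmetric] flip: const_simps(4)) (simp add: const_simps)

lemma gamma_flat: "const \<gamma> * flat_x = const \<alpha> * var_z - var_y" "const \<gamma> * flat_y = var_x + const \<beta> * var_z"
  unfolding flat_x_def flat_y_def by (simp_all only: const_inverse_gamma mult.left_commute[of "const \<gamma>"])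

lemma const_gamma_cancel: "const \<gamma> * A = const \<gamma> * B \<Longrightarrow> A = (B::S)"
proof -
  assume "const \<gamma> * A = const \<gamma> * B"
  moreover have "coef (const \<gamma>) (0, 0, 0) \<noteq> coef (0::S) (0, 0, 0)" using gamma by (simp add: const_def)
  then have "const \<gamma> \<noteq> (0::S)" by metis
  ultimately show ?thesis by simp
qed

lemma red_line: "red lf = 0"
  using gamma_red_z by (simp add: red_simps)

lemma is_form_red_z: "is_form (Suc 0) red_z"
  unfolding red_z_def by (intro is_form_add is_form_const_mult is_form_vars)

lemma is_form_flat_xy: "is_form (Suc 0) flat_x" "is_form (Suc 0) flat_y"
  unfolding flat_x_def flat_y_def by (intro is_form_add is_form_diff is_form_const_mult is_form_vars)+

lemma is_form_red: "is_form n p \<Longrightarrow> is_form n (red p)"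
  using is_form_subst[OF is_form_vars(1,2) is_form_red_z, of n p const 0]
  by (simp add: red_def const_simps)

lemma red_hpart: "red (hpart n p) = hpart n (red p)"
  unfolding red_def by (rule hpart_subst_const[OF is_form_vars(1,2) is_form_red_z])

lemma line_dvd_diff_red: "lf dvd p - red p"
proof -
  have "const \<gamma> * (var_z - red_z) = lf"
    using gamma_red_z by (simp add: right_diff_distrib)
  then have "var_z - red_z = lf * const (1 / \<gamma>)"
    by (metis const_inverse_gamma mult.commute)
  then have "lf dvd var_z - red_z" by (rule dvdI)
  then have "lf dvd subst const var_x var_y var_z p - subst const var_x var_y red_z p"
    by (intro subst_dvd_diff rhom_const) auto
  then show ?thesis by (simp add: red_def subst_vars_id)
qed

lemma red_eq_0_iff: "red p = 0 \<longleftrightarrow> lf dvd p"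
  using line_dvd_diff_red[of p] red_line by (auto simp: red_simps elim!: dvdE)

lemma zdeg_le_red: "zdeg_le 0 (red p)"
proof -
  have "zdeg_le 0 (const c * monom3 var_x var_y red_z m)" for c m
  proof (cases m)
    case (fields i j l)
    have r: "zdeg_le 0 red_z"
      unfolding red_z_def by (intro zdeg_le_add zdeg_le_const_mult zdeg_le_vars)
    have "zdeg_le (0 * i + 0 * j + 0 * l) (var_x ^ i * var_y ^ j * red_z ^ l)"
      by (intro zdeg_le_mult zdeg_le_power r zdeg_le_vars)
    then show ?thesis by (simp add: fields zdeg_le_const_mult)
  qed
  then show ?thesis
    unfolding red_def by (simp add: subst_sum_mons const_simps zdeg_le_sum)
qed

lemma red_binary: "zdeg_le 0 p \<Longrightarrow> red p = p"
proof -
  assume p: "zdeg_le 0 p"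
  have "red (monomial m c) = monomial m c" if "m \<in> mons p" for m c
    using that p by (auto simp: zdeg_le_def monomial_const red_simps)
  then have "red (\<Sum>m\<in>mons p. monomial m (coef p m)) = (\<Sum>m\<in>mons p. monomial m (coef p m))"
    by (simp add: red_simps)
  then show ?thesis by (simp add: poly_mapping_sum_monomials[symmetric])
qed

lemma red_red [simp]: "red (red p) = red p"
  by (rule red_binary[OF zdeg_le_red])

lemma zdeg_le_flat_xy: "zdeg_le (Suc 0) flat_x" "zdeg_le (Suc 0) flat_y"
  unfolding flat_x_def flat_y_def by (intro zdeg_le_add zdeg_le_diff zdeg_le_const_mult zdeg_le_vars)+

lemma zdeg_le_flat:
  assumes "is_form k g"
  shows "zdeg_le k (flat g)"
proof -
  have "zdeg_le (mdeg m) (red c * monom3 flat_x flat_y var_z m)" for c m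
  proof (cases m)
    case (fields i j l)
    have "zdeg_le (0 + (Suc 0 * i + Suc 0 * j + Suc 0 * l)) (red c * (flat_x ^ i * flat_y ^ j * var_z ^ l))"
      by (intro zdeg_le_mult zdeg_le_power zdeg_le_red zdeg_le_flat_xy zdeg_le_vars)
    then show ?thesis by (simp add: fields)
  qed
  then show ?thesis
    using assms unfolding flat_def is_form_def
    by (simp add: subst_sum_mons red_simps) (metis (no_types, lifting) zdeg_le_sum)
qed

lemma is_form_flat:
  assumes "is_form k g" "\<And>m. is_form n (coef g m)"
  shows "is_form (n + k) (flat g)"
  using is_form_subst[OF is_form_flat_xy is_form_vars(3) assms(1), of red n] assms(2)
  by (simp add: flat_def red_simps is_form_red)

lemma flat_hpart: "is_form k g \<Longrightarrow> flat (coef_hpart_map n g) = hpart (n + k) (flat g)"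
  using hpart_subst_form[OF is_form_flat_xy is_form_vars(3) rhom_red, of k g n]
  by (simp add: flat_def red_hpart)

text \<open>The point of the curve over \<open>Q \<in> L\<close> lies on the line dual to \<open>Q\<close>, which is what the Euler element
expresses.\<close>

lemma flat_euler: "flat euler = 0"
proof (rule const_gamma_cancel)
  have "const \<gamma> * flat euler = var_x * (const \<gamma> * flat_x) + var_y * (const \<gamma> * flat_y) + (const \<gamma> * red_z) * var_z"
    by (simp add: euler_def flat_simps algebra_simps)
  then show "const \<gamma> * flat euler = const \<gamma> * 0"
    unfolding gamma_flat gamma_red_z by (simp add: algebra_simps)
qed

lemma unflat_red: "unflat (red p) = subst const (const \<gamma> * var_y - const \<beta> * var_z)
    (const \<alpha> * var_z - const \<gamma> * var_x) (const \<beta> * var_x - const \<alpha> * var_y) p"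
proof -
  have "unflat red_z = const \<beta> * var_x - const \<alpha> * var_y"
  proof (rule const_gamma_cancel)
    have "const \<gamma> * unflat red_z = unflat (const \<gamma> * red_z)" by (simp add: unflat_simps)
    then show "const \<gamma> * unflat red_z = const \<gamma> * (const \<beta> * var_x - const \<alpha> * var_y)"
      unfolding gamma_red_z by (simp add: unflat_simps algebra_simps)
  qed
  moreover have "unflat \<circ> const = const" by auto
  ultimately show ?thesis
    unfolding red_def rhom_comp_subst[OF rhom_unflat rhom_const] by simp
qed

lemma curve_CL_eq: "curve_CL (\<alpha>, \<beta>, \<gamma>) g = unflat (flat g)"
proof -
  have g: "const \<gamma> * unflat p = unflat (const \<gamma> * p)" for p by (simp add: unflat_simps)
  have "unflat flat_x = var_x" "unflat flat_y = var_y"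
    by (rule const_gamma_cancel; simp add: g gamma_flat unflat_simps)+
  moreover have "unflat \<circ> red = subst const (const \<gamma> * var_y - const \<beta> * var_z)
    (const \<alpha> * var_z - const \<gamma> * var_x) (const \<beta> * var_x - const \<alpha> * var_y)"
    by (rule ext) (simp add: unflat_red)
  ultimately show ?thesis
    unfolding flat_def rhom_comp_subst[OF rhom_unflat rhom_red] by simp
qed

lemma unflat_inverse: "subst const flat_x flat_y var_z (unflat F) = F"
proof -
  note h = rhom_subst[OF rhom_const, of flat_x flat_y var_z]
  have "subst const flat_x flat_y var_z \<circ> const = (const :: complex \<Rightarrow> S)"
    by (rule ext) (simp add: subst_const const_simps)
  moreover have "subst const flat_x flat_y var_z (const \<gamma> * var_y - const \<beta> * var_z) = var_x"
    "subst const flat_x flat_y var_z (const \<alpha> * var_z - const \<gamma> * var_x) = var_y"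
    by (simp_all add: rhom.simps[OF h] subst_const subst_vars rhom_const const_simps(1) gamma_flat)
  ultimately show ?thesis
    unfolding unflat_def rhom_comp_subst[OF h rhom_const]
    by (simp add: subst_vars rhom_const subst_vars_id)
qed

lemma unflat_eq_0_iff: "unflat F = 0 \<longleftrightarrow> F = 0"
  using unflat_inverse[of F] by (metis rhom.zero[OF rhom_unflat] unflat_inverse)

text \<open>The two linear forms \<open>V\<close> generate, together with \<open>\<partial>\<^sub>z\<close>, the linear forms in the \<open>\<partial>\<close>'s. On the
line the Euler element becomes a multiple of \<open>x V' - y V\<close>, where \<open>V\<close> and \<open>V'\<close> belong to \<open>x\<close> and \<open>y\<close>:
it is the Koszul relation between their images \<open>x\<close> and \<open>y\<close> under \<open>flat\<close>.\<close>

definition mult_pair :: "S \<Rightarrow> S poly3 \<Rightarrow> bool" where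
  "mult_pair u V \<longleftrightarrow> (u = var_x \<and> V = const (const \<gamma>) * var_y - const (const \<beta>) * var_z) \<or>
     (u = var_y \<and> V = const (const \<alpha>) * var_z - const (const \<gamma>) * var_x)"

lemma mult_pair_flat: "mult_pair u V \<Longrightarrow> flat V = u"
  by (auto simp: mult_pair_def flat_simps gamma_flat)

lemma mult_pair_form: "mult_pair u V \<Longrightarrow> is_form (Suc 0) V"
  by (auto simp: mult_pair_def intro!: is_form_diff is_form_const_mult is_form_vars)

lemma mult_pair_red: "mult_pair u V \<Longrightarrow> red u = u"
  by (auto simp: mult_pair_def)

lemma flat_lift:
  assumes "mult_pair u V" "zdeg_le k F"
  shows "flat (lift u V k F) = u ^ k * F"
proof -
  have "flat (lift_term u V k m (coef F m)) = u ^ k * monomial m (coef F m)" if "m \<in> mons F" for m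
  proof -
    obtain i j l where m: "m = (i, j, l)" by (metis prod_cases3)
    then have "l \<le> k" using assms(2) that by (auto simp: zdeg_le_def)
    then have "u ^ k = u ^ l * u ^ (k - l)" by (simp flip: power_add)
    then show ?thesis
      using assms(1) by (simp add: m lift_term_def flat_simps red_simps mult_pair_flat mult_pair_red
          monomial_const power_mult_distrib algebra_simps)
  qed
  then have "flat (lift u V k F) = u ^ k * (\<Sum>m\<in>mons F. monomial m (coef F m))"
    by (simp add: lift_def flat_simps sum_distrib_left)
  then show ?thesis by (simp only: poly_mapping_sum_monomials[symmetric])
qed

abbreviation (input) cong_el :: "S poly3 \<Rightarrow> S poly3 \<Rightarrow> bool" where
  "cong_el \<equiv> cong2 euler (const lf)"

lemma const_const_inverse_gamma: "const (const (1 / \<gamma>)) * (const (const \<gamma>) * W) = (W :: S poly3)"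
  using const_inverse_gamma[of 1] by (simp add: mult.assoc[symmetric] flip: const_simps(4)) (simp add: const_simps)

lemma cong_flat_xy:
  assumes "mult_pair u V"
  shows "cong_el (const u * var_x) (lift u V (Suc 0) flat_x)" (is ?X)
    "cong_el (const u * var_y) (lift u V (Suc 0) flat_y)" (is ?Y)
proof -
  have lx: "const (const \<gamma>) * lift u V (Suc 0) flat_x = lift u V (Suc 0) (const \<gamma> * flat_x)"
    and ly: "const (const \<gamma>) * lift u V (Suc 0) flat_y = lift u V (Suc 0) (const \<gamma> * flat_y)"
    by (simp_all add: lift_const_mult zdeg_le_flat_xy)
  have ld: "lift u V (Suc 0) (F - G) = lift u V (Suc 0) F - lift u V (Suc 0) G" for F G
    using lift_add[of u V "Suc 0" "F - G" G] by simp
  have ex: "const (const \<gamma>) * lift u V (Suc 0) flat_x = const (const \<alpha>) * (const u * var_z) - const var_y * V"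
    unfolding lx gamma_flat by (simp add: ld lift_const_mult lift_vars)
  have ey: "const (const \<gamma>) * lift u V (Suc 0) flat_y = const var_x * V + const (const \<beta>) * (const u * var_z)"
    unfolding ly gamma_flat by (simp add: lift_add lift_const_mult lift_vars)
  have from_gamma: "cong_el A B"
    if "const (const \<gamma>) * A - const (const \<gamma>) * B = euler * s + const lf * t" for A B s t
  proof -
    have "A - B = const (const (1 / \<gamma>)) * (const (const \<gamma>) * (A - B))" by (simp only: const_const_inverse_gamma)
    also have "\<dots> = const (const (1 / \<gamma>)) * (euler * s + const lf * t)"
      by (simp only: right_diff_distrib[of "const (const \<gamma>)"] that)
    also have "\<dots> = euler * (const (const (1 / \<gamma>)) * s) + const lf * (const (const (1 / \<gamma>)) * t)"
      by (simp add: algebra_simps)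
    finally show ?thesis unfolding cong2_def by blast
  qed
  from assms consider
    (x) "u = var_x" "V = const (const \<gamma>) * var_y - const (const \<beta>) * var_z"
  | (y) "u = var_y" "V = const (const \<alpha>) * var_z - const (const \<gamma>) * var_x"
    unfolding mult_pair_def by blast
  then have "?X \<and> ?Y"
  proof cases
    case x
    have 1: "?X"
      by (rule from_gamma[of _ _ "const (const \<gamma>)" "- var_z"], unfold ex)
        (simp add: x euler_def const_simps(3,4) algebra_simps)
    have 2: "?Y"
      by (rule from_gamma[of _ _ 0 0], unfold ey) (simp add: x algebra_simps)
    show ?thesis using 1 2 by blast
  next
    case y
    have 1: "?X"
      by (rule from_gamma[of _ _ 0 0], unfold ex) (simp add: y algebra_simps)
    have 2: "?Y"
      by (rule from_gamma[of _ _ "const (const \<gamma>)" "- var_z"], unfold ey)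
        (simp add: y euler_def const_simps(3,4) algebra_simps)
    show ?thesis using 1 2 by blast
  qed
  then show ?X ?Y by auto
qed

lemma cong_const_red: "cong_el (const c) (const (red c))"
proof -
  obtain b where "c - red c = lf * b" using line_dvd_diff_red[of c] by blast
  then have "const c - const (red c) = euler * 0 + const lf * const b"
    unfolding const_simps(4)[symmetric] const_simps(6)[symmetric] by simp
  then show ?thesis unfolding cong2_def by blast
qed

text \<open>By multiplicativity of \<open>lift\<close> this needs to be checked for linear forms only. It says that
multiplication by \<open>u ^ k\<close> rewrites a tuple, modulo the Euler element and the line, as the homogenization
of its image under \<open>flat\<close>. So, up to that power and modulo these two elements, a tuple is determined by its image.\<close>

lemma cong_lift_flat:
  assumes "mult_pair u V" "is_form k g"
  shows "cong_el (const (u ^ k) * g) (lift u V k (flat g))"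
proof -
  have t: "cong_el (const (u ^ k) * monomial m c) (lift u V k (red c * monom3 flat_x flat_y var_z m))"
    if "mdeg m = k" for m and c :: S
  proof -
    obtain i j l where m: "m = (i, j, l)" by (metis prod_cases3)
    have k: "i + j + l = k" using that m by simp
    have "const (u ^ k) * monomial m c = const c * ((const u * var_x) ^ i * (const u * var_y) ^ j * (const u * var_z) ^ l)"
      by (simp add: m monomial_const power_mult_distrib const_simps power_add flip: k)
    moreover have "lift u V (0 + (Suc 0 * i + Suc 0 * j + Suc 0 * l)) (red c * (flat_x ^ i * flat_y ^ j * var_z ^ l)) =
        const (red c) * (lift u V (Suc 0) flat_x ^ i * lift u V (Suc 0) flat_y ^ j * (const u * var_z) ^ l)"
      by (simp only: lift_mult lift_power lift_binary lift_vars zdeg_le_mult zdeg_le_power zdeg_le_red zdeg_le_flat_xy zdeg_le_vars)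
    moreover have "cong_el (const c * ((const u * var_x) ^ i * (const u * var_y) ^ j * (const u * var_z) ^ l))
       (const (red c) * (lift u V (Suc 0) flat_x ^ i * lift u V (Suc 0) flat_y ^ j * (const u * var_z) ^ l))"
      by (intro cong2_mult cong2_power cong_const_red cong_flat_xy[OF assms(1)] cong2_refl)
    ultimately show ?thesis using k by (simp add: m)
  qed
  have "cong_el (\<Sum>m\<in>mons g. const (u ^ k) * monomial m (coef g m))
      (\<Sum>m\<in>mons g. lift u V k (red (coef g m) * monom3 flat_x flat_y var_z m))"
    using assms(2) unfolding is_form_def by (intro cong2_sum t) auto
  moreover have "(\<Sum>m\<in>mons g. const (u ^ k) * monomial m (coef g m)) = const (u ^ k) * g"
    by (simp only: sum_distrib_left[symmetric] poly_mapping_sum_monomials[symmetric])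
  ultimately show ?thesis
    by (simp add: flat_def subst_sum_mons red_simps lift_sum)
qed

text \<open>If \<open>flat g = 0\<close>, then \<open>u ^ k g\<close> is a combination of the Euler element and the equation of the line.
Taking homogeneous parts of the cofactors with respect to the \<open>\<partial>\<close>'s makes it one of the required degree.\<close>

lemma flat_kernel_var:
  assumes "u = var_x \<or> u = var_y" "is_form k g" "flat g = 0" "k \<ge> 1"
  shows "\<exists>e\<in>euler_span k. \<exists>v\<in>Der k. smul (u ^ k) g = e + smul lf v"
proof -
  obtain V where V: "mult_pair u V" using assms(1) unfolding mult_pair_def by blast
  have "cong_el (const (u ^ k) * g) 0"
    using cong_lift_flat[OF V assms(2)] assms(3) by simp
  then obtain a b where ab: "const (u ^ k) * g = euler * a + const lf * b"
    unfolding cong2_def by auto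
  have "is_form k (const (u ^ k) * g)" using assms(2) by (rule is_form_const_mult)
  then have "const (u ^ k) * g = hpart k (euler * a) + hpart k (const lf * b)"
    unfolding ab hpart_add[symmetric] by (simp add: hpart_form)
  also have "hpart k (euler * a) = euler * hpart (k - 1) a"
    using hpart_mult_form[OF is_form_euler, of "k - 1" a] assms(4) by simp
  also have "hpart k (const lf * b) = const lf * hpart k b"
    using hpart_mult_form[OF is_form_const[of lf], of k b] by simp
  finally have "smul (u ^ k) g = euler * hpart (k - 1) a + smul lf (hpart k b)"
    by (simp add: smul_const)
  moreover have "euler * hpart (k - 1) a \<in> euler_span k"
    using assms(4) by (intro euler_mult_in_span[OF is_form_hpart]) simp
  ultimately show ?thesis using is_form_hpart[of k b] unfolding Der_def by blast
qed

end

context line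
begin

section \<open>Feet of points\<close>

text \<open>The foot of \<open>p\<close> is the point where the line \<open>L\<close> meets the line dual to \<open>p\<close>, and \<open>flat_pt p\<close> is \<open>p\<close>
in the coordinates introduced by \<open>flat\<close>. Both have the same first two coordinates.\<close>

fun foot :: "point \<Rightarrow> point" where
  "foot (a, b, c) = (\<gamma> * b - \<beta> * c, \<alpha> * c - \<gamma> * a, \<beta> * a - \<alpha> * b)"

fun flat_pt :: "point \<Rightarrow> point" where
  "flat_pt (a, b, c) = (\<gamma> * b - \<beta> * c, \<alpha> * c - \<gamma> * a, c)"

lemma peval_red_z: "peval red_z (x, y, z) = - (\<alpha> * x + \<beta> * y) / \<gamma>"
  using gamma by (simp add: red_z_def peval_simps field_simps del: peval.simps)

lemma peval_red_foot:
  assumes "foot p = (x, y, z)"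
  shows "peval (red q) (x, y, z') = peval q (x, y, z)"
proof -
  obtain a b c where p: "p = (a, b, c)" by (metis prod_cases3)
  have xyz: "x = \<gamma> * b - \<beta> * c" "y = \<alpha> * c - \<gamma> * a" "z = \<beta> * a - \<alpha> * b"
    using assms by (simp_all add: p)
  have "- (\<alpha> * x + \<beta> * y) / \<gamma> = z"
    unfolding xyz using gamma by (simp add: field_simps)
  then show ?thesis
    by (simp add: red_def peval_subst_const peval_red_z del: peval.simps)
qed

lemma peval_red_flat_pt: "peval (red q) (flat_pt p) = peval q (foot p)"
  using peval_red_foot[of p] by (cases p) (simp del: peval.simps)

lemma peval_flat_xy_flat_pt: 
  "peval flat_x (flat_pt (a, b, c)) = a" "peval flat_y (flat_pt (a, b, c)) = b"
  using gamma by (simp_all add: flat_x_def flat_y_def peval_simps field_simps del: peval.simps)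

lemma peval_flat:
  "peval (flat g) (flat_pt (a, b, c)) = subst (\<lambda>q. peval q (foot (a, b, c))) a b c g"
  unfolding flat_def
  by (simp only: peval_subst[OF rhom_red] peval_red_flat_pt peval_flat_xy_flat_pt)
    (simp del: peval.simps)

lemma peval_dual_line_foot: "peval (dual_line p) (foot p) = 0"
  by (cases p) (simp add: peval_dual_line algebra_simps del: peval.simps dual_line.simps)

lemma is_form_dual_line: "is_form (Suc 0) (dual_line p)"
  by (cases p) (auto intro!: is_form_add is_form_const_mult is_form_vars)

text \<open>The reduced equation of the dual line is, up to a scalar, \<open>y\<^sub>0 x - x\<^sub>0 y\<close> where \<open>(x\<^sub>0, y\<^sub>0)\<close> are the
first coordinates of the foot. Modulo this form one variable is a multiple of the other, and what is left
of \<open>A\<close> is its value at the foot times a power of a variable.\<close>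

lemma red_dual_line_dvd:
  assumes A: "is_form n A" "zdeg_le 0 A" "peval A (foot p) = 0" and p: "foot p = (x, y, z)" "(x, y) \<noteq> (0, 0)"
  shows "red (dual_line p) dvd A"
proof -
  let ?d = "const y * var_x - const x * var_y :: S"
  obtain a b c where abc: "p = (a, b, c)" by (metis prod_cases3)
  have "const \<gamma> * red (dual_line p) = - ?d"
  proof -
    have "const \<gamma> * red (dual_line p) = const (\<gamma> * a) * var_x + const (\<gamma> * b) * var_y + const c * (const \<gamma> * red_z)"
      by (simp add: abc red_simps const_simps algebra_simps)
    also have "\<dots> = - ?d"
    proof -
      have xy: "x = \<gamma> * b - \<beta> * c" "y = \<alpha> * c - \<gamma> * a"
        using p(1) by (simp_all add: abc)
      show ?thesis unfolding gamma_red_z xy by (simp add: const_simps algebra_simps)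
    qed
    finally show ?thesis .
  qed
  then have "red (dual_line p) = ?d * (- const (1 / \<gamma>))"
    by (metis const_inverse_gamma minus_mult_commute mult.commute)
  moreover have "- const (1 / \<gamma>) dvd (1 :: S)"
  proof
    show "1 = - const (1 / \<gamma>) * (- const \<gamma> :: S)"
      using const_inverse_gamma[of 1] by simp
  qed
  moreover have "?d dvd A"
  proof -
    have A0: "A = subst const var_x var_y 0 A"
    proof -
      have "const (coef A m) * monom3 var_x var_y 0 m = const (coef A m) * monom3 var_x var_y var_z m" if "m \<in> mons A" for m
        using that A(2) by (auto simp: zdeg_le_def)
      then have "subst const var_x var_y 0 A = subst const var_x var_y var_z A"
        by (simp only: subst_sum_mons const_simps(1) cong: sum.cong)
      then show ?thesis by (simp add: subst_vars_id)
    qed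
    have z0: "peval A (x, y, z') = 0" for z'
      using A(3) peval_red_foot[OF p(1), of A] red_binary[OF A(2)] p(1) by (metis)
    show ?thesis
    proof (cases "y = 0")
      case False
      have "peval A (x / y, 1, 0) = peval A (pscale (1 / y) (x, y, 0))"
        using False by (simp del: peval.simps)
      then have e: "peval A (x / y, 1, 0) = 0"
        by (simp only: peval_pscale[OF A(1)] z0 mult_zero_right)
      have "const y * const (x / y) = (const x :: S)"
        using False by (simp flip: const_simps(4))
      then have d: "?d = const y * (var_x - var_y * const (x / y))"
        by (simp add: algebra_simps)
      have i: "const (1 / y) * const y = (1 :: S)"
        using False by (simp flip: const_simps(2,4))
      have "?d * const (1 / y) = (const (1 / y) * const y) * (var_x - var_y * const (x / y))"
        unfolding d by (simp only: mult_ac)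
      then have "var_x - var_y * const (x / y) = ?d * const (1 / y)"
        unfolding i by simp
      then have "?d dvd var_x - var_y * const (x / y)" by (rule dvdI)
      then have "?d dvd subst const var_x var_y 0 A
          - subst const (var_y * const (x / y)) (var_y * const 1) (var_y * const 0) A"
        by (intro subst_dvd_diff rhom_const) (simp_all add: const_simps)
      then show ?thesis
        unfolding form_subst_multiples[OF A(1)] e using A0 by (simp add: const_simps)
    next
      case True
      then have x: "x \<noteq> 0" using p(2) by simp
      have "peval A (1, 0, 0) = peval A (pscale (1 / x) (x, y, 0))"
        using x True by (simp del: peval.simps)
      then have e: "peval A (1, 0, 0) = 0"
        by (simp only: peval_pscale[OF A(1)] z0 mult_zero_right)
      have i: "const (1 / x) * const x = (1 :: S)"
        using x by (simp flip: const_simps(2,4))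
      have "?d * (- const (1 / x)) = (const (1 / x) * const x) * var_y"
        using True by (simp add: const_simps mult_ac)
      then have "var_y - var_x * const 0 = ?d * (- const (1 / x))"
        unfolding i by (simp add: const_simps)
      then have "?d dvd var_y - var_x * const 0" by (rule dvdI)
      then have "?d dvd subst const var_x var_y 0 A
          - subst const (var_x * const 1) (var_x * const 0) (var_x * const 0) A"
        by (intro subst_dvd_diff rhom_const) (simp_all add: const_simps)
      then show ?thesis
        unfolding form_subst_multiples[OF A(1)] e using A0 by (simp add: const_simps)
    qed
  qed
  ultimately show ?thesis
    using mult_dvd_mono[of ?d A "- const (1 / \<gamma>)" 1] by simp
qed

end

section \<open>The arrangement on a generic line\<close>

text \<open>Genericity means that the feet of the points of \<open>Z\<close> are defined and lie on no further line of the
arrangement. The third coordinate of a point on the line is determined by the other two, so a foot is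
a point if and only if these do not both vanish.\<close>

locale generic_line = line +
  fixes Z :: "point set" and k :: nat
  assumes fin: "finite Z" and k_pos: "k \<ge> 1"
    and foot_nonzero: "\<And>p x y z. p \<in> Z \<Longrightarrow> foot p = (x, y, z) \<Longrightarrow> (x, y) \<noteq> (0, 0)"
    and foot_generic: "\<And>p q. p \<in> Z \<Longrightarrow> q \<in> Z \<Longrightarrow> p \<noteq> q \<Longrightarrow> peval (dual_line q) (foot p) \<noteq> 0"
begin

abbreviation (input) f :: S where "f \<equiv> arr_poly Z"

text \<open>The factor of \<open>f\<close> complementary to the line dual to \<open>p\<close>.\<close>

definition others :: "point \<Rightarrow> S" where
  "others p = (\<Prod>q\<in>Z - {p}. dual_line q)"

definition grad :: "S poly3 \<Rightarrow> S" where
  "grad g = subst id (pd_x f) (pd_y f) (pd_z f) g"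

lemma rhom_grad: "rhom grad"
  unfolding grad_def by (rule rhom_subst[OF rhom_id])

lemmas grad_simps = rhom.simps[OF rhom_grad]

lemma grad_const [simp]: "grad (const c) = c"
  by (simp add: grad_def subst_const)

lemma arr_poly_split: "p \<in> Z \<Longrightarrow> f = dual_line p * others p"
  unfolding arr_poly_def others_def using fin by (rule prod.remove)

lemma is_form_arr_poly: "is_form (card Z) f"
  using is_form_prod[of Z "\<lambda>_. Suc 0" dual_line] is_form_dual_line by (simp add: arr_poly_def)

lemma is_form_others: "p \<in> Z \<Longrightarrow> is_form (card Z - 1) (others p)"
  using is_form_prod[of "Z - {p}" "\<lambda>_. Suc 0" dual_line] is_form_dual_line fin
  by (simp add: others_def)

lemma peval_others: "p \<in> Z \<Longrightarrow> peval (others p) (foot p) \<noteq> 0"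
  unfolding others_def peval_simps(8) using foot_generic fin
  by (metis (no_types, lifting) DiffD1 DiffD2 finite_Diff insertI1 prod_zero_iff)

lemma peval_others_other: "p \<in> Z \<Longrightarrow> q \<in> Z \<Longrightarrow> q \<noteq> p \<Longrightarrow> peval (others q) (foot p) = 0"
  unfolding others_def using fin peval_dual_line_foot[of p]
  by (simp add: peval_simps del: peval.simps) blast

lemma peval_red_foot': "peval (red q) (foot p) = peval q (foot p)"
  using peval_red_foot[of p] by (cases "foot p") (metis)

lemma peval_pd_foot:
  assumes "p \<in> Z" "p = (a, b, c)"
  shows "peval (pd_x f) (foot p) = peval (others p) (foot p) * a"
    "peval (pd_y f) (foot p) = peval (others p) (foot p) * b"
    "peval (pd_z f) (foot p) = peval (others p) (foot p) * c"
proof -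
  have "pd_x f = const a * others p + dual_line p * pd_x (others p)"
    "pd_y f = const b * others p + dual_line p * pd_y (others p)"
    "pd_z f = const c * others p + dual_line p * pd_z (others p)"
    unfolding arr_poly_split[OF assms(1)] derivation.mult[OF derivation_pd(1)]
      derivation.mult[OF derivation_pd(2)] derivation.mult[OF derivation_pd(3)] assms(2) pd_dual_line
    by (rule refl)+
  then show "peval (pd_x f) (foot p) = peval (others p) (foot p) * a"
    "peval (pd_y f) (foot p) = peval (others p) (foot p) * b"
    "peval (pd_z f) (foot p) = peval (others p) (foot p) * c"
    by (simp_all add: peval_simps peval_dual_line_foot mult.commute del: peval.simps)
qed

text \<open>Exactly one factor of \<open>f\<close> vanishes at the foot of \<open>p\<close>, so by the product rule the gradient of \<open>f\<close>
there is a nonzero multiple of \<open>p\<close>. This turns the condition of being a syzygy into the condition of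
passing through \<open>p\<close>.\<close>

lemma peval_grad_foot:
  assumes "p \<in> Z" "is_form n g"
  shows "peval (grad g) (foot p) = peval (others p) (foot p) ^ n * peval (flat g) (flat_pt p)"
proof -
  obtain a b c where p: "p = (a, b, c)" by (metis prod_cases3)
  have "peval (grad g) (foot p) = subst (\<lambda>q. peval q (foot p)) (peval (others p) (foot p) * a)
      (peval (others p) (foot p) * b) (peval (others p) (foot p) * c) g"
    unfolding grad_def by (simp only: peval_subst[OF rhom_id] peval_pd_foot[OF assms(1) p] id_apply)
  also have "\<dots> = peval (others p) (foot p) ^ n * subst (\<lambda>q. peval q (foot p)) a b c g"
    using assms(2) unfolding is_form_def
    by (simp add: subst_sum_mons peval_simps monom3_scale sum_distrib_left mult.left_commute
        del: peval.simps cong: sum.cong_simp)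
  also have "subst (\<lambda>q. peval q (foot p)) a b c g = peval (flat g) (flat_pt p)"
    unfolding p by (rule peval_flat[symmetric])
  finally show ?thesis .
qed

lemma syz_iff: "g \<in> syz k Z \<longleftrightarrow> g \<in> Der k \<and> f dvd grad g"
  by (simp add: syz_def grad_def Let_def)

lemma syz_vanish:
  assumes "g \<in> syz k Z" "p \<in> Z"
  shows "peval (flat g) (flat_pt p) = 0"
proof -
  have "f dvd grad g" "is_form k g" using assms(1) by (auto simp: syz_iff Der_def)
  then have "peval (grad g) (foot p) = 0"
    using arr_poly_split[OF assms(2)] by (auto simp: peval_simps peval_dual_line_foot simp del: peval.simps elim!: dvdE)
  then show ?thesis
    using peval_grad_foot[OF assms(2) \<open>is_form k g\<close>] peval_others[OF assms(2)] by simp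
qed

lemma red_dual_line_nonzero: "p \<in> Z \<Longrightarrow> red (dual_line p) \<noteq> 0"
proof
  assume p: "p \<in> Z" "red (dual_line p) = 0"
  obtain a b c where abc: "p = (a, b, c)" by (metis prod_cases3)
  have "const \<gamma> * red (dual_line p) = const (\<gamma> * a) * var_x + const (\<gamma> * b) * var_y + const c * (const \<gamma> * red_z)"
    by (simp add: abc red_simps const_simps algebra_simps)
  also have "\<dots> = const (\<gamma> * a - \<alpha> * c) * var_x + const (\<gamma> * b - \<beta> * c) * var_y"
    unfolding gamma_red_z by (simp add: const_simps algebra_simps)
  finally have e: "const (\<gamma> * a - \<alpha> * c) * var_x + const (\<gamma> * b - \<beta> * c) * var_y = (0::S)" using p by simp
  have "\<gamma> * a - \<alpha> * c = 0" "\<gamma> * b - \<beta> * c = 0"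
    using arg_cong[OF e, of "\<lambda>q. peval q (1, 0, 0)"] arg_cong[OF e, of "\<lambda>q. peval q (0, 1, 0)"]
    by (simp_all add: peval_simps del: peval.simps)
  then show False
    using foot_nonzero[OF p(1)] by (auto simp: abc)
qed

lemma red_arr_poly_nonzero: "red f \<noteq> 0"
  using fin red_dual_line_nonzero by (simp add: arr_poly_def red_simps)

text \<open>The factors are pairwise coprime because each of them is nonzero at the feet of the other points.\<close>

lemma red_arr_poly_dvd:
  assumes "Y \<subseteq> Z" "is_form n A" "zdeg_le 0 A" "\<And>p. p \<in> Y \<Longrightarrow> peval A (foot p) = 0"
  shows "(\<Prod>p\<in>Y. red (dual_line p)) dvd A"
proof -
  have "finite Y" using assms(1) fin finite_subset by blast
  then show ?thesis using assms
  proof (induction Y arbitrary: n A)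
    case (insert p Y)
    have p: "p \<in> Z" using insert.prems by blast
    let ?l = "red (dual_line p)"
    obtain x y z where xyz: "foot p = (x, y, z)" by (metis prod_cases3)
    have "?l dvd A"
      by (rule red_dual_line_dvd[OF insert.prems(2,3) _ xyz foot_nonzero[OF p xyz]])
        (rule insert.prems(4), simp)
    then obtain B where B: "A = ?l * B" by blast
    have "is_form (n - Suc 0) B"
      using insert.prems(2) unfolding B
      by (rule form_quotient[OF is_form_red[OF is_form_dual_line] red_dual_line_nonzero[OF p]])
    moreover have "?l * red B = ?l * B"
      using red_binary[OF insert.prems(3)] by (simp add: B red_simps)
    then have "red B = B" using red_dual_line_nonzero[OF p] by simp
    then have "zdeg_le 0 B" using zdeg_le_red[of B] by simp
    moreover have "peval B (foot q) = 0" if q: "q \<in> Y" for q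
    proof -
      have "q \<noteq> p" "q \<in> Z" using q insert.hyps insert.prems(1) by auto
      then have "peval ?l (foot q) \<noteq> 0"
        using foot_generic[OF \<open>q \<in> Z\<close> p] by (simp only: peval_red_foot') simp
      moreover have "peval A (foot q) = 0" using insert.prems(4) q by blast
      ultimately show ?thesis by (simp add: B peval_simps del: peval.simps)
    qed
    ultimately have "(\<Prod>p\<in>Y. red (dual_line p)) dvd B"
      using insert.prems(1) by (intro insert.IH[of "n - Suc 0" B]) auto
    then show ?case using insert.hyps by (simp add: B)
  qed simp
qed

lemma pd_arr_poly:
  "pd_x f = (\<Sum>p\<in>Z. const (fst p) * others p)" "pd_y f = (\<Sum>p\<in>Z. const (fst (snd p)) * others p)"
  "pd_z f = (\<Sum>p\<in>Z. const (snd (snd p)) * others p)"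
proof -
  have d: "D (\<Prod>p\<in>Y. dual_line p) = (\<Sum>p\<in>Y. D (dual_line p) * (\<Prod>q\<in>Y - {p}. dual_line q))"
    if "derivation D" "finite Y" for D Y
    using that(2)
  proof (induction Y)
    case empty
    show ?case using derivation.const[OF that(1), of 1] by (simp add: const_simps)
  next
    case (insert q Y)
    have "(\<Prod>r\<in>insert q Y - {p}. dual_line r) = dual_line q * (\<Prod>r\<in>Y - {p}. dual_line r)" if "p \<in> Y" for p
    proof -
      have "insert q Y - {p} = insert q (Y - {p})" using that insert.hyps by auto
      then show ?thesis using insert.hyps by simp
    qed
    then have "(\<Sum>p\<in>Y. D (dual_line p) * (\<Prod>r\<in>insert q Y - {p}. dual_line r))
        = dual_line q * (\<Sum>p\<in>Y. D (dual_line p) * (\<Prod>r\<in>Y - {p}. dual_line r))"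
      by (simp add: sum_distrib_left mult.left_commute)
    then show ?case
      using insert by (simp add: derivation.mult[OF that(1)])
  qed
  have e: "pd_x (dual_line p) = const (fst p)" "pd_y (dual_line p) = const (fst (snd p))"
    "pd_z (dual_line p) = const (snd (snd p))" for p
    by (cases p; simp only: pd_dual_line fst_conv snd_conv)+
  show "pd_x f = (\<Sum>p\<in>Z. const (fst p) * others p)" "pd_y f = (\<Sum>p\<in>Z. const (fst (snd p)) * others p)"
    "pd_z f = (\<Sum>p\<in>Z. const (snd (snd p)) * others p)"
    unfolding arr_poly_def others_def using d[OF derivation_pd(1) fin] d[OF derivation_pd(2) fin] d[OF derivation_pd(3) fin]
    by (simp_all only: e)
qed

end

context generic_line
begin

section \<open>The Jacobian ideal on the line\<close>

text \<open>The ideal generated by \<open>f\<close>, the equation of the line and the \<open>n\<close>-th power of the Jacobian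
ideal.\<close>

definition jac :: "nat \<Rightarrow> S set" where
  "jac n = {A. \<exists>H\<in>Der n. \<exists>a b. A = grad H + f * a + lf * b}"

lemma jac_add: "A \<in> jac n \<Longrightarrow> B \<in> jac n \<Longrightarrow> A + B \<in> jac n"
proof -
  assume "A \<in> jac n" "B \<in> jac n"
  then obtain H a b H' a' b' where "H \<in> Der n" "H' \<in> Der n"
    "A = grad H + f * a + lf * b" "B = grad H' + f * a' + lf * b'"
    unfolding jac_def by blast
  then have "A + B = grad (H + H') + f * (a + a') + lf * (b + b')" "H + H' \<in> Der n"
    by (simp_all add: grad_simps Der_def is_form_add algebra_simps)
  then show ?thesis unfolding jac_def by blast
qed

lemma jac_mult: "A \<in> jac n \<Longrightarrow> C * A \<in> jac n"
proof -
  assume "A \<in> jac n"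
  then obtain H a b where "H \<in> Der n" "A = grad H + f * a + lf * b"
    unfolding jac_def by blast
  then have "C * A = grad (const C * H) + f * (C * a) + lf * (C * b)" "const C * H \<in> Der n"
    by (simp add: grad_simps algebra_simps, simp add: Der_def is_form_const_mult)
  then show ?thesis unfolding jac_def by blast
qed

lemma jac_dvd: "f dvd A \<Longrightarrow> A \<in> jac n" "lf dvd A \<Longrightarrow> A \<in> jac n"
proof -
  have "f * a + lf * b \<in> jac n" for a b
    unfolding jac_def Der_def by (intro CollectI bexI[of _ 0] exI) (auto simp: grad_simps)
  from this[of _ 0] this[of 0] show "f dvd A \<Longrightarrow> A \<in> jac n" "lf dvd A \<Longrightarrow> A \<in> jac n"
    by (auto elim!: dvdE)
qed

lemma jac_sum: "(\<And>i. i \<in> I \<Longrightarrow> A i \<in> jac n) \<Longrightarrow> (\<Sum>i\<in>I. A i) \<in> jac n"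
  by (induction I rule: infinite_finite_induct) (auto intro: jac_add jac_dvd(1))

lemma jac_power: "A \<in> jac 1 \<Longrightarrow> A ^ n \<in> jac n"
proof -
  assume "A \<in> jac 1"
  then obtain H a b where H: "is_form (Suc 0) H" and A: "A = grad H + f * a + lf * b"
    unfolding jac_def Der_def by auto
  have "A - grad H = f * a + lf * b" by (simp add: A)
  then have "cong2 f lf A (grad H)" unfolding cong2_def by blast
  then obtain u v where "A ^ n - grad H ^ n = f * u + lf * v"
    using cong2_power unfolding cong2_def by metis
  then have "A ^ n = grad (H ^ n) + f * u + lf * v"
    by (simp add: grad_simps algebra_simps)
  moreover have "H ^ n \<in> Der n" using is_form_power[OF H, of n] by (simp add: Der_def)
  ultimately show ?thesis unfolding jac_def by blast
qed

lemma others_mult_dvd: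
  assumes "p \<in> Z" "q \<in> Z" "p \<noteq> q"
  shows "f dvd others p * others q"
proof -
  have "dual_line p dvd others q"
    unfolding others_def using assms fin by (intro dvd_prodI) auto
  then show ?thesis
    unfolding arr_poly_split[OF assms(1)] by (metis dvd_refl mult.commute mult_dvd_mono)
qed

text \<open>For a vector \<open>w\<close>, the derivative of \<open>f\<close> in direction \<open>w\<close> is \<open>\<Sum>\<^sub>q (w \<cdot> q) (others q)\<close>.
Multiplied by \<open>others p\<close>, all terms but the one for \<open>p\<close> become multiples of \<open>f\<close>; so any \<open>w\<close> with
\<open>w \<cdot> p = 1\<close> will do.\<close>

lemma others_square_jac:
  assumes Z0: "0 \<notin> Z" and p: "p \<in> Z"
  shows "others p * others p \<in> jac 1"
proof -
  obtain a b c where abc: "p = (a, b, c)" by (metis prod_cases3)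
  define dot :: "point \<Rightarrow> point \<Rightarrow> complex" where
    "dot = (\<lambda>w q. fst w * fst q + fst (snd w) * fst (snd q) + snd (snd w) * snd (snd q))"
  have "\<exists>w. dot w p = 1"
  proof -
    have "a \<noteq> 0 \<or> b \<noteq> 0 \<or> c \<noteq> 0" using Z0 p by (auto simp: abc zero_prod_def)
    then show ?thesis
    proof (elim disjE)
      assume "a \<noteq> 0" then show ?thesis by (intro exI[of _ "(1 / a, 0, 0)"]) (simp add: dot_def abc)
    next
      assume "b \<noteq> 0" then show ?thesis by (intro exI[of _ "(0, 1 / b, 0)"]) (simp add: dot_def abc)
    next
      assume "c \<noteq> 0" then show ?thesis by (intro exI[of _ "(0, 0, 1 / c)"]) (simp add: dot_def abc)
    qed
  qed
  then obtain u v w where w: "dot (u, v, w) p = 1" by (metis prod_cases3)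
  define H :: "S poly3" where
    "H = const (const u) * var_x + const (const v) * var_y + const (const w) * var_z"
  have H: "H \<in> Der 1"
    unfolding H_def Der_def by (auto intro!: is_form_add is_form_const_mult)
  have "grad H = const u * pd_x f + const v * pd_y f + const w * pd_z f"
    by (simp add: H_def grad_simps) (simp add: grad_def subst_vars rhom_id)
  also have "\<dots> = (\<Sum>q\<in>Z. const (dot (u, v, w) q) * others q)"
    unfolding pd_arr_poly by (simp add: dot_def sum_distrib_left const_simps distrib_right sum.distrib mult.assoc)
  also have "\<dots> = others p + (\<Sum>q\<in>Z - {p}. const (dot (u, v, w) q) * others q)"
    using p fin w by (simp add: sum.remove const_simps)
  finally have g: "grad H = \<dots>" .
  have "f dvd others p * (\<Sum>q\<in>Z - {p}. const (dot (u, v, w) q) * others q)"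
    unfolding sum_distrib_left using others_mult_dvd[OF p]
    by (intro dvd_sum) (metis DiffD1 DiffD2 dvd_mult insertI1 mult.left_commute)
  then have "others p * (- (\<Sum>q\<in>Z - {p}. const (dot (u, v, w) q) * others q)) \<in> jac 1"
    by (intro jac_dvd) simp
  moreover have "others p * grad H \<in> jac 1"
    using H by (intro jac_mult) (auto simp: jac_def intro!: bexI[of _ H] exI[of _ 0])
  ultimately have "others p * grad H + others p * (- (\<Sum>q\<in>Z - {p}. const (dot (u, v, w) q) * others q)) \<in> jac 1"
    by (intro jac_add)
  then show ?thesis unfolding g by (simp add: algebra_simps)
qed

text \<open>This expresses that the singular points of the arrangement do not lie on the line. On the line, the
products \<open>others p\<close> form a basis of the forms of degree \<open>|Z| - 1\<close> by Lagrange interpolation at the feet.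
So a power of the variable \<open>u\<close> is a combination of them; its square lies in the ideal, as the squares of the
\<open>others p\<close> do and the mixed products are multiples of \<open>f\<close>. If \<open>Z\<close> is empty, then \<open>f = 1\<close> is itself in the ideal.\<close>

lemma var_power_jac:
  assumes Z0: "0 \<notin> Z" and u: "u = var_x \<or> u = var_y"
  shows "\<exists>e. u ^ e \<in> jac k"
proof (cases "Z = {}")
  case True
  then have "u ^ 0 \<in> jac k" by (intro jac_dvd) (simp add: arr_poly_def)
  then show ?thesis by blast
next
  case False
  define n where "n = card Z - 1"
  have n: "card Z = Suc n" using False fin by (simp add: n_def card_gt_0_iff)
  have ru: "red u = u" "is_form (Suc 0) u" using u by auto
  define c where "c p = peval u (foot p) ^ n / peval (others p) (foot p)" for p
  \<comment> \<open>The interpolation error is a form of degree one less than the number of its zeros, hence \<open>0\<close>.\<close>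
  define A where "A = u ^ n - (\<Sum>q\<in>Z. const (c q) * red (others q))"
  have "is_form (Suc 0 * n) (u ^ n)" by (rule is_form_power[OF ru(2)])
  moreover have "is_form n (const (c q) * red (others q))" if "q \<in> Z" for q
    using is_form_others[OF that] unfolding n_def by (intro is_form_const_mult is_form_red)
  ultimately have An: "is_form n A"
    unfolding A_def by (intro is_form_diff is_form_sum) auto
  have "red A = A" by (simp add: A_def red_simps ru)
  then have Az: "zdeg_le 0 A" using zdeg_le_red[of A] by simp
  have "peval A (foot p) = 0" if p: "p \<in> Z" for p
  proof -
    have "(\<Sum>q\<in>Z. c q * peval (others q) (foot p)) = c p * peval (others p) (foot p)"
      using fin p peval_others_other[OF p] by (subst sum.remove[of _ p]) auto
    also have "\<dots> = peval u (foot p) ^ n" using peval_others[OF p] by (simp add: c_def del: peval.simps)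
    finally show ?thesis
      by (simp add: A_def peval_simps peval_red_foot' del: peval.simps)
  qed
  then have "red f dvd A"
    using red_arr_poly_dvd[OF order_refl An Az] by (simp add: arr_poly_def red_simps)
  then have "red f dvd hpart n A \<and> hpart n A = 0"
    using hpart_mult_form_less[OF is_form_red[OF is_form_arr_poly], of n] n by (auto elim!: dvdE)
  then have "A = 0" using hpart_form[OF An, of n] by simp
  define B where "B = (\<Sum>q\<in>Z. const (c q) * others q)"
  have "red (u ^ n) = red B"
    using \<open>A = 0\<close> by (simp add: A_def B_def red_simps ru)
  then have "red (u ^ n * u ^ n - B * B) = 0" by (simp add: red_simps)
  then have l: "u ^ n * u ^ n - B * B \<in> jac 1" by (intro jac_dvd) (simp only: red_eq_0_iff)
  have "others p * others q \<in> jac 1" if "p \<in> Z" "q \<in> Z" for p q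
    using others_square_jac[OF Z0] others_mult_dvd jac_dvd(1) that by metis
  then have "(const (c p) * const (c q)) * (others p * others q) \<in> jac 1" if "p \<in> Z" "q \<in> Z" for p q
    using that jac_mult by blast
  then have "B * B \<in> jac 1"
    unfolding B_def sum_product by (intro jac_sum) (simp add: mult_ac)
  from jac_add[OF l this] have "u ^ n * u ^ n \<in> jac 1" by simp
  then have "(u ^ (n + n)) ^ k \<in> jac k" by (intro jac_power) (simp add: power_add)
  then show ?thesis by (metis power_mult)
qed

section \<open>Curves come from syzygies\<close>

definition coef_form :: "nat \<Rightarrow> S poly3 \<Rightarrow> bool" where
  "coef_form n g \<longleftrightarrow> (\<forall>m. is_form n (coef g m))"

lemma coef_form_hpart: "coef_form n (coef_hpart_map n g)"
  by (simp add: coef_form_def coef_coef_hpart_map is_form_hpart)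

lemma Der_hpart: "g \<in> Der k \<Longrightarrow> coef_hpart_map n g \<in> Der k"
  by (auto simp: Der_def is_form_def in_keys_iff coef_coef_hpart_map)

lemma is_form_grad:
  assumes "g \<in> Der k" "coef_form n g"
  shows "is_form (n + (card Z - 1) * k) (grad g)"
  unfolding grad_def
proof (rule is_form_subst[OF is_form_pd[OF is_form_arr_poly]])
  show "is_form k g" using assms(1) by (simp add: Der_def)
  show "is_form n (id (coef g m))" for m using assms(2) unfolding coef_form_def id_apply by blast
qed simp

lemma grad_hpart: "g \<in> Der k \<Longrightarrow> grad (coef_hpart_map n g) = hpart (n + (card Z - 1) * k) (grad g)"
  using hpart_subst_form[OF is_form_pd[OF is_form_arr_poly] rhom_id, of k g n]
  by (simp add: grad_def Der_def)

text \<open>The equations, in the coordinates of \<open>flat\<close>, of the curves of degree \<open>d + k\<close> through \<open>Z\<close> with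
multiplicity at least \<open>d\<close> at \<open>P\<close>.\<close>

definition curves :: "nat \<Rightarrow> S set" where
  "curves d = {F. is_form (d + k) F \<and> zdeg_le k F \<and> (\<forall>p\<in>Z. peval F (flat_pt p) = 0)}"

text \<open>The homogenization \<open>g\<close> of \<open>F\<close> satisfies the syzygy condition on the line, that is, \<open>grad g\<close> is a
multiple of \<open>f\<close> plus a multiple \<open>l B\<close> of the equation \<open>l\<close> of the line. The error \<open>l B\<close> is compensated by
an element \<open>H\<close> with \<open>grad H\<close> congruent to a power of \<open>u\<close>: subtracting \<open>l B H\<close> from \<open>h g\<close>, where \<open>h\<close> reduces to
that power, gives a syzygy and changes nothing on the line.\<close>

lemma lift_curve:
  assumes Z0: "0 \<notin> Z" and F: "F \<in> curves d" and u: "u = var_x \<or> u = var_y"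
  shows "\<exists>e. \<exists>g\<in>syz k Z. coef_form (d + e) g \<and> flat g = u ^ e * F"
proof -
  have F: "is_form (d + k) F" "zdeg_le k F" "\<And>p. p \<in> Z \<Longrightarrow> peval F (flat_pt p) = 0"
    using F by (auto simp: curves_def simp del: peval.simps)
  obtain V where V: "mult_pair u V" using u unfolding mult_pair_def by blast
  have ru: "red u = u" "is_form (Suc 0) u" using u by auto
  define g where "g = coef_hpart_map (d + k) (lift u V k F)"
  have lift: "lift u V k F \<in> Der k"
    using is_form_lift[OF F(2) mult_pair_form[OF V]] by (simp add: Der_def)
  have g: "g \<in> Der k" "coef_form (d + k) g"
    unfolding g_def by (auto intro: Der_hpart lift coef_form_hpart)
  have uF: "is_form (n + m) (u ^ n * F')" if "is_form m F'" for n m F'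
    using is_form_mult[OF is_form_power[OF ru(2), of n] that] by simp
  have flat_g: "flat g = u ^ k * F"
    using flat_hpart[of k "lift u V k F" "d + k"] lift uF[OF F(1), of k]
    by (simp add: g_def Der_def flat_lift[OF V F(2)] hpart_form add.commute)
  have "peval (red (grad g)) (foot p) = 0" if "p \<in> Z" for p
    using peval_grad_foot[OF that, of k g] g(1) F(3)[OF that]
    by (simp add: peval_red_foot' flat_g peval_simps Der_def del: peval.simps)
  then have "(\<Prod>p\<in>Z. red (dual_line p)) dvd red (grad g)"
    by (intro red_arr_poly_dvd[OF order_refl is_form_red[OF is_form_grad[OF g]]] zdeg_le_red)
  then obtain A where A: "red (grad g) = red f * A"
    by (auto simp: arr_poly_def red_simps elim!: dvdE)
  have "red (grad g - f * A) = 0"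
    using A red_red[of "grad g"] arg_cong[OF A, of red] by (auto simp: red_simps)
  then obtain B where B: "grad g - f * A = lf * B" unfolding red_eq_0_iff by blast
  obtain e H a b where H: "H \<in> Der k" "u ^ e = grad H + f * a + lf * b"
    using var_power_jac[OF Z0 u] unfolding jac_def by blast
  define h where "h = grad H + f * a"
  define g' where "g' = const h * g - const (lf * B) * H"
  have g': "g' \<in> Der k"
    using g(1) H(1) unfolding g'_def Der_def by (auto intro: is_form_diff is_form_const_mult)
  have "grad g' = h * grad g - lf * B * grad H" by (simp add: g'_def grad_simps)
  also have "\<dots> = h * (f * A + lf * B) - lf * B * (h - f * a)"
    using B by (simp add: h_def algebra_simps)
  also have "\<dots> = f * (h * A + lf * B * a)" by (simp add: algebra_simps)
  finally have fg': "f dvd grad g'" by simp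
  have "red h = u ^ e"
    using arg_cong[OF H(2), of red] by (simp add: red_simps ru h_def red_line del: dual_line.simps)
  then have flat_g': "flat g' = u ^ (e + k) * F"
    by (simp add: g'_def flat_simps red_simps red_line flat_g power_add mult.assoc del: dual_line.simps)
  let ?g = "coef_hpart_map (d + (e + k)) g'"
  have "?g \<in> syz k Z"
    unfolding syz_iff grad_hpart[OF g'] by (intro conjI Der_hpart g' dvd_hpart[OF is_form_arr_poly fg'])
  moreover have "flat ?g = u ^ (e + k) * F"
    using flat_hpart[of k g' "d + (e + k)"] g' uF[OF F(1), of "e + k"]
    by (simp add: Der_def flat_g' hpart_form add_ac)
  ultimately show ?thesis using coef_form_hpart by blast
qed

lemma syz_curve:
  assumes "g \<in> syz k Z" "coef_form n g"
  shows "flat g \<in> curves n"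
proof -
  have g: "is_form k g" using assms(1) by (simp add: syz_iff Der_def)
  moreover have "is_form n (coef g m)" for m using assms(2) unfolding coef_form_def by blast
  ultimately show ?thesis
    using syz_vanish[OF assms(1)] is_form_flat[of k g n] zdeg_le_flat[of k g]
    by (simp add: curves_def del: peval.simps)
qed

lemma is_form_times_var:
  fixes u :: S
  assumes "is_form (e + n) (u ^ e * F)" "u = var_x \<or> u = var_y"
  shows "is_form n F"
proof -
  have u: "is_form (e) (u ^ e)" "u ^ e \<noteq> 0"
    using is_form_power[of "Suc 0" u e] assms(2) by auto
  show ?thesis using form_quotient[OF u assms(1)] by simp
qed

end

section \<open>Divisibility by powers of the variables\<close>

lemma coef_monomial_mult: "coef (monomial a 1 * F) (a + b) = coef (F :: S) b"
proof -
  have "coef (monomial a 1 * monomial m c) (a + b) = coef (monomial m c) b" for m and c :: complex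
    by (simp add: mult_single lookup_single when_def)
  then show ?thesis
    by (subst (1 2) poly_mapping_sum_monomials[of F]) (simp add: sum_distrib_left lookup_sum)
qed

lemma var_power_monomial: "(var_x :: S) ^ e = monomial (e, 0, 0) 1" "(var_y :: S) ^ e = monomial (0, e, 0) 1"
  by (simp_all add: monomial_const const_simps)

lemma zdeg_le_times_var:
  assumes "zdeg_le k (u ^ e * F)" "u = var_x \<or> u = var_y"
  shows "zdeg_le k F"
  unfolding zdeg_le_def
proof safe
  fix i j l assume m: "(i, j, l) \<in> mons F"
  from assms(2) show "l \<le> k"
  proof
    assume "u = var_x"
    then have "(e + i, j, l) \<in> mons (u ^ e * F)"
      using m coef_monomial_mult[of "(e, 0, 0)" F "(i, j, l)"]
      by (simp add: var_power_monomial in_keys_iff)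
    then show ?thesis using assms(1) by (auto simp: zdeg_le_def)
  next
    assume "u = var_y"
    then have "(i, e + j, l) \<in> mons (u ^ e * F)"
      using m coef_monomial_mult[of "(0, e, 0)" F "(i, j, l)"]
      by (simp add: var_power_monomial in_keys_iff)
    then show ?thesis using assms(1) by (auto simp: zdeg_le_def)
  qed
qed

text \<open>Unique factorization, in the only case in which sections are glued.\<close>

lemma coprime_var_powers:
  assumes "var_x ^ a * A = var_y ^ b * (B :: S)"
  shows "\<exists>G. A = var_y ^ b * G \<and> B = var_x ^ a * G"
proof -
  define G where "G = (\<Sum>m\<in>{m\<in>mons A. fst (snd m) \<ge> b}. monomial (fst m, fst (snd m) - b, snd (snd m)) (coef A m))"
  have "b \<le> j" if "(i, j, l) \<in> mons A" for i j l
  proof -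
    have "coef (var_x ^ a * A) (a + i, j, l) \<noteq> 0"
      using that coef_monomial_mult[of "(a, 0, 0)" A "(i, j, l)"]
      by (simp add: var_power_monomial in_keys_iff)
    then have "(a + i, j, l) \<in> mons (monomial (0, b, 0) 1 * B)"
      unfolding assms by (simp add: var_power_monomial in_keys_iff)
    then have "(a + i, j, l) \<in> {m + n |m n. m \<in> mons (monomial (0, b, 0) 1 :: S) \<and> n \<in> mons B}"
      using Poly_Mapping.keys_mult by blast
    then show ?thesis by auto
  qed
  then have all: "{m\<in>mons A. fst (snd m) \<ge> b} = mons A" by auto
  have "var_y ^ b * G = (\<Sum>m\<in>mons A. monomial m (coef A m))"
    unfolding G_def all sum_distrib_left
    using \<open>\<And>l j i. (i, j, l) \<in> mons A \<Longrightarrow> b \<le> j\<close>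
    by (intro sum.cong refl) (auto simp: var_power_monomial mult_single)
  then have A: "A = var_y ^ b * G" by (simp only: poly_mapping_sum_monomials[symmetric])
  have "var_y ^ b * (var_x ^ a * G) = var_y ^ b * B"
    using assms unfolding A by (simp add: mult_ac)
  moreover have "(var_y ^ b :: S) \<noteq> 0" by simp
  ultimately show ?thesis using A by auto
qed

section \<open>Sections over charts of the line\<close>

lemma hom_elem_smul:
  assumes "hom_elem M n v" "is_form a r"
  shows "hom_elem M (a + n) (smul r v)"
  unfolding hom_elem_def
proof (intro allI ballI)
  fix i m assume "m \<in> mons (coef (smul r v) i)"
  then have "m \<in> {a + b |a b. a \<in> mons r \<and> b \<in> mons (coef v i)}"
    using Poly_Mapping.keys_mult[of r "coef v i"] by (auto simp: lookup_smul)
  then obtain b c where "m = b + c" "b \<in> mons r" "c \<in> mons (coef v i)" by blast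
  then show "mdeg m + shift M i = a + n"
    using assms unfolding hom_elem_def is_form_def by (metis mdeg_add add.assoc)
qed

lemma hom_elem_add: "hom_elem M n v \<Longrightarrow> hom_elem M n w \<Longrightarrow> hom_elem M n (v + w)"
  unfolding hom_elem_def lookup_add by (meson Poly_Mapping.keys_add UnE subsetD)

lemma hom_elem_zero [simp]: "hom_elem M n 0"
  by (simp add: hom_elem_def)

lemma hom_elem_sum: "(\<And>i. i \<in> A \<Longrightarrow> hom_elem M n (v i)) \<Longrightarrow> hom_elem M n (\<Sum>i\<in>A. v i)"
  by (induction A rule: infinite_finite_induct) (auto intro: hom_elem_add)

lemma fracs_iff: "(v, n) \<in> fracs M d h \<longleftrightarrow> v \<in> num M \<and> hom_elem M (d + n * tdeg h) v"
  by (simp add: fracs_def)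

text \<open>The line is covered by the charts where \<open>x\<close> and \<open>y\<close> do not vanish; the third open set is their
intersection.\<close>

definition chart :: "S \<Rightarrow> bool" where
  "chart h \<longleftrightarrow> h = var_x \<or> h = var_y \<or> h = var_x * var_y"

lemma tdeg_simps [simp]: "tdeg (var_x :: S) = 1" "tdeg (var_y :: S) = 1" "tdeg (var_x * var_y :: S) = 2"
  using is_form_mult[OF is_form_vars(1,2), where 'c=complex]
  by (simp_all add: tdeg_form[OF is_form_vars(1)] tdeg_form[OF is_form_vars(2)] tdeg_form[of "Suc (Suc 0)"])

lemma chart_simps [simp]: "chart var_x" "chart var_y" "chart (var_x * var_y)"
  by (simp_all add: chart_def)

lemma chartD:
  assumes "chart h"
  shows "h \<noteq> 0" "is_form (tdeg h) h" "pos_form h"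
proof -
  show "h \<noteq> 0" using assms by (auto simp: chart_def)
  show "is_form (tdeg h) h"
    using assms is_form_mult[OF is_form_vars(1,2), where 'c=complex] by (auto simp: chart_def numeral_2_eq_2)
  then show "pos_form h"
    using \<open>h \<noteq> 0\<close> assms by (auto simp: pos_form_def nonzero_form_def chart_def)
qed

lemma is_form_chart_power: "chart h \<Longrightarrow> is_form (n * tdeg h) (h ^ n)"
  using is_form_power[OF chartD(2), of h n] by (simp add: mult.commute)

text \<open>A linear map \<open>C\<close> over the coordinate ring of the line whose kernel on \<open>num M\<close> is \<open>den M\<close>, up to
powers of the variables. Such a map identifies sections of the sheaf of \<open>M\<close> over the charts with
fractions of polynomials.\<close>

locale frac_model = line +
  fixes M :: "'i gmod" and C :: "('i \<Rightarrow>\<^sub>0 S) \<Rightarrow> S"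
  assumes C_add: "C (v + w) = C v + C w" and C_smul: "C (smul r v) = red r * C v"
    and num_zero: "0 \<in> num M" and num_add: "v \<in> num M \<Longrightarrow> w \<in> num M \<Longrightarrow> v + w \<in> num M"
    and num_smul: "v \<in> num M \<Longrightarrow> smul r v \<in> num M"
    and den_smul: "v \<in> den M \<Longrightarrow> smul r v \<in> den M" and den_zero: "v \<in> den M \<Longrightarrow> C v = 0"
    and den_power: "v \<in> num M \<Longrightarrow> C v = 0 \<Longrightarrow> u = var_x \<or> u = var_y \<Longrightarrow> \<exists>N. smul (u ^ N) v \<in> den M"
begin

lemma red_chart: "chart h \<Longrightarrow> red h = h"
  by (auto simp: chart_def red_simps)

lemma C_smul_chart: "chart h \<Longrightarrow> C (smul (h ^ n) v) = h ^ n * C v"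
  by (simp add: C_smul red_simps red_chart)

lemma C_diff: "C (v - w) = C v - C w"
  using C_add[of "v - w" w] by simp

lemma num_diff: "v \<in> num M \<Longrightarrow> w \<in> num M \<Longrightarrow> v - w \<in> num M"
proof -
  assume "v \<in> num M" "w \<in> num M"
  then have "v + smul (- 1) w \<in> num M" by (intro num_add num_smul)
  moreover have "smul (- 1) w = - w" by (rule poly_mapping_eqI) (simp add: lookup_smul)
  ultimately show ?thesis by simp
qed

lemma C_zero [simp]: "C 0 = 0"
  using C_add[of 0 0] by simp

lemma C_sum: "C (\<Sum>i\<in>A. v i) = (\<Sum>i\<in>A. C (v i))"
  by (induction A rule: infinite_finite_induct) (simp_all add: C_add)

lemma num_sum: "(\<And>i. i \<in> A \<Longrightarrow> v i \<in> num M) \<Longrightarrow> (\<Sum>i\<in>A. v i) \<in> num M"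
  by (induction A rule: infinite_finite_induct) (auto intro: num_zero num_add)

lemma den_power_chart:
  assumes "chart h" "v \<in> num M" "C v = 0"
  shows "\<exists>N. smul (h ^ N) v \<in> den M"
proof (cases "h = var_x * var_y")
  case True
  obtain N where "smul (var_x ^ N) v \<in> den M" using den_power[OF assms(2,3)] by blast
  then have "smul (var_y ^ N) (smul (var_x ^ N) v) \<in> den M" by (rule den_smul)
  then have "smul (h ^ N) v \<in> den M"
    by (simp add: True power_mult_distrib mult.commute)
  then show ?thesis by blast
next
  case False
  then show ?thesis using den_power[OF assms(2,3)] assms(1) by (auto simp: chart_def)
qed

text \<open>Cross multiplication. Powers of \<open>h\<close> can be cancelled because the values of \<open>C\<close> lie in an integral
domain.\<close>

lemma frac_rel_iff:
  assumes h: "chart h"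
  shows "((v, n), (v', n')) \<in> frac_rel M d h \<longleftrightarrow>
    (v, n) \<in> fracs M d h \<and> (v', n') \<in> fracs M d h \<and> h ^ n' * C v = h ^ n * C v'"
proof -
  let ?w = "smul (h ^ n') v - smul (h ^ n) v'"
  have Cw: "C ?w = h ^ n' * C v - h ^ n * C v'"
    using h by (simp add: C_diff C_smul_chart)
  have "(\<exists>N. smul (h ^ N) ?w \<in> den M) \<longleftrightarrow> C ?w = 0"
    if "(v, n) \<in> fracs M d h" "(v', n') \<in> fracs M d h"
  proof
    assume "\<exists>N. smul (h ^ N) ?w \<in> den M"
    then obtain N where "C (smul (h ^ N) ?w) = 0" using den_zero by blast
    then show "C ?w = 0"
      using chartD(1)[OF h] by (simp only: C_smul_chart[OF h]) simp
  next
    assume "C ?w = 0"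
    moreover have "?w \<in> num M" using that by (intro num_diff num_smul) (auto simp: fracs_iff)
    ultimately show "\<exists>N. smul (h ^ N) ?w \<in> den M" using den_power_chart[OF h] by blast
  qed
  then show ?thesis unfolding frac_rel_def by (auto simp: Cw)
qed

definition cls :: "S \<Rightarrow> ('i \<Rightarrow>\<^sub>0 S) \<times> nat \<Rightarrow> (('i \<Rightarrow>\<^sub>0 S) \<times> nat) set" where
  "cls h a = frac_rel M 0 h `` {a}"

lemma frac_rel_equiv:
  assumes "chart h"
  shows "equiv (fracs M 0 h) (frac_rel M 0 h)"
proof (rule equivI)
  show "frac_rel M 0 h \<subseteq> fracs M 0 h \<times> fracs M 0 h" by (auto simp: frac_rel_def)
  show "refl_on (fracs M 0 h) (frac_rel M 0 h)"
    by (auto simp: refl_on_def frac_rel_iff[OF assms])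
  show "sym (frac_rel M 0 h)"
    by (auto simp: sym_def frac_rel_iff[OF assms])
  show "trans (frac_rel M 0 h)"
  proof (rule transI)
    fix a b c assume "(a, b) \<in> frac_rel M 0 h" "(b, c) \<in> frac_rel M 0 h"
    moreover obtain v n w m x k where abc: "a = (v, n)" "b = (w, m)" "c = (x, k)" by (metis surj_pair)
    ultimately have *: "h ^ m * C v = h ^ n * C w" "h ^ k * C w = h ^ m * C x" "a \<in> fracs M 0 h" "c \<in> fracs M 0 h"
      by (auto simp: frac_rel_iff[OF assms])
    have "h ^ m * (h ^ k * C v) = h ^ k * (h ^ m * C v)" by (simp only: mult.left_commute)
    also have "\<dots> = h ^ n * (h ^ k * C w)" by (simp only: *(1) mult.left_commute)
    also have "\<dots> = h ^ m * (h ^ n * C x)" by (simp only: *(2) mult.left_commute)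
    finally have "h ^ k * C v = h ^ n * C x" using chartD(1)[OF assms] by simp
    then show "(a, c) \<in> frac_rel M 0 h" using * by (simp add: abc frac_rel_iff[OF assms])
  qed
qed

lemma cls_eq_iff: "chart h \<Longrightarrow> a \<in> fracs M 0 h \<Longrightarrow> b \<in> fracs M 0 h \<Longrightarrow> cls h a = cls h b \<longleftrightarrow> (a, b) \<in> frac_rel M 0 h"
  unfolding cls_def by (rule eq_equiv_class_iff[OF frac_rel_equiv])

lemma sections_iff: "X \<in> sections M 0 h \<longleftrightarrow> (\<exists>a\<in>fracs M 0 h. X = cls h a)"
  by (auto simp: sections_def quotient_def cls_def)

lemma self_in_cls: "chart h \<Longrightarrow> a \<in> fracs M 0 h \<Longrightarrow> a \<in> cls h a"
  unfolding cls_def by (rule equiv_class_self[OF frac_rel_equiv])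

lemma image_eq_cls:
  assumes "chart h" "a \<in> A" "\<And>b. b \<in> A \<Longrightarrow> (a, b) \<in> frac_rel M 0 h"
  shows "frac_rel M 0 h `` A = cls h a"
proof -
  have "frac_rel M 0 h `` {b} = frac_rel M 0 h `` {a}" if "b \<in> A" for b
    using equiv_class_eq[OF frac_rel_equiv[OF assms(1)] assms(3)[OF that]] by simp
  then show ?thesis using assms(2) unfolding cls_def by blast
qed

lemma fracs_add:
  assumes "chart h" "(v, n) \<in> fracs M 0 h" "(v', n') \<in> fracs M 0 h"
  shows "(smul (h ^ n') v + smul (h ^ n) v', n + n') \<in> fracs M 0 h"
proof -
  have "hom_elem M (n' * tdeg h + n * tdeg h) (smul (h ^ n') v)" "hom_elem M (n * tdeg h + n' * tdeg h) (smul (h ^ n) v')"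
    using assms by (auto intro!: hom_elem_smul is_form_chart_power simp: fracs_iff)
  then show ?thesis
    using assms by (auto simp: fracs_iff add_mult_distrib add.commute intro!: num_add num_smul hom_elem_add)
qed

lemma fracs_scale:
  assumes "(v, n) \<in> fracs M 0 h" "is_form (q * tdeg h) r"
  shows "(smul r v, q + n) \<in> fracs M 0 h"
  using assms hom_elem_smul[of M "n * tdeg h" v "q * tdeg h" r]
  by (simp add: fracs_iff num_smul add_mult_distrib)

lemma fracs_res:
  assumes "chart h" "chart g" "chart (h * g)" "(v, n) \<in> fracs M 0 h"
  shows "(smul (g ^ n) v, n) \<in> fracs M 0 (h * g)"
proof -
  have "tdeg (h * g) = tdeg h + tdeg g"
    using chartD[OF assms(1)] chartD[OF assms(2)] by (intro tdeg_form is_form_mult) auto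
  then show ?thesis
    using assms hom_elem_smul[of M "n * tdeg h" v "n * tdeg g" "g ^ n"] is_form_chart_power[OF assms(2)]
    by (simp add: fracs_iff num_smul add_mult_distrib2 add.commute)
qed

lemma sec_add_cls:
  assumes h: "chart h" and a: "(v, n) \<in> fracs M 0 h" and b: "(v', n') \<in> fracs M 0 h"
  shows "sec_add M 0 h (cls h (v, n)) (cls h (v', n')) = cls h (smul (h ^ n') v + smul (h ^ n) v', n + n')"
  unfolding sec_add_def
proof (rule image_eq_cls[OF h])
  show "(smul (h ^ n') v + smul (h ^ n) v', n + n') \<in>
      {(smul (h ^ m') w + smul (h ^ m) w', m + m') |w m w' m'. (w, m) \<in> cls h (v, n) \<and> (w', m') \<in> cls h (v', n')}"
    using self_in_cls[OF h a] self_in_cls[OF h b] by blast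
  fix c assume "c \<in> {(smul (h ^ m') w + smul (h ^ m) w', m + m') |w m w' m'. (w, m) \<in> cls h (v, n) \<and> (w', m') \<in> cls h (v', n')}"
  then obtain w m w' m' where c: "c = (smul (h ^ m') w + smul (h ^ m) w', m + m')"
    and w: "((v, n), (w, m)) \<in> frac_rel M 0 h" "((v', n'), (w', m')) \<in> frac_rel M 0 h"
    unfolding cls_def by blast
  from w have f: "(w, m) \<in> fracs M 0 h" "(w', m') \<in> fracs M 0 h"
    and e: "h ^ m * C v = h ^ n * C w" "h ^ m' * C v' = h ^ n' * C w'"
    by (simp_all add: frac_rel_iff[OF h])
  have "h ^ (m + m') * (h ^ n' * C v + h ^ n * C v') = h ^ m' * h ^ n' * (h ^ m * C v) + h ^ m * h ^ n * (h ^ m' * C v')"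
    by (simp add: power_add algebra_simps)
  also have "\<dots> = h ^ (n + n') * (h ^ m' * C w + h ^ m * C w')"
    unfolding e by (simp add: power_add algebra_simps)
  finally show "((smul (h ^ n') v + smul (h ^ n) v', n + n'), c) \<in> frac_rel M 0 h"
    unfolding c frac_rel_iff[OF h] using fracs_add[OF h a b] fracs_add[OF h f]
    by (simp add: C_add C_smul_chart[OF h])
qed

lemma sec_scale_cls:
  assumes h: "chart h" and a: "(v, n) \<in> fracs M 0 h" and r: "is_form (q * tdeg h) r"
  shows "sec_scale M 0 h r q (cls h (v, n)) = cls h (smul r v, q + n)"
  unfolding sec_scale_def
proof (rule image_eq_cls[OF h])
  show "(smul r v, q + n) \<in> {(smul r w, q + m) |w m. (w, m) \<in> cls h (v, n)}"
    using self_in_cls[OF h a] by blast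
  fix c assume "c \<in> {(smul r w, q + m) |w m. (w, m) \<in> cls h (v, n)}"
  then obtain w m where c: "c = (smul r w, q + m)" and w: "((v, n), (w, m)) \<in> frac_rel M 0 h"
    unfolding cls_def by blast
  from w have f: "(w, m) \<in> fracs M 0 h" and e: "h ^ m * C v = h ^ n * C w"
    by (simp_all add: frac_rel_iff[OF h])
  have "h ^ (q + m) * (red r * C v) = h ^ q * red r * (h ^ m * C v)" by (simp add: power_add mult_ac)
  also have "\<dots> = h ^ (q + n) * (red r * C w)" unfolding e by (simp add: power_add mult_ac)
  finally show "((smul r v, q + n), c) \<in> frac_rel M 0 h"
    unfolding c frac_rel_iff[OF h] using fracs_scale[OF a r] fracs_scale[OF f r]
    by (simp add: C_smul)
qed

lemma sec_res_cls:
  assumes h: "chart h" "chart g" "chart (h * g)" and a: "(v, n) \<in> fracs M 0 h"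
  shows "sec_res M 0 h g (cls h (v, n)) = cls (h * g) (smul (g ^ n) v, n)"
  unfolding sec_res_def
proof (rule image_eq_cls[OF h(3)])
  show "(smul (g ^ n) v, n) \<in> {(smul (g ^ m) w, m) |w m. (w, m) \<in> cls h (v, n)}"
    using self_in_cls[OF h(1) a] by blast
  fix c assume "c \<in> {(smul (g ^ m) w, m) |w m. (w, m) \<in> cls h (v, n)}"
  then obtain w m where c: "c = (smul (g ^ m) w, m)" and w: "((v, n), (w, m)) \<in> frac_rel M 0 h"
    unfolding cls_def by blast
  from w have f: "(w, m) \<in> fracs M 0 h" and e: "h ^ m * C v = h ^ n * C w"
    by (simp_all add: frac_rel_iff[OF h(1)])
  have "(h * g) ^ m * (g ^ n * C v) = g ^ m * g ^ n * (h ^ m * C v)"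
    by (simp add: power_mult_distrib mult_ac)
  also have "\<dots> = (h * g) ^ n * (g ^ m * C w)" unfolding e by (simp add: power_mult_distrib mult_ac)
  finally show "((smul (g ^ n) v, n), c) \<in> frac_rel M 0 (h * g)"
    unfolding c frac_rel_iff[OF h(3)] using fracs_res[OF h a] fracs_res[OF h f]
    by (simp add: C_smul_chart[OF h(2)])
qed

text \<open>The global sections, twisted by \<open>d\<close>, of the sheaf of \<open>M\<close> on the line: the polynomials that can be
represented on both charts. A common exponent \<open>e\<close> is no restriction, as numerators can be multiplied by
further powers.\<close>

definition global_forms :: "nat \<Rightarrow> S set" where
  "global_forms d = {F. \<exists>e. \<forall>u\<in>{var_x, var_y}. \<exists>v\<in>num M. hom_elem M (d + e) v \<and> C v = u ^ e * F}"

end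

section \<open>Global sections under isomorphism\<close>

text \<open>An isomorphism of sheaves over the charts, as a relation between representatives of sections. In
contrast to a family of bijections it is symmetric in the two modules, so every result transfers in both
directions.\<close>

locale frac_model_iso =
  M: frac_model \<alpha> \<beta> \<gamma> M C + N: frac_model \<alpha> \<beta> \<gamma> M' C'
  for \<alpha> \<beta> \<gamma> and M :: "'i gmod" and C and M' :: "'j gmod" and C' +
  fixes T :: "S \<Rightarrow> ('i \<Rightarrow>\<^sub>0 S) \<times> nat \<Rightarrow> ('j \<Rightarrow>\<^sub>0 S) \<times> nat \<Rightarrow> bool"
  assumes T_fracs: "T h a b \<Longrightarrow> a \<in> fracs M 0 h \<and> b \<in> fracs M' 0 h"
    and T_total: "chart h \<Longrightarrow> a \<in> fracs M 0 h \<Longrightarrow> \<exists>b. T h a b"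
    and T_surj: "chart h \<Longrightarrow> b \<in> fracs M' 0 h \<Longrightarrow> \<exists>a. T h a b"
    and T_rel: "chart h \<Longrightarrow> T h a b \<Longrightarrow> T h a' b' \<Longrightarrow> (a, a') \<in> frac_rel M 0 h \<longleftrightarrow> (b, b') \<in> frac_rel M' 0 h"
    and T_cong: "chart h \<Longrightarrow> T h a b \<Longrightarrow> (a, a') \<in> frac_rel M 0 h \<Longrightarrow> (b, b') \<in> frac_rel M' 0 h \<Longrightarrow> T h a' b'"
    and T_add: "chart h \<Longrightarrow> T h (v, n) (w, m) \<Longrightarrow> T h (v', n') (w', m') \<Longrightarrow>
      T h (smul (h ^ n') v + smul (h ^ n) v', n + n') (smul (h ^ m') w + smul (h ^ m) w', m + m')"
    and T_scale: "chart h \<Longrightarrow> T h (v, n) (w, m) \<Longrightarrow> is_form (q * tdeg h) r \<Longrightarrow>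
      T h (smul r v, q + n) (smul r w, q + m)"
    and T_res: "chart h \<Longrightarrow> chart g \<Longrightarrow> chart (h * g) \<Longrightarrow> T h (v, n) (w, m) \<Longrightarrow>
      T (h * g) (smul (g ^ n) v, n) (smul (g ^ m) w, m)"
begin

lemma swap: "frac_model_iso \<alpha> \<beta> \<gamma> M' C' M C (\<lambda>h b a. T h a b)"
proof
  show "b \<in> fracs M' 0 h \<and> a \<in> fracs M 0 h" if "T h a b" for h a b
    using T_fracs[OF that] by simp
  show "\<exists>a. T h a b" if "chart h" "b \<in> fracs M' 0 h" for h b
    using that by (rule T_surj)
  show "\<exists>b. T h a b" if "chart h" "a \<in> fracs M 0 h" for h a
    using that by (rule T_total)
  show "(b, b') \<in> frac_rel M' 0 h \<longleftrightarrow> (a, a') \<in> frac_rel M 0 h" if "chart h" "T h a b" "T h a' b'" for h a b a' b'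
    using T_rel[OF that] by simp
  show "T h a' b'" if "chart h" "T h a b" "(b, b') \<in> frac_rel M' 0 h" "(a, a') \<in> frac_rel M 0 h" for h a b a' b'
    by (rule T_cong[OF that(1,2,4,3)])
qed (rule T_add T_scale T_res; assumption)+

text \<open>Two related fractions can be given the same denominator.\<close>

lemma T_pad:
  assumes h: "chart h" and T: "T h (v, n) (w, m)" and N: "n \<le> N" "m \<le> N"
  shows "T h (smul (h ^ (N - n)) v, N) (smul (h ^ (N - m)) w, N)"
proof (rule T_cong[OF h T])
  have f: "(v, n) \<in> fracs M 0 h" "(w, m) \<in> fracs M' 0 h" using T_fracs[OF T] by auto
  show "((v, n), smul (h ^ (N - n)) v, N) \<in> frac_rel M 0 h"
    using f N M.fracs_scale[OF f(1) is_form_chart_power[OF h], of "N - n"]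
    by (simp add: M.frac_rel_iff[OF h] M.C_smul_chart[OF h] flip: mult.assoc power_add)
  show "((w, m), smul (h ^ (N - m)) w, N) \<in> frac_rel M' 0 h"
    using f N N.fracs_scale[OF f(2) is_form_chart_power[OF h], of "N - m"]
    by (simp add: N.frac_rel_iff[OF h] N.C_smul_chart[OF h] flip: mult.assoc power_add)
qed

text \<open>The isomorphism relates \<open>F / x ^ d\<close> to \<open>G / x ^ d\<close>. The twist by \<open>d\<close> is encoded in this denominator because
the isomorphism itself only concerns sections of degree \<open>0\<close>.\<close>

definition corr :: "nat \<Rightarrow> S \<Rightarrow> S \<Rightarrow> bool" where
  "corr d F G \<longleftrightarrow> (\<exists>n v w. d \<le> n \<and> T var_x (v, n) (w, n) \<and> C v = var_x ^ (n - d) * F \<and> C' w = var_x ^ (n - d) * G)"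

lemma corr_common_denominator:
  assumes "corr d F G"
  obtains n where "d \<le> n"
    "\<And>N. n \<le> N \<Longrightarrow> \<exists>v w. T var_x (v, N) (w, N) \<and> C v = var_x ^ (N - d) * F \<and> C' w = var_x ^ (N - d) * G"
proof -
  obtain n v w where *: "d \<le> n" "T var_x (v, n) (w, n)" "C v = var_x ^ (n - d) * F" "C' w = var_x ^ (n - d) * G"
    using assms unfolding corr_def by blast
  have "\<exists>v w. T var_x (v, N) (w, N) \<and> C v = var_x ^ (N - d) * F \<and> C' w = var_x ^ (N - d) * G" if "n \<le> N" for N
  proof (intro exI conjI)
    show "T var_x (smul (var_x ^ (N - n)) v, N) (smul (var_x ^ (N - n)) w, N)"
      using * that by (intro T_pad) auto
    show "C (smul (var_x ^ (N - n)) v) = var_x ^ (N - d) * F" "C' (smul (var_x ^ (N - n)) w) = var_x ^ (N - d) * G"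
      using * that by (simp_all add: M.C_smul_chart N.C_smul_chart flip: mult.assoc power_add)
  qed
  then show thesis using that *(1) by blast
qed

lemma corr_zero: "corr d 0 0"
proof -
  have "(0, d) \<in> fracs M 0 var_x" by (simp add: fracs_iff M.num_zero)
  then obtain w m where "T var_x (0, d) (w, m)" using T_total[of var_x] by (metis chart_simps(1) surj_pair)
  then have "T var_x (smul 0 0, 0 + d) (smul 0 w, 0 + m)" by (intro T_scale) auto
  then have "T var_x (smul (var_x ^ (max d m - d)) (smul 0 0), max d m) (smul (var_x ^ (max d m - m)) (smul 0 w), max d m)"
    by (intro T_pad) auto
  then show ?thesis
    unfolding corr_def by (intro exI conjI) (auto simp: M.C_smul N.C_smul M.red_simps)
qed

lemma corr_add:
  assumes "corr d F G" "corr d F' G'"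
  shows "corr d (F + F') (G + G')"
proof -
  obtain n where n: "d \<le> n" "\<And>N. n \<le> N \<Longrightarrow> \<exists>v w. T var_x (v, N) (w, N) \<and> C v = var_x ^ (N - d) * F \<and> C' w = var_x ^ (N - d) * G"
    using corr_common_denominator[OF assms(1)] by metis
  obtain n' where n': "d \<le> n'" "\<And>N. n' \<le> N \<Longrightarrow> \<exists>v w. T var_x (v, N) (w, N) \<and> C v = var_x ^ (N - d) * F' \<and> C' w = var_x ^ (N - d) * G'"
    using corr_common_denominator[OF assms(2)] by metis
  define N where "N = max n n'"
  obtain v w v' w' where *: "T var_x (v, N) (w, N)" "C v = var_x ^ (N - d) * F" "C' w = var_x ^ (N - d) * G"
    "T var_x (v', N) (w', N)" "C v' = var_x ^ (N - d) * F'" "C' w' = var_x ^ (N - d) * G'"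
    using n(2)[of N] n'(2)[of N] unfolding N_def by (metis max.cobounded1 max.cobounded2)
  have dN: "d \<le> N + N" using n(1) by (simp add: N_def)
  have "N + (N - d) = N + N - d" using n(1) by (simp add: N_def)
  then have p: "var_x ^ (N + N - d) = var_x ^ N * (var_x :: S) ^ (N - d)" by (simp flip: power_add)
  have "T var_x (smul (var_x ^ N) v + smul (var_x ^ N) v', N + N) (smul (var_x ^ N) w + smul (var_x ^ N) w', N + N)"
    by (intro T_add *) simp
  then show ?thesis
    unfolding corr_def using dN
    by (intro exI[of _ "N + N"] exI conjI)
      (auto simp: M.C_add N.C_add M.C_smul_chart N.C_smul_chart * p algebra_simps)
qed

lemma corr_scale:
  assumes "corr d F G"
  shows "corr d (c *s F) (c *s G)"
proof -
  obtain n v w where *: "d \<le> n" "T var_x (v, n) (w, n)" "C v = var_x ^ (n - d) * F" "C' w = var_x ^ (n - d) * G"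
    using assms unfolding corr_def by blast
  have "T var_x (smul (const c) v, 0 + n) (smul (const c) w, 0 + n)"
    using * by (intro T_scale) auto
  then show ?thesis
    unfolding corr_def using *
    by (intro exI[of _ n] exI conjI) (auto simp: M.C_smul N.C_smul smul_eq_const_mult[of c] mult.left_commute)
qed

lemma corr_inj:
  assumes "corr d F 0"
  shows "F = 0"
proof -
  obtain n v w where *: "d \<le> n" "T var_x (v, n) (w, n)" "C v = var_x ^ (n - d) * F" "C' w = 0"
    using assms unfolding corr_def by auto
  have "T var_x (smul 0 v, 0 + n) (smul 0 w, 0 + n)" using * by (intro T_scale) auto
  moreover have "smul 0 v = 0" "smul 0 w = 0" by (auto intro!: poly_mapping_eqI simp: lookup_smul)
  ultimately have T0: "T var_x (0, n) (0, n)" by simp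
  have "((w, n), (0, n)) \<in> frac_rel M' 0 var_x"
    using T_fracs[OF *(2)] T_fracs[OF T0] *(4) by (simp add: N.frac_rel_iff)
  then have "((v, n), (0, n)) \<in> frac_rel M 0 var_x" using T_rel[OF _ *(2) T0] by simp
  then show ?thesis by (simp add: M.frac_rel_iff *)
qed

text \<open>The images of \<open>F / x ^ d\<close> and \<open>F / y ^ d\<close> on the two charts differ by the factor \<open>(x / y) ^ d\<close> on
the intersection, as \<open>F / x ^ d\<close> and \<open>F / y ^ d\<close> do. Being polynomials up to powers of \<open>x\<close> and of \<open>y\<close>
respectively, they come from one polynomial \<open>G\<close>.\<close>

lemma corr_total:
  assumes "F \<in> M.global_forms d"
  shows "\<exists>G\<in>N.global_forms d. corr d F G"
proof -
  obtain e v v' where v: "v \<in> num M" "hom_elem M (d + e) v" "C v = var_x ^ e * F"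
    and v': "v' \<in> num M" "hom_elem M (d + e) v'" "C v' = var_y ^ e * F"
    using assms unfolding M.global_forms_def by auto
  have "(v, d + e) \<in> fracs M 0 var_x" "(v', d + e) \<in> fracs M 0 var_y"
    using v v' by (simp_all add: fracs_iff)
  then obtain w m w' m' where "T var_x (v, d + e) (w, m)" "T var_y (v', d + e) (w', m')"
    using T_total[of var_x] T_total[of var_y] by (metis chart_simps(1,2) surj_pair)
  moreover define N where "N = max (d + e) (max m m')"
  ultimately have
    T: "T var_x (smul (var_x ^ (N - (d + e))) v, N) (smul (var_x ^ (N - m)) w, N)"
      "T var_y (smul (var_y ^ (N - (d + e))) v', N) (smul (var_y ^ (N - m')) w', N)"
    by (auto intro!: T_pad)
  have "N - (d + e) + e = N - d" by (simp add: N_def)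
  then have "C (smul (var_x ^ (N - (d + e))) v) = var_x ^ (N - d) * F"
    "C (smul (var_y ^ (N - (d + e))) v') = var_y ^ (N - d) * F"
    using v v' by (simp_all add: M.C_smul_chart flip: mult.assoc power_add)
  with T obtain v1 w1 v2 w2 where T1: "T var_x (v1, N) (w1, N)" "C v1 = var_x ^ (N - d) * F"
    and T2: "T var_y (v2, N) (w2, N)" "C v2 = var_y ^ (N - d) * F"
    by blast
  have dN: "d \<le> N" by (simp add: N_def)
  let ?h = "var_x * var_y :: S"
  \<comment> \<open>Scaling the first section by \<open>x ^ (2 d) / (x y) ^ d\<close> and the second by \<open>(x y) ^ d / (x y) ^ d = 1\<close>
    makes them equal over \<open>M\<close>, and so over \<open>M'\<close>.\<close>
  have "T ?h (smul (var_y ^ N) v1, N) (smul (var_y ^ N) w1, N)"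
    by (intro T_res T1) auto
  then have R1: "T ?h (smul (var_x ^ (d + d)) (smul (var_y ^ N) v1), d + N) (smul (var_x ^ (d + d)) (smul (var_y ^ N) w1), d + N)"
    using is_form_power[OF is_form_vars(1), of "d + d", where 'c = complex]
    by (intro T_scale) (simp_all add: mult_2_right)
  have "T (var_y * var_x) (smul (var_x ^ N) v2, N) (smul (var_x ^ N) w2, N)"
    by (intro T_res T2) (simp_all add: chart_def mult.commute)
  then have "T ?h (smul (var_x ^ N) v2, N) (smul (var_x ^ N) w2, N)" by (simp only: mult.commute)
  then have R2: "T ?h (smul (?h ^ d) (smul (var_x ^ N) v2), d + N) (smul (?h ^ d) (smul (var_x ^ N) w2), d + N)"
    by (intro T_scale is_form_chart_power) simp_all
  have p: "(u :: S) ^ N = u ^ d * u ^ (N - d)" for u using dN by (simp flip: power_add)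
  have "((smul (var_x ^ (d + d)) (smul (var_y ^ N) v1), d + N), (smul (?h ^ d) (smul (var_x ^ N) v2), d + N))
      \<in> frac_rel M 0 ?h"
    using T_fracs[OF R1] T_fracs[OF R2] unfolding M.frac_rel_iff[OF chart_simps(3)]
    by (simp add: M.C_smul M.red_simps T1 T2 p power_add power_mult_distrib mult_ac)
  then have "((smul (var_x ^ (d + d)) (smul (var_y ^ N) w1), d + N), (smul (?h ^ d) (smul (var_x ^ N) w2), d + N))
      \<in> frac_rel M' 0 ?h"
    using T_rel[OF chart_simps(3) R1 R2] by simp
  then have "C' (smul (var_x ^ (d + d)) (smul (var_y ^ N) w1)) = C' (smul (?h ^ d) (smul (var_x ^ N) w2))"
    unfolding N.frac_rel_iff[OF chart_simps(3)] by simp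
  then have "(var_x ^ (d + d) * var_y ^ d) * (var_y ^ (N - d) * C' w1) = (var_x ^ (d + d) * var_y ^ d) * (var_x ^ (N - d) * C' w2)"
    by (simp add: N.C_smul M.red_simps p power_add power_mult_distrib mult_ac)
  then have "var_x ^ (N - d) * C' w2 = var_y ^ (N - d) * C' w1" by simp
  then obtain G where G: "C' w2 = var_y ^ (N - d) * G" "C' w1 = var_x ^ (N - d) * G"
    using coprime_var_powers by blast
  have "corr d F G" unfolding corr_def using dN T1 G by blast
  moreover have "G \<in> N.global_forms d"
    unfolding N.global_forms_def using T_fracs[OF T1(1)] T_fracs[OF T2(1)] G dN
    by (auto simp: fracs_iff intro!: exI[of _ "N - d"])
  ultimately show ?thesis by blast
qed

lemma dim_global_forms_le:
  assumes "finite A" "M.global_forms d \<subseteq> {F. mons F \<subseteq> A}" "finite B" "N.global_forms d \<subseteq> {F. mons F \<subseteq> B}"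
  shows "form_space.dim (M.global_forms d) \<le> form_space.dim (N.global_forms d)"
proof (rule dim_le_correspondence[where K = "corr d"])
  have sp: "{F. mons F \<subseteq> A} \<subseteq> form_space.span ((\<lambda>m. monomial m 1) ` A)" for A
    by (rule subsetI, rule mons_subset_span, simp)
  show "M.global_forms d \<subseteq> form_space.span ((\<lambda>m. monomial m 1) ` A)"
    by (rule subset_trans[OF assms(2) sp])
  show "N.global_forms d \<subseteq> form_space.span ((\<lambda>m. monomial m 1) ` B)"
    by (rule subset_trans[OF assms(4) sp])
  show "finite ((\<lambda>m. monomial m (1::complex)) ` A)" "finite ((\<lambda>m. monomial m (1::complex)) ` B)"
    using assms(1,3) by simp_all
qed (fact corr_total corr_zero | rule corr_add corr_scale corr_inj; assumption)+

end

lemma frac_model_iso_of_sheaf_iso: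
  assumes "frac_model \<alpha> \<beta> \<gamma> M C" "frac_model \<alpha> \<beta> \<gamma> N C'" "sheaf_iso M N"
  shows "\<exists>T. frac_model_iso \<alpha> \<beta> \<gamma> M C N C' T"
proof -
  interpret M: frac_model \<alpha> \<beta> \<gamma> M C by fact
  interpret N: frac_model \<alpha> \<beta> \<gamma> N C' by fact
  obtain \<phi> where \<phi>: "\<forall>h. pos_form h \<longrightarrow>
        bij_betw (\<phi> h) (sections M 0 h) (sections N 0 h) \<and>
        (\<forall>X\<in>sections M 0 h. \<forall>Y\<in>sections M 0 h.
           \<phi> h (sec_add M 0 h X Y) = sec_add N 0 h (\<phi> h X) (\<phi> h Y)) \<and>
        (\<forall>X\<in>sections M 0 h. \<forall>r q. is_form (q * tdeg h) r \<longrightarrow>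
           \<phi> h (sec_scale M 0 h r q X) = sec_scale N 0 h r q (\<phi> h X))"
     "\<forall>h g. pos_form h \<and> nonzero_form g \<longrightarrow>
        (\<forall>X\<in>sections M 0 h. \<phi> (h * g) (sec_res M 0 h g X) = sec_res N 0 h g (\<phi> h X))"
    using assms(3) unfolding sheaf_iso_def by (elim exE conjE)
  have bij: "bij_betw (\<phi> h) (sections M 0 h) (sections N 0 h)" if "pos_form h" for h
    using \<phi>(1) that by blast
  have add: "\<phi> h (sec_add M 0 h X Y) = sec_add N 0 h (\<phi> h X) (\<phi> h Y)"
    if "pos_form h" "X \<in> sections M 0 h" "Y \<in> sections M 0 h" for h X Y
    using \<phi>(1) that by blast
  have scale: "\<phi> h (sec_scale M 0 h r q X) = sec_scale N 0 h r q (\<phi> h X)"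
    if "pos_form h" "X \<in> sections M 0 h" "is_form (q * tdeg h) r" for h X r q
    using \<phi>(1) that by blast
  have res: "\<phi> (h * g) (sec_res M 0 h g X) = sec_res N 0 h g (\<phi> h X)"
    if "pos_form h" "nonzero_form g" "X \<in> sections M 0 h" for h g X
    using \<phi>(2) that by blast
  define T where "T h a b \<longleftrightarrow> a \<in> fracs M 0 h \<and> b \<in> fracs N 0 h \<and> \<phi> h (M.cls h a) = N.cls h b" for h a b
  have secM: "M.cls h a \<in> sections M 0 h" if "a \<in> fracs M 0 h" for h a
    using that by (auto simp: M.sections_iff)
  have "frac_model_iso \<alpha> \<beta> \<gamma> M C N C' T"
  proof
    fix h a assume h: "chart h" and a: "a \<in> fracs M 0 h"
    then have "\<phi> h (M.cls h a) \<in> sections N 0 h"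
      using bij[OF chartD(3)[OF h]] secM[OF a] by (auto simp: bij_betw_def)
    then show "\<exists>b. T h a b" using a by (auto simp: N.sections_iff T_def)
  next
    fix h b assume h: "chart h" and b: "b \<in> fracs N 0 h"
    then have "N.cls h b \<in> \<phi> h ` sections M 0 h"
      using bij[OF chartD(3)[OF h]] by (auto simp: bij_betw_def N.sections_iff)
    then obtain a where "a \<in> fracs M 0 h" "N.cls h b = \<phi> h (M.cls h a)"
      unfolding image_iff by (metis M.sections_iff)
    then show "\<exists>a. T h a b" using b unfolding T_def by metis
  next
    fix h a b a' b' assume h: "chart h" and T: "T h a b" "T h a' b'"
    have "M.cls h a = M.cls h a' \<longleftrightarrow> N.cls h b = N.cls h b'"
    proof -
      have inj: "inj_on (\<phi> h) (sections M 0 h)" using bij[OF chartD(3)[OF h]] by (simp add: bij_betw_def)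
      have a: "a \<in> fracs M 0 h" "a' \<in> fracs M 0 h" using T by (simp_all add: T_def)
      have "\<phi> h (M.cls h a) = \<phi> h (M.cls h a') \<longleftrightarrow> M.cls h a = M.cls h a'"
        by (rule inj_on_eq_iff[OF inj secM[OF a(1)] secM[OF a(2)]])
      then show ?thesis using T by (simp add: T_def)
    qed
    then show "(a, a') \<in> frac_rel M 0 h \<longleftrightarrow> (b, b') \<in> frac_rel N 0 h"
      using T M.cls_eq_iff[OF h] N.cls_eq_iff[OF h] unfolding T_def by blast
  next
    fix h a b a' b' assume h: "chart h" and T: "T h a b"
      and r: "(a, a') \<in> frac_rel M 0 h" "(b, b') \<in> frac_rel N 0 h"
    have f: "a' \<in> fracs M 0 h" "b' \<in> fracs N 0 h" using r by (auto simp: frac_rel_def)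
    then have "M.cls h a = M.cls h a'" "N.cls h b = N.cls h b'"
      using r T M.cls_eq_iff[OF h] N.cls_eq_iff[OF h] unfolding T_def by blast+
    then show "T h a' b'" using T f unfolding T_def by simp
  next
    fix h v n w m v' n' w' m' assume h: "chart h" and T: "T h (v, n) (w, m)" "T h (v', n') (w', m')"
    show "T h (smul (h ^ n') v + smul (h ^ n) v', n + n') (smul (h ^ m') w + smul (h ^ m) w', m + m')"
      using T add[OF chartD(3)[OF h] secM secM, of "(v, n)" "(v', n')"] unfolding T_def
      by (simp add: M.sec_add_cls[OF h] N.sec_add_cls[OF h] M.fracs_add[OF h] N.fracs_add[OF h])
  next
    fix h v n w m q r assume h: "chart h" and T: "T h (v, n) (w, m)" and r: "is_form (q * tdeg h) (r :: S)"
    show "T h (smul r v, q + n) (smul r w, q + m)"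
      using T r scale[OF chartD(3)[OF h] secM r, of "(v, n)"] unfolding T_def
      by (simp add: M.sec_scale_cls[OF h] N.sec_scale_cls[OF h] M.fracs_scale N.fracs_scale)
  next
    fix h g v n w m assume h: "chart h" "chart g" "chart (h * g)" and T: "T h (v, n) (w, m)"
    have "nonzero_form g" using chartD(3)[OF h(2)] by (simp add: pos_form_def)
    then show "T (h * g) (smul (g ^ n) v, n) (smul (g ^ m) w, m)"
      using T res[OF chartD(3)[OF h(1)] _ secM, of g "(v, n)"] unfolding T_def
      by (simp add: M.sec_res_cls[OF h] N.sec_res_cls[OF h] M.fracs_res[OF h] N.fracs_res[OF h])
  qed (simp add: T_def)
  then show ?thesis by blast
qed

declare dual_line.simps [simp del] peval.simps [simp del]

section \<open>Direct sums of twists on the line\<close>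

lemma coef_binary_zpow:
  assumes "zdeg_le 0 B"
  shows "coef (B * var_z ^ i) (p, q, l) = (if l = i then coef B (p, q, 0) else 0)"
proof -
  have z: "(var_z :: S) ^ i = monomial (0, 0, i) 1" by (simp add: monomial_const const_simps)
  have t: "coef (monomial m c * var_z ^ i) (p, q, l) = (if l = i then coef (monomial m c) (p, q, 0) else 0)"
    if "m \<in> mons B" for m and c :: complex
    using that assms unfolding z by (auto simp: zdeg_le_def mult_single lookup_single when_def)
  have "coef (\<Sum>m\<in>mons B. monomial m (coef B m) * var_z ^ i) (p, q, l)
      = (if l = i then coef (\<Sum>m\<in>mons B. monomial m (coef B m)) (p, q, 0) else 0)"
    by (simp add: lookup_sum t)
  then show ?thesis
    by (simp only: poly_mapping_sum_monomials[symmetric] flip: sum_distrib_right)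
qed

text \<open>Monomials whose exponent of \<open>z\<close> is the index \<open>i < n\<close> of a summand and whose part in \<open>x\<close> and \<open>y\<close>
has degree \<open>d - a i\<close>. With \<open>a = id\<close> these are the monomials of degree \<open>d\<close> and degree below \<open>n\<close> in \<open>z\<close>.\<close>

definition twist_mons :: "nat \<Rightarrow> (nat \<Rightarrow> nat) \<Rightarrow> nat \<Rightarrow> mon set" where
  "twist_mons n a d = {(p, q, i). i < n \<and> p + q + a i = d}"

lemma twist_mons_image:
  "twist_mons n a d = (\<lambda>(i, p). (p, d - a i - p, i)) ` (SIGMA i:{..<n}. {..<d + 1 - a i})"
proof (intro equalityI subsetI)
  fix m assume "m \<in> twist_mons n a d"
  then obtain p q i where "m = (p, q, i)" "i < n" "p + q + a i = d" by (auto simp: twist_mons_def)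
  then show "m \<in> (\<lambda>(i, p). (p, d - a i - p, i)) ` (SIGMA i:{..<n}. {..<d + 1 - a i})"
    by (intro image_eqI[of _ _ "(i, p)"]) auto
qed (auto simp: twist_mons_def)

lemma finite_twist_mons: "finite (twist_mons n a d)"
  by (simp add: twist_mons_image)

lemma card_twist_mons: "card (twist_mons n a d) = (\<Sum>i<n. d + 1 - a i)"
proof -
  have "inj_on (\<lambda>(i, p). (p, d - a i - p, i)) (SIGMA i:{..<n}. {..<d + 1 - a i})"
    by (auto intro!: inj_onI)
  then have "card (twist_mons n a d) = card (SIGMA i:{..<n}. {..<d + 1 - a i})"
    unfolding twist_mons_image by (rule card_image)
  then show ?thesis by simp
qed

context line
begin

text \<open>Encoding a tuple by powers of \<open>z\<close> makes the values of a direct sum polynomials, in parallel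
with \<open>flat\<close>; the dimension of its sections then becomes a number of monomials.\<close>

definition sum_poly :: "nat \<Rightarrow> (nat \<Rightarrow>\<^sub>0 S) \<Rightarrow> S" where
  "sum_poly n v = (\<Sum>i<n. red (coef v i) * var_z ^ i)"

lemma coef_sum_poly: "coef (sum_poly n v) (p, q, l) = (if l < n then coef (red (coef v l)) (p, q, 0) else 0)"
  by (simp add: sum_poly_def lookup_sum coef_binary_zpow[OF zdeg_le_red] sum.delta)

lemma sum_poly_eq_0: "sum_poly n v = 0 \<Longrightarrow> i < n \<Longrightarrow> lf dvd coef v i"
proof -
  assume v: "sum_poly n v = 0" "i < n"
  have "red (coef v i) = 0"
  proof (rule poly_mapping_eqI)
    fix m :: mon obtain p q l where m: "m = (p, q, l)" by (metis prod_cases3)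
    show "coef (red (coef v i)) m = coef 0 m"
    proof (cases "l = 0")
      case True
      then show ?thesis using coef_sum_poly[of n v p q i] v by (simp add: m)
    next
      case False
      then have "(p, q, l) \<notin> mons (red (coef v i))"
        using zdeg_le_red[of "coef v i"] unfolding zdeg_le_def by auto
      then show ?thesis by (simp add: m not_in_keys_iff_lookup_eq_zero)
    qed
  qed
  then show ?thesis by (simp add: red_eq_0_iff)
qed

lemma twisted_frac_model:
  "frac_model \<alpha> \<beta> \<gamma> (restrict_line lf (twisted_sum as)) (sum_poly (length as))" (is "frac_model _ _ _ ?N _")
proof
  let ?n = "length as"
  have num: "num ?N = {v. mons v \<subseteq> {..<?n}}"
    by (simp add: restrict_line_def twisted_sum_def)
  have den: "den ?N = {smul lf v |v. mons v \<subseteq> {..<?n}}"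
    by (simp add: restrict_line_def twisted_sum_def)
  have keys_smul: "mons (smul r v) \<subseteq> mons v" for r and v :: "nat \<Rightarrow>\<^sub>0 S"
    by (auto simp: in_keys_iff lookup_smul)
  show "sum_poly ?n (v + w) = sum_poly ?n v + sum_poly ?n w" for v w
    by (simp add: sum_poly_def lookup_add red_simps distrib_right sum.distrib)
  show "sum_poly ?n (smul r v) = red r * sum_poly ?n v" for r v
    by (simp add: sum_poly_def lookup_smul red_simps sum_distrib_left mult.assoc)
  show "0 \<in> num ?N"
    by (simp add: num)
  show "v + w \<in> num ?N"
    if "v \<in> num ?N" "w \<in> num ?N" for v w
    using that Poly_Mapping.keys_add[of v w] unfolding num by blast
  show "smul r v \<in> num ?N"
    if "v \<in> num ?N" for r v
    using that keys_smul[of r v] unfolding num by blast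
  show "smul r v \<in> den ?N"
    if v: "v \<in> den ?N" for r v
  proof -
    obtain w where w: "v = smul lf w" "mons w \<subseteq> {..<?n}" using v unfolding den by blast
    have "smul r v = smul lf (smul r w)"
      unfolding w(1) by (rule poly_mapping_eqI) (simp only: lookup_smul mult.left_commute)
    then show ?thesis unfolding den using w(2) keys_smul[of r w] by blast
  qed
  show "sum_poly ?n v = 0" if v: "v \<in> den ?N" for v
    using v unfolding den by (auto simp: sum_poly_def lookup_smul red_simps red_line)
  show "\<exists>N. smul (u ^ N) v \<in> den ?N"
    if v: "v \<in> num ?N" "sum_poly ?n v = 0" for u v
  proof -
    have "\<forall>i. \<exists>b. i < ?n \<longrightarrow> coef v i = lf * b" using sum_poly_eq_0[OF v(2)] by (auto elim: dvdE simp del: dual_line.simps)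
    then obtain b where b: "\<And>i. i < ?n \<Longrightarrow> coef v i = lf * b i" by metis
    define w where "w = (\<Sum>i<?n. monomial i (b i))"
    have cw: "coef w i = (if i < ?n then b i else 0)" for i
      by (simp add: w_def lookup_sum lookup_single when_def sum.delta)
    have "v = smul lf w"
    proof (rule poly_mapping_eqI)
      fix i show "coef v i = coef (smul lf w) i"
        using b[of i] v(1) unfolding lookup_smul cw num
        by (cases "i < ?n") (auto simp: in_keys_iff simp del: dual_line.simps)
    qed
    moreover have "mons w \<subseteq> {..<?n}" by (auto simp: in_keys_iff cw split: if_splits)
    ultimately have "smul (u ^ 0) v \<in> den ?N"
      unfolding den by (auto simp del: dual_line.simps)
    then show ?thesis by blast
  qed
qed

lemma twisted_global_forms:
  "frac_model.global_forms (restrict_line lf (twisted_sum as)) (sum_poly (length as)) d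
    = {F. mons F \<subseteq> twist_mons (length as) ((!) as) d}"
proof -
  let ?n = "length as" and ?N = "restrict_line lf (twisted_sum as)"
  interpret N: frac_model \<alpha> \<beta> \<gamma> ?N "sum_poly ?n" by (rule twisted_frac_model)
  have num: "num ?N = {v. mons v \<subseteq> {..<?n}}"
    by (simp add: restrict_line_def twisted_sum_def)
  have shift: "shift ?N = (\<lambda>i. if i < ?n then as ! i else 0)"
    by (simp add: restrict_line_def twisted_sum_def)
  show ?thesis
  proof (intro equalityI subsetI CollectI)
    fix F m assume F: "F \<in> N.global_forms d" and m: "m \<in> mons F"
    obtain e v where v: "hom_elem ?N (d + e) v" "sum_poly ?n v = var_x ^ e * F"
      using F unfolding N.global_forms_def by auto
    obtain p q l where pql: "m = (p, q, l)" by (metis prod_cases3)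
    have "coef (sum_poly ?n v) (e + p, q, l) \<noteq> 0"
      using m coef_monomial_mult[of "(e, 0, 0)" F "(p, q, l)"]
      by (simp add: v(2) var_power_monomial pql in_keys_iff)
    then have l: "l < ?n" and c: "coef (red (coef v l)) (e + p, q, 0) \<noteq> 0"
      unfolding coef_sum_poly by (auto split: if_splits)
    then have ne: "coef v l \<noteq> 0" by (auto simp: red_simps)
    then obtain m' where m': "m' \<in> mons (coef v l)" by (metis all_not_in_conv keys_eq_empty_iff)
    have sh: "mdeg m' + as ! l = d + e" if "m' \<in> mons (coef v l)" for m'
    proof -
      have "mdeg m' + (if l < ?n then as ! l else 0) = d + e"
        using v(1) that unfolding hom_elem_def shift by blast
      then show ?thesis using l by simp
    qed
    have "is_form (d + e - as ! l) (coef v l)"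
      unfolding is_form_def using sh by fastforce
    then have "is_form (d + e - as ! l) (red (coef v l))" by (rule is_form_red)
    then have "e + p + q = d + e - as ! l" using is_formD[OF _ c] by simp
    then show "m \<in> twist_mons ?n ((!) as) d"
      using sh[OF m'] l by (simp add: twist_mons_def pql)
  next
    fix F :: S assume "F \<in> {F. mons F \<subseteq> twist_mons ?n ((!) as) d}"
    then have F: "(p, q, i) \<in> mons F \<Longrightarrow> i < ?n \<and> p + q + as ! i = d" for p q i
      by (auto simp: twist_mons_def)
    define piece :: "mon \<Rightarrow> nat \<Rightarrow>\<^sub>0 S" where
      "piece = (\<lambda>(p, q, i). monomial i (monomial (p, q, 0) (coef F (p, q, i))))"
    define v where "v = (\<Sum>m\<in>mons F. piece m)"
    have "sum_poly ?n (piece m) = monomial m (coef F m)" if m: "m \<in> mons F" for m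
    proof -
      obtain p q i where pqi: "m = (p, q, i)" by (metis prod_cases3)
      have "i < ?n" using F[of p q i] m pqi by simp
      have "sum_poly ?n (piece m) = (\<Sum>j<?n. if j = i then red (monomial (p, q, 0) (coef F m)) * var_z ^ i else 0)"
        unfolding sum_poly_def piece_def pqi
        by (intro sum.cong) (auto simp: lookup_single when_def red_simps)
      also have "\<dots> = monomial (p, q, 0) (coef F m) * var_z ^ i"
        using \<open>i < ?n\<close> red_binary[OF zdeg_le_monomial, of 0 p q] by (simp add: sum.delta)
      finally show ?thesis by (simp add: pqi monomial_const mult.assoc)
    qed
    moreover have "sum_poly ?n v = (\<Sum>m\<in>mons F. sum_poly ?n (piece m))"
      unfolding v_def by (rule N.C_sum)
    ultimately have "sum_poly ?n v = F" by (simp flip: poly_mapping_sum_monomials)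
    moreover have "v \<in> num ?N \<and> hom_elem ?N d v"
    proof -
      have "piece m \<in> num ?N \<and> hom_elem ?N d (piece m)" if "m \<in> mons F" for m
        using F that by (cases m) (auto simp: num hom_elem_def shift piece_def lookup_single when_def split: if_splits)
      then show ?thesis unfolding v_def by (intro conjI N.num_sum hom_elem_sum) auto
    qed
    ultimately show "F \<in> N.global_forms d"
      unfolding N.global_forms_def by (auto intro!: exI[of _ 0])
  qed
qed

end

section \<open>The dimension of the space of curves\<close>

lemma form_eq_mons: "is_form n (F :: S) \<longleftrightarrow> mons F \<subseteq> twist_mons (n + 1) id n"
  by (fastforce simp: is_form_def twist_mons_def)

lemma forms_span: "{F. is_form n F} \<subseteq> form_space.span ((\<lambda>m. monomial m 1) ` twist_mons (n + 1) id n)"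
  unfolding form_eq_mons by (rule subsetI, rule mons_subset_span, simp)

context generic_line
begin

text \<open>Each line contributes its own equation times the complementary factor, so the sum is \<open>|Z| f\<close>.\<close>

lemma euler_formula: "f dvd grad euler"
proof -
  have "grad euler = var_x * pd_x f + var_y * pd_y f + var_z * pd_z f"
    by (simp add: euler_def grad_simps) (simp add: grad_def subst_vars rhom_id)
  also have "\<dots> = (\<Sum>p\<in>Z. (const (fst p) * var_x + const (fst (snd p)) * var_y + const (snd (snd p)) * var_z) * others p)"
    unfolding pd_arr_poly sum_distrib_left distrib_right sum.distrib by (simp only: mult_ac)
  also have "\<dots> = (\<Sum>p\<in>Z. f)"
    by (rule sum.cong) (auto simp: arr_poly_split[symmetric] dual_line.simps[symmetric])
  finally show ?thesis by simp
qed

text \<open>The equation of \<open>L\<close> is prime, because reduction maps to an integral domain, and \<open>f\<close> does not vanish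
on \<open>L\<close>.\<close>

lemma line_coprime:
  assumes "f dvd lf * W"
  shows "f dvd W"
proof -
  obtain A where A: "lf * W = f * A" using assms by blast
  have "red f * red A = red (lf * W)" unfolding A by (simp add: red_simps)
  then have "red f * red A = 0" by (simp add: red_simps red_line)
  then have "red A = 0" using red_arr_poly_nonzero by simp
  then obtain A' where "A = lf * A'" unfolding red_eq_0_iff by blast
  then have "lf * W = lf * (f * A')" using A by (simp add: mult_ac)
  moreover have "lf \<noteq> 0"
  proof
    assume "lf = 0"
    then have "peval lf (0, 0, 1) = peval 0 (0, 0, 1)" by simp
    then show False using gamma by (simp add: peval_dual_line peval_simps)
  qed
  ultimately show ?thesis by simp
qed

lemma euler_span_syz: "v \<in> euler_span k \<Longrightarrow> v \<in> syz k Z"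
  using euler_span_multiple[of v k] euler_formula by (auto simp: syz_iff grad_simps elim!: dvdE)

lemma syz_smul: "v \<in> syz k Z \<Longrightarrow> smul r v \<in> syz k Z"
  by (simp add: syz_iff Der_def smul_const grad_simps is_form_const_mult)

lemma syz_add: "v \<in> syz k Z \<Longrightarrow> w \<in> syz k Z \<Longrightarrow> v + w \<in> syz k Z"
  by (simp add: syz_iff Der_def grad_simps is_form_add)

lemma syz_diff: "v \<in> syz k Z \<Longrightarrow> w \<in> syz k Z \<Longrightarrow> v - w \<in> syz k Z"
  by (simp add: syz_iff Der_def grad_simps is_form_diff)

abbreviation (input) "syz_line \<equiv> restrict_line lf (syz0_mod k Z)"

lemma num_syz_line: "num syz_line = syz k Z"
  by (simp add: restrict_line_def syz0_mod_def)

lemma den_syz_line: "den syz_line = {u + smul lf v |u v. u \<in> euler_span k \<and> v \<in> syz k Z}"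
  by (simp add: restrict_line_def syz0_mod_def)

lemma hom_syz_line: "hom_elem syz_line n v \<longleftrightarrow> coef_form n v"
  unfolding hom_elem_def coef_form_def is_form_def by (simp add: restrict_line_def syz0_mod_def)

lemma den_syz_line_flat: "v \<in> den syz_line \<Longrightarrow> flat v = 0"
proof -
  assume "v \<in> den syz_line"
  then obtain u w where uw: "v = u + smul lf w" "u \<in> euler_span k"
    unfolding den_syz_line by blast
  obtain q where "u = euler * q" using euler_span_multiple[OF uw(2)] by blast
  then show ?thesis by (simp add: uw(1) flat_simps flat_smul red_line flat_euler)
qed

lemma den_syz_line_smul: "v \<in> den syz_line \<Longrightarrow> smul r v \<in> den syz_line"
proof -
  assume "v \<in> den syz_line"
  then obtain u w where uw: "v = u + smul lf w" "u \<in> euler_span k" "w \<in> syz k Z"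
    unfolding den_syz_line by blast
  have "smul r v = smul r u + smul lf (smul r w)"
    unfolding uw(1) smul_const by (simp only: distrib_left mult.left_commute)
  moreover have "smul r u \<in> euler_span k"
    using uw(2) unfolding euler_span_def by (rule free_mod.span_scale)
  ultimately show ?thesis using syz_smul[OF uw(3)] unfolding den_syz_line by blast
qed

lemma den_syz_line_add: "v \<in> den syz_line \<Longrightarrow> w \<in> den syz_line \<Longrightarrow> v + w \<in> den syz_line"
proof -
  assume "v \<in> den syz_line" "w \<in> den syz_line"
  then obtain u v' u' w' where *: "v = u + smul lf v'" "u \<in> euler_span k" "v' \<in> syz k Z"
     "w = u' + smul lf w'" "u' \<in> euler_span k" "w' \<in> syz k Z"
    unfolding den_syz_line by blast
  have "v + w = (u + u') + smul lf (v' + w')"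
    unfolding *(1,4) smul_const by (simp only: distrib_left add_ac)
  moreover have "u + u' \<in> euler_span k"
    using *(2,5) unfolding euler_span_def by (rule free_mod.span_add)
  ultimately show ?thesis using syz_add[OF *(3,6)] unfolding den_syz_line by blast
qed

lemma zero_in_den: "0 \<in> den syz_line"
  unfolding den_syz_line
proof (intro CollectI exI conjI)
  show "0 \<in> euler_span k" unfolding euler_span_def by (rule free_mod.span_zero)
  then show "0 \<in> syz k Z" by (rule euler_span_syz)
qed (simp add: smul_const)

lemma line_in_den: "v \<in> syz k Z \<Longrightarrow> smul (lf * b) v \<in> den syz_line"
proof -
  assume v: "v \<in> syz k Z"
  have "0 + smul lf (smul b v) \<in> den syz_line"
    unfolding den_syz_line using syz_smul[OF v] free_mod.span_zero
    unfolding euler_span_def by blast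
  then show ?thesis by simp
qed

text \<open>The multiple of the equation of the line produced by \<open>flat_kernel_var\<close> is itself a syzygy, and then so is
the cofactor, by coprimality.\<close>

lemma syz_line_kernel:
  assumes "v \<in> syz k Z" "flat v = 0" "u = var_x \<or> u = var_y"
  shows "smul (u ^ k) v \<in> den syz_line"
proof -
  have v: "is_form k v" using assms(1) by (simp add: syz_iff Der_def)
  obtain e w where ew: "e \<in> euler_span k" "w \<in> Der k" "smul (u ^ k) v = e + smul lf w"
    using flat_kernel_var[OF assms(3) v assms(2) k_pos] by blast
  have "smul lf w = smul (u ^ k) v - e" using ew(3) by simp
  then have "smul lf w \<in> syz k Z"
    using syz_diff[OF syz_smul[OF assms(1)] euler_span_syz[OF ew(1)]] by simp
  then have "f dvd lf * grad w" by (simp add: syz_iff smul_const grad_simps)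
  then have "f dvd grad w" by (rule line_coprime)
  then have "w \<in> syz k Z" using ew(2) by (simp add: syz_iff)
  then show ?thesis unfolding den_syz_line ew(3) using ew(1) by blast
qed

lemma syz_frac_model: "frac_model \<alpha> \<beta> \<gamma> syz_line flat"
proof
  show "\<exists>N. smul (u ^ N) v \<in> den syz_line"
    if "v \<in> num syz_line" "flat v = 0" "u = var_x \<or> u = var_y" for u v
    using syz_line_kernel that unfolding num_syz_line by blast
  show "flat (v + w) = flat v + flat w" for v w by (rule flat_simps(3))
  show "flat (smul r v) = red r * flat v" for r v by (rule flat_smul)
  show "0 \<in> num syz_line" unfolding num_syz_line
    by (simp add: syz_iff Der_def grad_simps)
  show "v + w \<in> num syz_line" if "v \<in> num syz_line" "w \<in> num syz_line" for v w
    using that unfolding num_syz_line by (rule syz_add)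
  show "smul r v \<in> num syz_line" if "v \<in> num syz_line" for r v
    using that unfolding num_syz_line by (rule syz_smul)
qed (rule den_syz_line_smul den_syz_line_flat; assumption)+

lemma syz_global_forms:
  assumes Z0: "0 \<notin> Z"
  shows "frac_model.global_forms syz_line flat d = curves d"
proof -
  interpret M: frac_model \<alpha> \<beta> \<gamma> syz_line flat by (rule syz_frac_model)
  show ?thesis
  proof (intro equalityI subsetI)
    fix F assume "F \<in> M.global_forms d"
    then obtain e v v' where v: "v \<in> syz k Z" "coef_form (d + e) v" "flat v = var_x ^ e * F"
      and v': "v' \<in> syz k Z" "coef_form (d + e) v'" "flat v' = var_y ^ e * F"
      unfolding M.global_forms_def num_syz_line hom_syz_line by auto
    have c: "var_x ^ e * F \<in> curves (d + e)" "var_y ^ e * F \<in> curves (d + e)"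
      using syz_curve[OF v(1,2)] syz_curve[OF v'(1,2)] v(3) v'(3) by simp_all
    have "is_form (e + (d + k)) (var_x ^ e * F)" "zdeg_le k (var_x ^ e * F)"
      using c(1) by (simp_all add: curves_def add_ac)
    then have "is_form (d + k) F" "zdeg_le k F"
      using is_form_times_var zdeg_le_times_var by blast+
    moreover have "peval F (flat_pt p) = 0" if p: "p \<in> Z" for p
    proof -
      obtain a b c where abc: "p = (a, b, c)" by (metis prod_cases3)
      have "peval (var_x ^ e * F) (flat_pt p) = 0" "peval (var_y ^ e * F) (flat_pt p) = 0"
        using c p by (simp_all add: curves_def)
      then show ?thesis
        using foot_nonzero[OF p, of "\<gamma> * b - \<beta> * c" "\<alpha> * c - \<gamma> * a" "\<beta> * a - \<alpha> * b"]
        by (auto simp: abc peval_simps)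
    qed
    ultimately show "F \<in> curves d" by (simp add: curves_def)
  next
    fix F assume F: "F \<in> curves d"
    obtain e v where v: "v \<in> syz k Z" "coef_form (d + e) v" "flat v = var_x ^ e * F"
      using lift_curve[OF Z0 F] by blast
    obtain e' v' where v': "v' \<in> syz k Z" "coef_form (d + e') v'" "flat v' = var_y ^ e' * F"
      using lift_curve[OF Z0 F] by blast
    have pad: "coef_form (d + (e + e')) (smul (u ^ i) w)"
      if "coef_form (d + j) w" "u = var_x \<or> u = var_y" "i + j = e + e'" for u i j w
    proof -
      have "is_form (Suc 0 * i) (u ^ i)" using that(2) by (intro is_form_power) auto
      from hom_elem_smul[of syz_line "d + j" w _ "u ^ i", OF _ this] that show ?thesis
        by (simp add: hom_syz_line add_ac flip: that(3))
    qed
    have "smul (var_x ^ e') v \<in> syz k Z \<and> coef_form (d + (e + e')) (smul (var_x ^ e') v)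
        \<and> flat (smul (var_x ^ e') v) = var_x ^ (e + e') * F"
      using v by (auto intro!: pad[of e] syz_smul simp: flat_smul red_simps power_add mult_ac)
    moreover have "smul (var_y ^ e) v' \<in> syz k Z \<and> coef_form (d + (e + e')) (smul (var_y ^ e) v')
        \<and> flat (smul (var_y ^ e) v') = var_y ^ (e + e') * F"
      using v' by (auto intro!: pad[of e'] syz_smul simp: flat_smul red_simps power_add mult_ac)
    ultimately show "F \<in> M.global_forms d"
      unfolding M.global_forms_def num_syz_line hom_syz_line by blast
  qed
qed

lemma curves_eq:
  "curves d = {F \<in> {F. mons F \<subseteq> twist_mons (k + 1) id (d + k)}. \<forall>p\<in>Z. peval F (flat_pt p) = 0}"
  unfolding curves_def is_form_def zdeg_le_def twist_mons_def by fastforce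

lemma dim_curves_ge: "(\<Sum>i<k + 1. d + k + 1 - i) \<le> form_space.dim (curves d) + card Z"
proof -
  let ?A = "twist_mons (k + 1) id (d + k)"
  have "form_space.dim {F. mons F \<subseteq> ?A} \<le> form_space.dim (curves d) + card Z"
    unfolding curves_eq
  proof (rule dim_kernels[OF fin subspace_mons])
    show "{F. mons F \<subseteq> ?A} \<subseteq> form_space.span ((\<lambda>m. monomial m 1) ` ?A)"
      by (rule subsetI, rule mons_subset_span, simp)
  qed (simp_all add: finite_twist_mons functional_peval)
  moreover have "form_space.dim {F. mons F \<subseteq> ?A} = (\<Sum>i<k + 1. d + k + 1 - i)"
    unfolding dim_mons[OF finite_twist_mons] card_twist_mons by simp
  ultimately show ?thesis by simp
qed

text \<open>The two inequalities come from the correspondence given by the isomorphism and from its converse.\<close>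

theorem dim_curves:
  assumes "0 \<notin> Z" "splitting_type k Z (\<alpha>, \<beta>, \<gamma>) as"
  shows "form_space.dim (curves d) = (\<Sum>i<k + 1. d + 1 - as ! i)"
proof -
  let ?N = "restrict_line lf (twisted_sum as)"
  have as: "length as = k + 1" and iso: "sheaf_iso syz_line ?N"
    using assms(2) by (auto simp: splitting_type_def)
  interpret M: frac_model \<alpha> \<beta> \<gamma> syz_line flat by (rule syz_frac_model)
  interpret N: frac_model \<alpha> \<beta> \<gamma> ?N "sum_poly (length as)" by (rule twisted_frac_model)
  obtain T where "frac_model_iso \<alpha> \<beta> \<gamma> syz_line flat ?N (sum_poly (length as)) T"
    using frac_model_iso_of_sheaf_iso[OF syz_frac_model twisted_frac_model iso] by blast
  then interpret MN: frac_model_iso \<alpha> \<beta> \<gamma> syz_line flat ?N "sum_poly (length as)" T .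
  interpret NM: frac_model_iso \<alpha> \<beta> \<gamma> ?N "sum_poly (length as)" syz_line flat "\<lambda>h b a. T h a b"
    by (rule MN.swap)
  have M: "M.global_forms d = curves d" by (rule syz_global_forms[OF assms(1)])
  have N: "N.global_forms d = {F. mons F \<subseteq> twist_mons (length as) ((!) as) d}"
    by (rule twisted_global_forms)
  have "M.global_forms d \<subseteq> {F. mons F \<subseteq> twist_mons (k + 1) id (d + k)}"
    unfolding M curves_eq by blast
  then have "form_space.dim (M.global_forms d) = form_space.dim (N.global_forms d)"
    using MN.dim_global_forms_le[OF finite_twist_mons _ finite_twist_mons, of d]
      NM.dim_global_forms_le[OF finite_twist_mons _ finite_twist_mons, of d]
    unfolding N by (intro antisym) blast+
  then show ?thesis unfolding M N by (simp add: dim_mons finite_twist_mons card_twist_mons as)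
qed

text \<open>In degree \<open>D = \<Sum>\<^sub>i a\<^sub>i\<close>, no summand of the dimension formula is truncated, so that comparison
with the number of linear conditions involves \<open>\<Sum>\<^sub>i a\<^sub>i\<close> itself.\<close>

corollary sum_splitting_type:
  assumes "0 \<notin> Z" "splitting_type k Z (\<alpha>, \<beta>, \<gamma>) as"
  shows "(\<Sum>i<k + 1. as ! i) + (\<Sum>i<k + 1. k - i) \<le> card Z"
proof -
  define D where "D = (\<Sum>i<k + 1. as ! i)"
  have le: "as ! i \<le> D" if "i < k + 1" for i
    unfolding D_def using that by (intro member_le_sum) auto
  have "(\<Sum>i<k + 1. D + k + 1 - i) \<le> (\<Sum>i<k + 1. D + 1 - as ! i) + card Z"
    using dim_curves_ge[of D] dim_curves[OF assms, of D] by simp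
  moreover have "(\<Sum>i<k + 1. D + 1 - as ! i) + (\<Sum>i<k + 1. as ! i) = (\<Sum>i<k + 1. D + 1)"
    unfolding sum.distrib[symmetric] using le by (intro sum.cong) (auto simp: le_SucI)
  moreover have "(\<Sum>i<k + 1. D + k + 1 - i) = (\<Sum>i<k + 1. D + 1) + (\<Sum>i<k + 1. k - i)"
    unfolding sum.distrib[symmetric] by (intro sum.cong) auto
  ultimately show ?thesis by simp
qed

abbreviation (input) s_form :: S where "s_form \<equiv> const \<gamma> * var_y - const \<beta> * var_z"
abbreviation (input) t_form :: S where "t_form \<equiv> const \<alpha> * var_z - const \<gamma> * var_x"

section \<open>Multiplicity at the point dual to the line\<close>

text \<open>Membership in the \<open>d\<close>-th power of the ideal of \<open>P\<close>. In this form it is clear that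
a derivative lowers the order of vanishing by at most one.\<close>

fun fat :: "nat \<Rightarrow> S \<Rightarrow> bool" where
  "fat 0 F = True"
| "fat (Suc d) F = (\<exists>A B. fat d A \<and> fat d B \<and> F = s_form * A + t_form * B)"

lemma fat_SucI: "fat d A \<Longrightarrow> fat d B \<Longrightarrow> fat (Suc d) (s_form * A + t_form * B)"
  unfolding fat.simps(2) by blast

lemma fat_zero: "fat d 0"
proof (induction d)
  case (Suc d)
  from fat_SucI[OF this this] show ?case by simp
qed simp

lemma fat_mult: "fat d F \<Longrightarrow> fat d (F * G)"
proof (induction d arbitrary: F)
  case (Suc d)
  then obtain A B where "fat d A" "fat d B" "F = s_form * A + t_form * B" by auto
  then have "fat (Suc d) (s_form * (A * G) + t_form * (B * G))" by (intro fat_SucI Suc.IH)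
  moreover have "F * G = s_form * (A * G) + t_form * (B * G)"
    unfolding \<open>F = _\<close> by (simp only: distrib_right mult.assoc)
  ultimately show ?case by simp
qed simp

lemma fat_add: "fat d F \<Longrightarrow> fat d G \<Longrightarrow> fat d (F + G)"
proof (induction d arbitrary: F G)
  case (Suc d)
  then obtain A B A' B' where *: "fat d A" "fat d B" "F = s_form * A + t_form * B"
    "fat d A'" "fat d B'" "G = s_form * A' + t_form * B'" by auto
  have "F + G = s_form * (A + A') + t_form * (B + B')"
    unfolding *(3,6) by (simp only: distrib_left add_ac)
  then show ?case using Suc.IH * by auto
qed simp

lemma fat_Suc: "fat (Suc d) F \<Longrightarrow> fat d F"
proof (induction d arbitrary: F)
  case (Suc d)
  then obtain A B where "fat (Suc d) A" "fat (Suc d) B" "F = s_form * A + t_form * B"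
    unfolding fat.simps(2)[of "Suc d" F] by blast
  then show ?case using Suc.IH unfolding fat.simps(2)[of d F] by blast
qed simp

lemma fat_antimono: "d \<le> e \<Longrightarrow> fat e F \<Longrightarrow> fat d F"
  by (induction e rule: dec_induct) (auto dest: fat_Suc simp del: fat.simps)

lemma fat_derivation:
  assumes "derivation D" "fat d F"
  shows "fat (d - 1) (D F)"
  using assms(2)
proof (induction d arbitrary: F)
  case (Suc d)
  interpret derivation D by fact
  obtain A B where AB: "fat d A" "fat d B" "F = s_form * A + t_form * B" using Suc.prems by auto
  have "fat d (s_form * D A + t_form * D B)"
  proof (cases d)
    case (Suc d')
    then have "fat d' (D A)" "fat d' (D B)" using Suc.IH AB by auto
    then show ?thesis unfolding Suc fat.simps(2) by blast
  qed simp
  moreover have "fat d (D s_form * A)" "fat d (D t_form * B)"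
    using fat_mult[OF AB(1), of "D s_form"] fat_mult[OF AB(2), of "D t_form"] by (simp_all only: mult.commute)
  ultimately have "fat d (D s_form * A + D t_form * B + (s_form * D A + t_form * D B))"
    using fat_add by blast
  moreover have "D F = D s_form * A + D t_form * B + (s_form * D A + t_form * D B)"
    unfolding AB(3) add mult[of s_form A] mult[of t_form B] by (simp only: add_ac)
  ultimately show ?case by simp
qed simp

lemma fat_funpow: "derivation D \<Longrightarrow> fat d F \<Longrightarrow> fat (d - n) ((D ^^ n) F)"
proof (induction n)
  case (Suc n)
  then have "fat (d - n - 1) (D ((D ^^ n) F))" by (intro fat_derivation) auto
  then show ?case by simp
qed simp

lemma peval_fat:
  assumes "fat (Suc d) F"
  shows "peval F (pscale c (\<alpha>, \<beta>, \<gamma>)) = 0"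
proof -
  have "peval s_form (pscale c (\<alpha>, \<beta>, \<gamma>)) = 0" "peval t_form (pscale c (\<alpha>, \<beta>, \<gamma>)) = 0"
    by (simp_all add: peval_simps)
  then show ?thesis using assms by (auto simp: peval_simps(3,4))
qed

lemma fat_power: "fat (p + q) (s_form ^ p * t_form ^ q * G)"
proof (induction p)
  case 0
  show ?case
  proof (induction q)
    case (Suc q)
    then have "fat (Suc q) (s_form * 0 + t_form * (t_form ^ q * G))"
      by (intro fat_SucI fat_zero) simp
    then show ?case by (simp add: mult.assoc del: fat.simps)
  qed simp
next
  case (Suc p)
  then have "fat (Suc (p + q)) (s_form * (s_form ^ p * t_form ^ q * G) + t_form * 0)"
    by (intro fat_SucI fat_zero)
  then show ?case by (simp add: mult.assoc del: fat.simps)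
qed

text \<open>In the coordinates of \<open>flat\<close>, a monomial of degree \<open>d + k\<close> with exponent of \<open>z\<close> at most \<open>k\<close> has degree
at least \<open>d\<close> in the other two variables, whose images under \<open>unflat\<close> vanish at \<open>P\<close>.\<close>

lemma unflat_fat:
  assumes "is_form (d + k) F" "zdeg_le k F"
  shows "fat d (unflat F)"
proof -
  have m: "fat d (unflat (monomial m c))" if "m \<in> mons F" for m c
  proof -
    obtain p q l where m: "m = (p, q, l)" by (metis prod_cases3)
    have "p + q + l = d + k" "l \<le> k" using that assms by (auto simp: m is_form_def zdeg_le_def)
    then have "d \<le> p + q" by simp
    moreover have "fat (p + q) (unflat (monomial m c))"
      using fat_power[of p q "const c * var_z ^ l"] by (simp add: m monomial_const unflat_simps mult_ac)
    ultimately show ?thesis by (rule fat_antimono)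
  qed
  have "fat d (\<Sum>m\<in>A. unflat (monomial m (coef F m)))" if "A \<subseteq> mons F" for A
    using finite_subset[OF that finite_keys] that
    by (induction A rule: finite_induct) (auto intro: fat_add fat_zero m)
  from this[OF order_refl] have "fat d (unflat (\<Sum>m\<in>mons F. monomial m (coef F m)))"
    by (simp add: unflat_simps)
  then show ?thesis by (simp only: poly_mapping_sum_monomials[symmetric])
qed

lemma peval_unflat: "peval (unflat F) p = peval F (flat_pt p)"
  by (cases p) (simp add: unflat_def peval_subst_const peval_simps)

lemma is_form_unflat: "is_form n F \<Longrightarrow> is_form n (unflat F)"
proof -
  assume F: "is_form n F"
  have "is_form (Suc 0) s_form" "is_form (Suc 0) t_form"
    by (auto intro!: is_form_diff is_form_const_mult)
  from is_form_subst[OF this is_form_vars(3) F, of const 0] show ?thesis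
    by (simp add: unflat_def const_simps)
qed

lemma unflat_curves:
  assumes "F \<in> curves d"
  shows "unflat F \<in> graded_part (ideal_pts_fat Z d (\<alpha>, \<beta>, \<gamma>)) (d + k)"
proof -
  have F: "is_form (d + k) F" "zdeg_le k F" "\<And>p. p \<in> Z \<Longrightarrow> peval F (flat_pt p) = 0"
    using assms by (auto simp: curves_def)
  have "peval (unflat F) (pscale t p) = 0" if "p \<in> Z" for p t
    unfolding peval_pscale[OF is_form_unflat[OF F(1)]] by (simp add: peval_unflat F(3)[OF that])
  moreover have "peval ((pd_x ^^ i) ((pd_y ^^ j) ((pd_z ^^ l) (unflat F)))) (pscale t (\<alpha>, \<beta>, \<gamma>)) = 0"
    if "i + j + l < d" for i j l t
  proof -
    have "fat (d - l - j - i) ((pd_x ^^ i) ((pd_y ^^ j) ((pd_z ^^ l) (unflat F))))"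
      by (intro fat_funpow derivation_pd unflat_fat F)
    moreover have "d - l - j - i = Suc (d - l - j - i - 1)" using that by simp
    ultimately show ?thesis using peval_fat by metis
  qed
  ultimately show ?thesis
    using is_form_unflat[OF F(1)] by (simp add: graded_part_def ideal_pts_fat_def ideal_pts_def)
qed

lemma dim_fat_ge:
  "form_space.dim (curves d) \<le> form_space.dim (graded_part (ideal_pts_fat Z d (\<alpha>, \<beta>, \<gamma>)) (d + k))"
proof (rule dim_le_correspondence[where K = "\<lambda>F G. G = unflat F"])
  show "curves d \<subseteq> form_space.span ((\<lambda>m. monomial m 1) ` twist_mons (d + k + 1) id (d + k))"
    using forms_span[of "d + k"] by (auto simp: curves_def)
  show "graded_part (ideal_pts_fat Z d (\<alpha>, \<beta>, \<gamma>)) (d + k) \<subseteq>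
     form_space.span ((\<lambda>m. monomial m 1) ` twist_mons (d + k + 1) id (d + k))"
    using forms_span[of "d + k"] by (auto simp: graded_part_def)
  show "\<exists>G\<in>graded_part (ideal_pts_fat Z d (\<alpha>, \<beta>, \<gamma>)) (d + k). G = unflat F" if "F \<in> curves d" for F
    using unflat_curves[OF that] by blast
  show "c *s G = unflat (c *s F)" if "G = unflat F" for c F G
    using that by (simp add: smul_eq_const_mult[of c] unflat_simps)
  show "F = 0" if "0 = unflat F" for F using that unflat_eq_0_iff[of F] by simp
qed (simp_all add: finite_twist_mons unflat_simps(1,3))

end

section \<open>Independent conditions\<close>

lemma dim_ideal_pts:
  assumes "finite Z" "independent_conditions Z n"
  shows "form_space.dim (graded_part (ideal_pts Z) n) + card Z \<le> (\<Sum>i<n + 1. n + 1 - i)"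
proof -
  let ?A = "twist_mons (n + 1) id n" and ?W = "(\<lambda>m. monomial m (1::complex)) ` twist_mons (n + 1) id n"
  have U: "{F :: S. is_form n F} = {F. mons F \<subseteq> ?A}"
    by (fastforce simp: is_form_def twist_mons_def)
  have "\<forall>p\<in>Z. c p = 0" if "\<And>F. F \<in> {F. is_form n F} \<Longrightarrow> (\<Sum>p\<in>Z. c p * peval F p) = 0" for c
    using assms(2) that unfolding independent_conditions_def by blast
  then have "form_space.dim {F \<in> {F. is_form n F}. \<forall>p\<in>Z. peval F p = 0} + card Z \<le> form_space.dim {F :: S. is_form n F}"
    using forms_span[of n] unfolding U
    by (intro dim_independent_kernels[OF assms(1) subspace_mons, of _ ?W]) (auto simp: finite_twist_mons functional_peval)
  moreover have "graded_part (ideal_pts Z) n \<subseteq> {F \<in> {F. is_form n F}. \<forall>p\<in>Z. peval F p = 0}"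
  proof
    fix F assume F: "F \<in> graded_part (ideal_pts Z) n"
    have "peval F p = 0" if "p \<in> Z" for p
    proof -
      have "peval F (pscale 1 p) = 0" using F that by (simp add: graded_part_def ideal_pts_def)
      then show ?thesis by (cases p) simp
    qed
    then show "F \<in> {F \<in> {F. is_form n F}. \<forall>p\<in>Z. peval F p = 0}"
      using F by (simp add: graded_part_def)
  qed
  then have "form_space.dim (graded_part (ideal_pts Z) n) \<le> form_space.dim {F \<in> {F. is_form n F}. \<forall>p\<in>Z. peval F p = 0}"
    using forms_span[of n] by (intro dim_mono_finite[of _ _ ?W]) (auto simp: finite_twist_mons)
  moreover have "form_space.dim {F :: S. is_form n F} = (\<Sum>i<n + 1. n + 1 - i)"
    unfolding U by (simp add: dim_mons finite_twist_mons card_twist_mons)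
  ultimately show ?thesis by linarith
qed

context generic_line
begin

section \<open>The curve of a syzygy\<close>

text \<open>Any form of positive degree is nilpotent modulo the equation of the line and \<open>x ^ k\<close>, \<open>y ^ k\<close>:
on the line, each monomial of degree at least \<open>2 k\<close> is divisible by one of these powers.\<close>

lemma syz_line_kernel_form:
  assumes v: "v \<in> syz k Z" "flat v = 0" and h: "pos_form h"
  shows "\<exists>N. smul (h ^ N) v \<in> den syz_line"
proof -
  obtain n where n: "is_form n h" "n > 0" using h by (auto simp: pos_form_def nonzero_form_def)
  let ?R = "red (h ^ (2 * k))"
  have R: "is_form (n * (2 * k)) ?R" "zdeg_le 0 ?R"
    by (intro is_form_red is_form_power n zdeg_le_red)+
  have m: "smul (monomial m c) v \<in> den syz_line" if m: "m \<in> mons ?R" for m and c :: complex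
  proof -
    obtain i j l where ijl: "m = (i, j, l)" by (metis prod_cases3)
    have "l = 0" using m R(2) by (auto simp: ijl zdeg_le_def)
    moreover have "mdeg m = n * (2 * k)" using m R(1) unfolding is_form_def by blast
    ultimately have "i + j = n * (2 * k)" by (simp add: ijl)
    moreover have "2 * k \<le> n * (2 * k)" using n(2) by simp
    ultimately have "k \<le> i \<or> k \<le> j" by linarith
    then obtain u a where u: "u = var_x \<or> u = var_y" "monomial m c = a * u ^ k"
    proof
      assume "k \<le> i"
      then have "monomial m c = monomial (i - k, j, l) c * var_x ^ k"
        by (simp add: ijl var_power_monomial mult_single)
      then show ?thesis using that by blast
    next
      assume "k \<le> j"
      then have "monomial m c = monomial (i, j - k, l) c * var_y ^ k"
        by (simp add: ijl var_power_monomial mult_single)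
      then show ?thesis using that by blast
    qed
    have "smul a (smul (u ^ k) v) \<in> den syz_line"
      by (intro den_syz_line_smul syz_line_kernel v u)
    then show ?thesis using u(2) by simp
  qed
  have "smul (\<Sum>m\<in>A. monomial m (coef ?R m)) v \<in> den syz_line" if "A \<subseteq> mons ?R" for A
    using finite_subset[OF that finite_keys] that
  proof (induction A rule: finite_induct)
    case empty
    have "smul 0 v = 0" by (simp add: smul_const const_simps)
    then show ?case using zero_in_den by simp
  next
    case (insert x A)
    then show ?case by (simp add: free_mod.scale_left_distrib den_syz_line_add m)
  qed
  from this[OF order_refl] have "smul ?R v \<in> den syz_line"
    by (simp flip: poly_mapping_sum_monomials)
  moreover obtain b where "h ^ (2 * k) - ?R = lf * b" using line_dvd_diff_red by blast
  then have "h ^ (2 * k) = ?R + lf * b" by (simp add: algebra_simps)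
  then have "smul (h ^ (2 * k)) v = smul ?R v + smul (lf * b) v"
    by (metis free_mod.scale_left_distrib)
  ultimately have "smul (h ^ (2 * k)) v \<in> den syz_line"
    using den_syz_line_add[OF _ line_in_den[OF v(1)]] by (simp only:)
  then show ?thesis by blast
qed

lemma section_class:
  assumes "X \<in> sections syz_line d h"
  obtains v n where "X = frac_rel syz_line d h `` {(v, n)}" "(v, n) \<in> fracs syz_line d h" "(v, n) \<in> X"
proof -
  obtain v n where v: "(v, n) \<in> fracs syz_line d h" "X = frac_rel syz_line d h `` {(v, n)}"
    using assms unfolding sections_def quotient_def by auto
  have "((v, n), (v, n)) \<in> frac_rel syz_line d h"
    using v zero_in_den by (auto simp: frac_rel_def smul_const)
  then show thesis using that v by blast
qed

text \<open>The map \<open>flat\<close> is defined on all tuples and kills both the Euler elements and the equation of the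
line, so it does not see the difference between a section and the tuple that represents it.\<close>

lemma represented_section:
  assumes "represents k (\<alpha>, \<beta>, \<gamma>) d \<sigma> g" "pos_form h" "(v, n) \<in> \<sigma> h"
  shows "\<exists>N. red h ^ N * (flat v - red h ^ n * flat g) = 0"
proof -
  have "((v, n), (g, 0)) \<in> frac_rel (restrict_line lf (Der0_mod k)) d h"
    using assms unfolding represents_def by blast
  then obtain N where "smul (h ^ N) (smul (h ^ 0) v - smul (h ^ n) g) \<in> den (restrict_line lf (Der0_mod k))"
    unfolding frac_rel_def by blast
  then obtain e w where ew: "e \<in> euler_span k" "smul (h ^ N) (smul (h ^ 0) v - smul (h ^ n) g) = e + smul lf w"
    unfolding restrict_line_def Der0_mod_def by auto
  obtain q where "e = euler * q" using euler_span_multiple[OF ew(1)] by blast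
  then have "flat (smul (h ^ N) (smul (h ^ 0) v - smul (h ^ n) g)) = 0"
    unfolding ew(2) by (simp add: flat_simps flat_smul red_line flat_euler)
  then have "red h ^ N * (flat v - red h ^ n * flat g) = 0"
    by (simp add: flat_smul flat_simps red_simps)
  then show ?thesis by blast
qed

text \<open>The curve passes through \<open>p\<close> because, on a chart containing the foot of \<open>p\<close>, the tuple agrees with a
syzygy. If its equation were \<open>0\<close>, each local representative \<open>v\<close> of the section would satisfy
\<open>flat v = 0\<close> and so be annihilated by a power of the denominator; then the section itself would be
zero.\<close>

theorem syzygy_curve:
  assumes "nonzero_syzygy_on_line k Z (\<alpha>, \<beta>, \<gamma>) d g"
  shows "flat g \<in> curves d" "flat g \<noteq> 0"
proof -
  obtain \<sigma> h0 where sec: "\<And>h. pos_form h \<Longrightarrow> \<sigma> h \<in> sections syz_line d h"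
    and h0: "pos_form h0" "\<sigma> h0 \<noteq> sec_zero syz_line d h0"
    and rep: "represents k (\<alpha>, \<beta>, \<gamma>) d \<sigma> g"
    using assms unfolding nonzero_syzygy_on_line_def Let_def global_section_def by blast
  have g: "is_form k g" "coef_form d g" using rep unfolding represents_def Der_def coef_form_def by auto
  have "peval (flat g) (flat_pt p) = 0" if p: "p \<in> Z" for p
  proof -
    obtain x y z where xyz: "foot p = (x, y, z)" by (metis prod_cases3)
    have "\<exists>h. chart h \<and> peval h (foot p) \<noteq> 0"
    proof (cases "x = 0")
      case True
      then have "y \<noteq> 0" using foot_nonzero[OF p xyz] by simp
      then show ?thesis by (intro exI[of _ var_y]) (simp add: xyz)
    next
      case False
      then show ?thesis by (intro exI[of _ var_x]) (simp add: xyz)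
    qed
    then obtain h where h: "chart h" "peval h (foot p) \<noteq> 0" by blast
    obtain v n where v: "(v, n) \<in> fracs syz_line d h" "(v, n) \<in> \<sigma> h"
      using section_class[OF sec[OF chartD(3)[OF h(1)]]] by metis
    obtain N where N: "red h ^ N * (flat v - red h ^ n * flat g) = 0"
      using represented_section[OF rep chartD(3)[OF h(1)] v(2)] by blast
    have "v \<in> syz k Z" using v(1) by (simp add: fracs_iff num_syz_line)
    then show ?thesis
      using arg_cong[OF N, of "\<lambda>q. peval q (flat_pt p)"] h(2) syz_vanish[OF _ p, of v]
      by (simp add: peval_simps peval_red_flat_pt)
  qed
  then show "flat g \<in> curves d"
    using g is_form_flat[OF g(1)] zdeg_le_flat[OF g(1)] unfolding curves_def coef_form_def by blast
  show "flat g \<noteq> 0"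
  proof
    assume g0: "flat g = 0"
    have den: "\<exists>N. smul (h0 ^ N) v \<in> den syz_line" if v: "v \<in> syz k Z" "(v, n) \<in> \<sigma> h0" for v n
    proof (cases "red h0 = 0")
      case True
      then obtain b where "h0 = lf * b" unfolding red_eq_0_iff by blast
      then have "smul (h0 ^ 1) v \<in> den syz_line" using line_in_den[OF v(1), of b] by simp
      then show ?thesis by blast
    next
      case False
      then have "flat v = 0" using represented_section[OF rep h0(1) v(2)] g0 by simp
      then show ?thesis using syz_line_kernel_form[OF v(1) _ h0(1)] by blast
    qed
    obtain v n where vn: "\<sigma> h0 = frac_rel syz_line d h0 `` {(v, n)}" "(v, n) \<in> fracs syz_line d h0"
        "(v, n) \<in> \<sigma> h0"
      by (rule section_class[OF sec[OF h0(1)]])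
    have v: "v \<in> syz k Z" using vn(2) by (simp add: fracs_iff num_syz_line)
    obtain N where N: "smul (h0 ^ N) v \<in> den syz_line" using den[OF v vn(3)] by blast
    \<comment> \<open>A section is zero if and only if a power of \<open>h0\<close> annihilates its numerator.\<close>
    have z: "sec_zero syz_line d h0 = {(w, m). (w, m) \<in> fracs syz_line d h0 \<and> (\<exists>N. smul (h0 ^ N) w \<in> den syz_line)}"
    proof -
      have "(0, 0) \<in> fracs syz_line d h0"
        using euler_span_syz[of 0] by (simp add: fracs_iff num_syz_line euler_span_def free_mod.span_zero)
      moreover have "smul r (smul s 0 - smul 1 w) \<in> den syz_line \<longleftrightarrow> smul r w \<in> den syz_line" for r s w
      proof -
        have e: "smul r (smul s 0 - smul 1 w) = smul (- 1) (smul r w)" "smul r w = smul (- 1) (smul r (smul s 0 - smul 1 w))"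
          by (simp_all add: smul_const const_simps)
        show ?thesis using den_syz_line_smul[of "smul r w" "- 1"]
            den_syz_line_smul[of "smul r (smul s 0 - smul 1 w)" "- 1"] e by metis
      qed
      ultimately show ?thesis unfolding sec_zero_def frac_rel_def by auto
    qed
    have "(w, m) \<in> \<sigma> h0 \<longleftrightarrow> (w, m) \<in> sec_zero syz_line d h0" for w m
    proof
      assume w: "(w, m) \<in> \<sigma> h0"
      then have f: "(w, m) \<in> fracs syz_line d h0" unfolding vn(1) by (auto simp: frac_rel_def)
      then have "w \<in> syz k Z" by (simp add: fracs_iff num_syz_line)
      then show "(w, m) \<in> sec_zero syz_line d h0" unfolding z using den w f by blast
    next
      assume "(w, m) \<in> sec_zero syz_line d h0"
      then obtain M where M: "(w, m) \<in> fracs syz_line d h0" "smul (h0 ^ M) w \<in> den syz_line"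
        unfolding z by blast
      have "smul (h0 ^ (N + M)) (smul (h0 ^ m) v - smul (h0 ^ n) w)
          = smul (h0 ^ (M + m)) (smul (h0 ^ N) v) + smul (- (h0 ^ (N + n))) (smul (h0 ^ M) w)"
        by (simp add: smul_const const_simps power_add algebra_simps)
      then have "smul (h0 ^ (N + M)) (smul (h0 ^ m) v - smul (h0 ^ n) w) \<in> den syz_line"
        using N M(2) by (simp only: den_syz_line_add den_syz_line_smul)
      then show "(w, m) \<in> \<sigma> h0" unfolding vn(1) frac_rel_def using vn(2) M(1) by blast
    qed
    then have "\<sigma> h0 = sec_zero syz_line d h0" by (auto simp: set_eq_iff)
    then show False using h0(2) by simp
  qed
qed

text \<open>The hypothesis on \<open>as\<close> measures the truncated terms: \<open>\<Sum>\<^sub>i max 0 (d + 1 - a\<^sub>i)\<close> is equal to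
\<open>\<Sum>\<^sub>i (d + 1 - a\<^sub>i)\<close> plus the sum of \<open>max 0 (a\<^sub>i - d - 1)\<close>. The rest is the identity
\<open>(d + k + 1) (d + k + 2) - d (d + 1) - k (k + 1) = 2 (k + 1) (d + 1)\<close>.\<close>

theorem unexpected_of_dim:
  assumes Z0: "0 \<notin> Z" and split: "splitting_type k Z (\<alpha>, \<beta>, \<gamma>) as"
    and syz: "nonzero_syzygy_on_line k Z (\<alpha>, \<beta>, \<gamma>) d g"
    and ind: "independent_conditions Z (d + k)"
    and pos: "0 < (\<Sum>i<k + 1. int (as ! i - (d + 1)))"
    and d: "d \<in> set as"
  shows "unexpected_curve Z (\<alpha>, \<beta>, \<gamma>) (d + k) d (curve_CL (\<alpha>, \<beta>, \<gamma>) g)"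
proof -
  let ?fat = "graded_part (ideal_pts_fat Z d (\<alpha>, \<beta>, \<gamma>)) (d + k)" and ?I = "graded_part (ideal_pts Z) (d + k)"
  have len: "length as = k + 1" using split by (simp add: splitting_type_def)
  have F: "curve_CL (\<alpha>, \<beta>, \<gamma>) g \<in> ?fat" "curve_CL (\<alpha>, \<beta>, \<gamma>) g \<noteq> 0"
    using syzygy_curve[OF syz] by (simp_all only: curve_CL_eq unflat_curves unflat_eq_0_iff not_False_eq_True)
  have fat: "(\<Sum>i<k + 1. d + 1 - as ! i) \<le> form_space.dim ?fat"
    using dim_fat_ge[of d] dim_curves[OF Z0 split, of d] by simp
  have "int (\<Sum>i<k + 1. d + 1 - as ! i) = (\<Sum>i<k + 1. (int d + 1 - int (as ! i)) + int (as ! i - (d + 1)))"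
    unfolding of_nat_sum by (intro sum.cong) auto
  then have 1: "int (\<Sum>i<k + 1. d + 1 - as ! i)
      = (int k + 1) * (int d + 1) - int (\<Sum>i<k + 1. as ! i) + (\<Sum>i<k + 1. int (as ! i - (d + 1)))"
    by (simp only: sum.distrib sum_subtractf of_nat_sum sum_constant card_lessThan) (simp add: algebra_simps)
  \<comment> \<open>Triangular numbers count the monomials of a given degree, here and in \<open>sum_splitting_type\<close>.\<close>
  have tri: "2 * (\<Sum>i<n. n - i) = n * (n + 1)" for n :: nat
  proof (induction n)
    case (Suc n)
    have "(\<Sum>i<Suc n. Suc n - i) = Suc n + (\<Sum>i<n. n - i)"
      by (subst sum.lessThan_Suc_shift) simp
    then show ?case using Suc by simp
  qed simp
  have "2 * (\<Sum>i<k + 1. k - i) = k * (k + 1)" using tri[of k] by simp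
  then have 2: "2 * (\<Sum>i<k + 1. as ! i) + k * (k + 1) \<le> 2 * card Z"
    using sum_splitting_type[OF Z0 split] by linarith
  have 3: "2 * form_space.dim ?I + 2 * card Z \<le> (d + k + 1) * (d + k + 2)"
    using dim_ideal_pts[OF fin ind] tri[of "d + k + 1"] by simp
  have 4: "2 * ((d + 1) choose 2) = d * (d + 1)"
    by (simp add: choose_two)
  have "2 * int (form_space.dim ?I) + 2 * int (card Z) \<le> (int d + int k + 1) * (int d + int k + 2)"
    using 3 by (metis (mono_tags, lifting) of_nat_le_iff of_nat_add of_nat_mult of_nat_1 of_nat_numeral)
  moreover have "2 * int (\<Sum>i<k + 1. as ! i) + int k * (int k + 1) \<le> 2 * int (card Z)"
    using 2 by (metis (mono_tags, lifting) of_nat_le_iff of_nat_add of_nat_mult of_nat_1 of_nat_numeral)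
  moreover have "2 * int ((d + 1) choose 2) = int d * (int d + 1)"
    using 4 by (metis (mono_tags, lifting) of_nat_add of_nat_mult of_nat_1 of_nat_numeral)
  ultimately have "2 * (int (form_space.dim ?I) - int ((d + 1) choose 2))
      \<le> 2 * ((int k + 1) * (int d + 1) - int (\<Sum>i<k + 1. as ! i))"
    by (simp add: algebra_simps)
  then have "int (form_space.dim ?I) - int ((d + 1) choose 2)
      \<le> (int k + 1) * (int d + 1) - int (\<Sum>i<k + 1. as ! i)"
    by (simp only: mult_le_cancel_left_pos zero_less_numeral)
  also have "\<dots> < int (\<Sum>i<k + 1. d + 1 - as ! i)"
    unfolding 1 using pos by (simp only: less_add_same_cancel1)
  also have "\<dots> \<le> int (form_space.dim ?fat)"
    using fat by (simp only: of_nat_le_iff)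
  finally have "int (form_space.dim ?I) - int ((d + 1) choose 2) < int (form_space.dim ?fat)" .
  moreover have "0 < form_space.dim ?fat"
  proof -
    obtain i where i: "i < k + 1" "as ! i = d" using d len by (metis in_set_conv_nth)
    then have "d + 1 - as ! i \<le> (\<Sum>i<k + 1. d + 1 - as ! i)" by (intro member_le_sum) auto
    then show ?thesis using i fat by simp
  qed
  ultimately show ?thesis
    using F ind unfolding unexpected_curve_def by simp
qed

end

section \<open>General points\<close>

lemma dual_line_nonzero:
  assumes "w \<noteq> 0"
  shows "nonzero_form (dual_line w)"
proof -
  obtain a b c where w: "w = (a, b, c)" by (metis prod_cases3)
  have "is_form (Suc 0) (dual_line w)"
    by (auto simp: w dual_line.simps intro!: is_form_add is_form_const_mult)
  moreover have "dual_line w \<noteq> 0"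
  proof
    assume z: "dual_line w = 0"
    have "a = 0" "b = 0" "c = 0"
      using arg_cong[OF z, of "\<lambda>q. peval q (1, 0, 0)"] arg_cong[OF z, of "\<lambda>q. peval q (0, 1, 0)"]
        arg_cong[OF z, of "\<lambda>q. peval q (0, 0, 1)"]
      by (simp_all add: w peval_dual_line peval_simps)
    then show False using assms w by (simp add: zero_prod_def)
  qed
  ultimately show ?thesis by (auto simp: nonzero_form_iff)
qed

text \<open>The cross product, up to sign. Its dual line is the line of the points \<open>P\<close> collinear with \<open>p\<close> and \<open>q\<close>.\<close>

fun cross :: "point \<Rightarrow> point \<Rightarrow> point" where
  "cross (a, b, c) (a', b', c') = (b' * c - c' * b, c' * a - a' * c, a' * b - b' * a)"

lemma cross_eq_0:
  assumes "cross p q = 0" "p \<noteq> 0" "q \<noteq> 0"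
  shows "same_point p q"
proof -
  obtain a b c where p: "p = (a, b, c)" by (metis prod_cases3)
  obtain a' b' c' where q: "q = (a', b', c')" by (metis prod_cases3)
  have e: "b' * c = c' * b" "c' * a = a' * c" "a' * b = b' * a"
    using assms(1) by (simp_all add: p q zero_prod_def)
  have "\<exists>t. q = pscale t p"
  proof -
    have "a \<noteq> 0 \<or> b \<noteq> 0 \<or> c \<noteq> 0" using assms(2) by (auto simp: p zero_prod_def)
    then show ?thesis
    proof (elim disjE)
      assume "a \<noteq> 0" then show ?thesis using e by (intro exI[of _ "a' / a"]) (simp add: p q field_simps)
    next
      assume "b \<noteq> 0" then show ?thesis using e by (intro exI[of _ "b' / b"]) (simp add: p q field_simps)
    next
      assume "c \<noteq> 0" then show ?thesis using e by (intro exI[of _ "c' / c"]) (simp add: p q field_simps)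
    qed
  qed
  then obtain t where t: "q = pscale t p" by blast
  moreover have "t \<noteq> 0" using assms(3) t by (auto simp: p zero_prod_def)
  ultimately show ?thesis unfolding same_point_def by blast
qed

lemma exists_orthogonal: "\<exists>w. w \<noteq> 0 \<and> (\<exists>a b c. w = (a, b, c) \<and> a * x + b * y + c * z = (0::complex))"
proof (cases "x = 0 \<and> y = 0")
  case True
  then show ?thesis by (intro exI[of _ "(1, 0, 0)"]) (simp add: zero_prod_def)
next
  case False
  then show ?thesis by (intro exI[of _ "(y, - x, 0)"]) (auto simp: zero_prod_def)
qed

text \<open>The excluded curve is a union of lines: \<open>z = 0\<close>, one line through each point of \<open>Z\<close>, and the lines
joining two points of \<open>Z\<close>. A line through \<open>p\<close> avoiding \<open>P\<close> shows that \<open>P \<noteq> p\<close>.\<close>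

lemma general_point_generic_line:
  assumes Z: "point_set Z" and k: "k \<ge> 1"
  shows "for_general_point (\<lambda>P. \<exists>\<alpha> \<beta> \<gamma>. P = (\<alpha>, \<beta>, \<gamma>) \<and> generic_line \<alpha> \<beta> \<gamma> Z k)"
proof -
  have fin: "finite Z" and nz: "\<And>p. p \<in> Z \<Longrightarrow> p \<noteq> 0"
    and ns: "\<And>p q. p \<in> Z \<Longrightarrow> q \<in> Z \<Longrightarrow> p \<noteq> q \<Longrightarrow> \<not> same_point p q"
    using Z by (auto simp: point_set_def)
  obtain w where w: "\<And>p. w p \<noteq> 0" "\<And>p. peval (dual_line (w p)) p = 0"
  proof -
    have "\<exists>w. w \<noteq> 0 \<and> peval (dual_line w) p = 0" for p
      using exists_orthogonal[of "fst p" "fst (snd p)" "snd (snd p)"]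
      by (cases p) (auto simp: peval_dual_line)
    then show thesis using that by metis
  qed
  define h where "h = var_z * ((\<Prod>p\<in>Z. dual_line (w p)) * (\<Prod>p\<in>Z. \<Prod>q\<in>Z - {p}. dual_line (cross p q)))"
  have "nonzero_form h"
    unfolding h_def
  proof (intro nonzero_form_mult nonzero_form_prod dual_line_nonzero w)
    show "nonzero_form var_z"
      unfolding nonzero_form_iff using is_form_vars(3)[where 'c = complex] vars_nonzero(3) by blast
    show "cross p q \<noteq> 0" if "p \<in> Z" "q \<in> Z - {p}" for p q
      using that cross_eq_0[of p q] nz[of p] nz[of q] ns[of p q] by blast
  qed
  moreover have "\<exists>\<alpha> \<beta> \<gamma>. P = (\<alpha>, \<beta>, \<gamma>) \<and> generic_line \<alpha> \<beta> \<gamma> Z k" if "peval h P \<noteq> 0" for P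
  proof -
    obtain \<alpha> \<beta> \<gamma> where P: "P = (\<alpha>, \<beta>, \<gamma>)" by (metis prod_cases3)
    have g: "\<gamma> \<noteq> 0" and wP: "\<And>p. p \<in> Z \<Longrightarrow> peval (dual_line (w p)) P \<noteq> 0"
      and cP: "\<And>p q. p \<in> Z \<Longrightarrow> q \<in> Z \<Longrightarrow> p \<noteq> q \<Longrightarrow> peval (dual_line (cross p q)) P \<noteq> 0"
      using that fin by (auto simp: h_def peval_simps P)
    interpret line \<alpha> \<beta> \<gamma> by (unfold_locales) (rule g)
    have "generic_line \<alpha> \<beta> \<gamma> Z k"
    proof
      fix p x y z assume p: "p \<in> Z" and xyz: "foot p = (x, y, z)"
      show "(x, y) \<noteq> (0, 0)"
      proof
        assume "(x, y) = (0, 0)"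
        obtain a b c where abc: "p = (a, b, c)" by (metis prod_cases3)
        obtain u v t where uvt: "w p = (u, v, t)" by (metis prod_cases3)
        have e: "\<gamma> * b = \<beta> * c" "\<alpha> * c = \<gamma> * a"
          using xyz \<open>(x, y) = (0, 0)\<close> by (auto simp: abc)
        have "\<gamma> * (u * a + v * b + t * c) = u * (\<gamma> * a) + v * (\<gamma> * b) + t * \<gamma> * c"
          by (simp add: algebra_simps)
        also have "\<dots> = c * (u * \<alpha> + v * \<beta> + t * \<gamma>)"
          unfolding e(1) e(2)[symmetric] by (simp add: algebra_simps)
        finally have "\<gamma> * (u * a + v * b + t * c) = c * (u * \<alpha> + v * \<beta> + t * \<gamma>)" .
        moreover have "u * a + v * b + t * c = 0" using w(2)[of p] unfolding uvt unfolding abc by (simp add: peval_dual_line)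
        moreover have "u * \<alpha> + v * \<beta> + t * \<gamma> \<noteq> 0" using wP[OF p] by (simp add: uvt P peval_dual_line)
        ultimately have "c = 0" by simp
        then have "p = 0" using e g by (simp add: abc zero_prod_def)
        then show False using nz[OF p] by simp
      qed
    next
      fix p q assume pq: "p \<in> Z" "q \<in> Z" "p \<noteq> q"
      have "peval (dual_line q) (foot p) = peval (dual_line (cross p q)) P"
        by (cases p; cases q) (simp add: P peval_dual_line algebra_simps)
      then show "peval (dual_line q) (foot p) \<noteq> 0" using cP[OF pq] by simp
    qed (rule fin k)+
    then show ?thesis using P by blast
  qed
  ultimately show ?thesis unfolding for_general_point_def by blast
qed

lemma sum_nth_blocks:
  fixes F :: "nat \<Rightarrow> int"
  shows
  "(\<Sum>i<length (concat (map (\<lambda>i. replicate (t i) (b i)) [0..<n])). F (concat (map (\<lambda>i. replicate (t i) (b i)) [0..<n]) ! i))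
    = (\<Sum>i<n. of_nat (t i) * (F (b i) :: int))"
proof -
  let ?xs = "\<lambda>n. concat (map (\<lambda>i. replicate (t i) (b i)) [0..<n])"
  have "sum_list (map F (?xs n)) = (\<Sum>i<n. of_nat (t i) * F (b i))"
    by (induction n) (simp_all add: sum_list_replicate)
  then show ?thesis
    using sum_list_sum_nth[of "map F (?xs n)"] by (simp add: atLeast0LessThan)
qed

theorem proposition5p4:
  fixes k :: nat and Z :: "point set"
  assumes "k \<ge> 1" and "point_set Z"
  shows "for_general_point (\<lambda>P.
    \<forall>(a::nat) (s::nat) (\<epsilon> :: nat \<Rightarrow> nat) (t :: nat \<Rightarrow> nat) (j::nat) g.
      \<epsilon> 0 = 0 \<and> (s \<ge> 1 \<longrightarrow> \<epsilon> 1 \<ge> 1) \<and> (\<forall>i<s. \<epsilon> i < \<epsilon> (i + 1)) \<and>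
      (\<forall>i\<le>s. t i \<ge> 1) \<and> (\<Sum>i\<le>s. t i) = k + 1 \<and>
      splitting_type k Z P (concat (map (\<lambda>i. replicate (t i) (a + \<epsilon> i)) [0..<s + 1])) \<and>
      j \<le> s \<and>
      nonzero_syzygy_on_line k Z P (a + \<epsilon> j) g \<and>
      independent_conditions Z (a + \<epsilon> j + k) \<and>
      0 < (\<Sum>i=j+1..s. int (t i) * (int (\<epsilon> i) - int (\<epsilon> j) - 1)) \<longrightarrow>
      unexpected_curve Z P (a + \<epsilon> j + k) (a + \<epsilon> j) (curve_CL P g))"
proof -
  obtain h where h: "nonzero_form h"
    and generic: "\<And>P. P \<noteq> 0 \<Longrightarrow> peval h P \<noteq> 0 \<Longrightarrow> \<exists>\<alpha> \<beta> \<gamma>. P = (\<alpha>, \<beta>, \<gamma>) \<and> generic_line \<alpha> \<beta> \<gamma> Z k"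
    using general_point_generic_line[OF assms(2,1)] unfolding for_general_point_def by blast
  have Z0: "0 \<notin> Z" using assms(2) by (simp add: point_set_def)
  show ?thesis
    unfolding for_general_point_def
  proof (intro exI[of _ h] conjI h allI impI)
    fix P a s \<epsilon> t j g
    assume P: "P \<noteq> 0 \<and> peval h P \<noteq> 0"
    assume *: "\<epsilon> 0 = 0 \<and> (s \<ge> 1 \<longrightarrow> \<epsilon> 1 \<ge> 1) \<and> (\<forall>i<s. \<epsilon> i < \<epsilon> (i + 1)) \<and>
      (\<forall>i\<le>s. t i \<ge> 1) \<and> (\<Sum>i\<le>s. t i) = k + 1 \<and>
      splitting_type k Z P (concat (map (\<lambda>i. replicate (t i) (a + \<epsilon> i)) [0..<s + 1])) \<and>
      j \<le> s \<and>
      nonzero_syzygy_on_line k Z P (a + \<epsilon> j) g \<and>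
      independent_conditions Z (a + \<epsilon> j + k) \<and>
      0 < (\<Sum>i=j+1..s. int (t i) * (int (\<epsilon> i) - int (\<epsilon> j) - 1))"
    define as where "as = concat (map (\<lambda>i. replicate (t i) (a + \<epsilon> i)) [0..<s + 1])"
    have split: "splitting_type k Z P as" and j: "j \<le> s" and tj: "t j \<ge> 1"
      and pos: "0 < (\<Sum>i=j+1..s. int (t i) * (int (\<epsilon> i) - int (\<epsilon> j) - 1))"
      using * by (simp_all add: as_def)
    have len: "length as = k + 1" using split by (simp add: splitting_type_def)
    have "a + \<epsilon> j \<in> set as" using j tj by (auto simp: as_def intro!: bexI[of _ j])
    moreover have "0 < (\<Sum>i<k + 1. int (as ! i - (a + \<epsilon> j + 1)))"
    proof -
      have "(\<Sum>i=j+1..s. int (t i) * (int (\<epsilon> i) - int (\<epsilon> j) - 1))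
          \<le> (\<Sum>i=j+1..s. int (t i) * int (a + \<epsilon> i - (a + \<epsilon> j + 1)))"
        by (intro sum_mono mult_left_mono) auto
      \<comment> \<open>The subtraction of natural numbers makes the terms with \<open>i \<le> j\<close> vanish.\<close>
      also have "\<dots> \<le> (\<Sum>i<s + 1. int (t i) * int (a + \<epsilon> i - (a + \<epsilon> j + 1)))"
        by (intro sum_mono2) auto
      also have "\<dots> = (\<Sum>i<k + 1. int (as ! i - (a + \<epsilon> j + 1)))"
        using sum_nth_blocks[of "\<lambda>x. int (x - (a + \<epsilon> j + 1))" t "\<lambda>i. a + \<epsilon> i" "s + 1"] len
        by (simp add: as_def)
      finally show ?thesis using pos by linarith
    qed
    moreover obtain \<alpha> \<beta> \<gamma> where "P = (\<alpha>, \<beta>, \<gamma>)" "generic_line \<alpha> \<beta> \<gamma> Z k"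
      using generic P by blast
    ultimately show "unexpected_curve Z P (a + \<epsilon> j + k) (a + \<epsilon> j) (curve_CL P g)"
      using generic_line.unexpected_of_dim[OF _ Z0, of \<alpha> \<beta> \<gamma> k as "a + \<epsilon> j" g] split * by simp
  qed
qed

end
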